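(* For each $c,d>0$ there exists a 3-isometric 2-tuple $(T,S)$ of invertible operators on a complex Hilbert space $\mathcal{H}$, in the class $\mathfrak{F}_{c,d}$, such that the pencil $\hat{Q}_{T,S}$ does not factor. In particular, the 2-tuple $(T,S)$ does not lift to a 2-tuple $(J_1,J_2)$ in the class $\mathfrak{J}_{c,d}$.
   Context: All operators are bounded. A commuting pair $(T_1,T_2)$ of operators on a complex Hilbert space $\mathcal{H}$ is a 3-isometric 2-tuple if there exist bounded operators $B_{i,j}$ on $\mathcal{H}$ ($i,j\ge0$, $i+j\le2$) such that $$T_2^{*m}T_1^{*n}T_1^nT_2^m=\sum_{0\le i+j\le2}n^im^jB_{i,j}$$ for all $n,m\in\mathbb{N}=\{0,1,2,\dots\}$ (so $B_{0,0}=I$). For $(\alpha,\beta)\in\mathbb{R}^2$ put $Q_{T_1,T_2}(\alpha,\beta)=\sum_{0\le i+j\le2}\alpha^i\beta^jB_{i,j}$ and $$\hat{Q}_{T_1,T_2}(\alpha,\beta)=Q_{T_1,T_2}(\alpha,\beta)-\frac1{c^2}B_{2,0}-\frac1{d^2}B_{0,2}.$$ The pair is in the class $\mathfrak{F}_{c,d}$ if $\hat{Q}_{T_1,T_2}(\alpha,\beta)\succeq0$ for all $(\alpha,\beta)\in\mathbb{R}^2$. The pencil $\hat{Q}_{T_1,T_2}$ factors if there are a Hilbert space $K$ and bounded operators $V_0,V_1,V_2:\mathcal{H}\to K$ with $\hat{Q}_{T_1,T_2}(\alpha,\beta)=(V_0+\alpha V_1+\beta V_2)^*(V_0+\alpha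 V_1+\beta V_2)$ for all $(\alpha,\beta)\in\mathbb{R}^2$. A pair $(J_1,J_2)$ is in the class $\mathfrak{J}_{c,d}$ if there are commuting unitary operators $U_1,U_2$ on some Hilbert space $F$ such that, on $F\oplus F\oplus F$, $$J_1=\begin{pmatrix}U_1&cU_1&0\\0&U_1&0\\0&0&U_1\end{pmatrix},\qquad J_2=\begin{pmatrix}U_2&0&dU_2\\0&U_2&0\\0&0&U_2\end{pmatrix}.$$ A pair $(T_1,T_2)$ on $\mathcal{H}$ lifts to $(J_1,J_2)$ on $K$ if there is an isometry $V:\mathcal{H}\to K$ with $VT_i=J_iV$ for $i=1,2$. *)

theory Defs
  imports Complex_Main "HOL-Library.Nonpos_Ints" "HOL-Library.Nat_Bijection" "HOL-Algebra.Module"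
begin

section \<open>Complex Hilbert spaces\<close>

text \<open>
  Hilbert spaces are quantified over inside the statement, so they are values (records with an
  explicit carrier) and not types.
  Operators are functions whose values outside the carrier are irrelevant.
\<close>

definition complex_ring :: "complex ring" where
  "complex_ring = \<lparr>carrier = UNIV, mult = (*), one = 1, zero = 0, add = (+)\<rparr>"

text \<open>The fields \<open>mult\<close> and \<open>one\<close> inherited from \<open>module\<close> play no role.\<close>

record 'a hspace = "(complex, 'a) module" +
  ip :: "'a \<Rightarrow> 'a \<Rightarrow> complex"

definition hnorm :: "'a hspace \<Rightarrow> 'a \<Rightarrow> real" where
  "hnorm H x = sqrt (Re (ip H x x))"

locale hilbert_space = Module.module complex_ring H for H :: "'a hspace" (structure) +
  assumes ip_add:
      "\<lbrakk>x \<in> carrier H; y \<in> carrier H; z \<in> carrier H\<rbrakk> \<Longrightarrow> ip H (x \<oplus> y) z = ip H x z + ip H y z"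
    and ip_smult:
      "\<lbrakk>x \<in> carrier H; y \<in> carrier H\<rbrakk> \<Longrightarrow> ip H (a \<odot> x) y = a * ip H x y"
    and ip_cnj:
      "\<lbrakk>x \<in> carrier H; y \<in> carrier H\<rbrakk> \<Longrightarrow> ip H x y = cnj (ip H y x)"
    and ip_nonneg:
      "x \<in> carrier H \<Longrightarrow> ip H x x \<in> \<real>\<^sub>\<ge>\<^sub>0"
    and ip_definite:
      "\<lbrakk>x \<in> carrier H; ip H x x = 0\<rbrakk> \<Longrightarrow> x = \<zero>"
    and complete:
      "\<lbrakk>range \<sigma> \<subseteq> carrier H;
        \<And>e. e > 0 \<Longrightarrow> \<exists>N. \<forall>m\<ge>N. \<forall>n\<ge>N. hnorm H (\<sigma> m \<ominus> \<sigma> n) < e\<rbrakk>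
       \<Longrightarrow> \<exists>x\<in>carrier H. (\<lambda>n. hnorm H (\<sigma> n \<ominus> x)) \<longlonglongrightarrow> 0"

definition bounded_op :: "'a hspace \<Rightarrow> 'b hspace \<Rightarrow> ('a \<Rightarrow> 'b) \<Rightarrow> bool" where
  "bounded_op H K A \<longleftrightarrow>
     A \<in> carrier H \<rightarrow> carrier K \<and>
     (\<forall>x\<in>carrier H. \<forall>y\<in>carrier H. A (x \<oplus>\<^bsub>H\<^esub> y) = A x \<oplus>\<^bsub>K\<^esub> A y) \<and>
     (\<forall>a. \<forall>x\<in>carrier H. A (a \<odot>\<^bsub>H\<^esub> x) = a \<odot>\<^bsub>K\<^esub> A x) \<and>
     (\<exists>C. \<forall>x\<in>carrier H. hnorm K (A x) \<le> C * hnorm H x)"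

definition is_adjoint :: "'a hspace \<Rightarrow> 'b hspace \<Rightarrow> ('a \<Rightarrow> 'b) \<Rightarrow> ('b \<Rightarrow> 'a) \<Rightarrow> bool" where
  "is_adjoint H K A A' \<longleftrightarrow> bounded_op K H A' \<and>
     (\<forall>x\<in>carrier H. \<forall>y\<in>carrier K. ip K (A x) y = ip H x (A' y))"

text \<open>The adjoint of a bounded operator exists and is unique on the carrier: see
  \<open>is_adjoint_adj\<close> and \<open>adj_unique\<close> below.\<close>

definition adj :: "'a hspace \<Rightarrow> 'b hspace \<Rightarrow> ('a \<Rightarrow> 'b) \<Rightarrow> 'b \<Rightarrow> 'a" where
  "adj H K A = (SOME A'. is_adjoint H K A A')"

definition op_commute :: "'a hspace \<Rightarrow> ('a \<Rightarrow> 'a) \<Rightarrow> ('a \<Rightarrow> 'a) \<Rightarrow> bool" where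
  "op_commute H A B \<longleftrightarrow> (\<forall>x\<in>carrier H. A (B x) = B (A x))"

definition invertible_op :: "'a hspace \<Rightarrow> ('a \<Rightarrow> 'a) \<Rightarrow> bool" where
  "invertible_op H A \<longleftrightarrow> bounded_op H H A \<and>
     (\<exists>B. bounded_op H H B \<and> (\<forall>x\<in>carrier H. A (B x) = x \<and> B (A x) = x))"

definition pos_op :: "'a hspace \<Rightarrow> ('a \<Rightarrow> 'a) \<Rightarrow> bool" where
  "pos_op H A \<longleftrightarrow> (\<forall>x\<in>carrier H. ip H (A x) x \<in> \<real>\<^sub>\<ge>\<^sub>0)"

definition isometry :: "'a hspace \<Rightarrow> 'b hspace \<Rightarrow> ('a \<Rightarrow> 'b) \<Rightarrow> bool" where
  "isometry H K V \<longleftrightarrow> bounded_op H K V \<and> (\<forall>x\<in>carrier H. hnorm K (V x) = hnorm H x)"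

definition unitary :: "'a hspace \<Rightarrow> ('a \<Rightarrow> 'a) \<Rightarrow> bool" where
  "unitary H U \<longleftrightarrow> bounded_op H H U \<and>
     (\<forall>x\<in>carrier H. adj H H U (U x) = x \<and> U (adj H H U x) = x)"

section \<open>3-isometric pairs\<close>

definition quad_pencil ::
  "'a hspace \<Rightarrow> (nat \<Rightarrow> nat \<Rightarrow> 'a \<Rightarrow> 'a) \<Rightarrow> real \<Rightarrow> real \<Rightarrow> 'a \<Rightarrow> 'a" where
  "quad_pencil H B \<alpha> \<beta> x =
     finsum H (\<lambda>(i, j). complex_of_real (\<alpha> ^ i * \<beta> ^ j) \<odot>\<^bsub>H\<^esub> B i j x) {(i, j). i + j \<le> 2}"

definition is_coeffs ::
  "'a hspace \<Rightarrow> ('a \<Rightarrow> 'a) \<Rightarrow> ('a \<Rightarrow> 'a) \<Rightarrow> (nat \<Rightarrow> nat \<Rightarrow> 'a \<Rightarrow> 'a) \<Rightarrow> bool" where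
  "is_coeffs H T1 T2 B \<longleftrightarrow>
     (\<forall>i j. i + j \<le> 2 \<longrightarrow> bounded_op H H (B i j)) \<and>
     (\<forall>n m. \<forall>x\<in>carrier H.
        ((adj H H T2 ^^ m) \<circ> (adj H H T1 ^^ n) \<circ> (T1 ^^ n) \<circ> (T2 ^^ m)) x =
        quad_pencil H B (real n) (real m) x)"

definition three_isometric :: "'a hspace \<Rightarrow> ('a \<Rightarrow> 'a) \<Rightarrow> ('a \<Rightarrow> 'a) \<Rightarrow> bool" where
  "three_isometric H T1 T2 \<longleftrightarrow>
     bounded_op H H T1 \<and> bounded_op H H T2 \<and> op_commute H T1 T2 \<and> (\<exists>B. is_coeffs H T1 T2 B)"

text \<open>For a 3-isometric pair the operators \<open>B\<^sub>i\<^sub>j\<close> are unique on the carrier: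
  see \<open>coeffs_unique\<close> below.\<close>

definition coeffs :: "'a hspace \<Rightarrow> ('a \<Rightarrow> 'a) \<Rightarrow> ('a \<Rightarrow> 'a) \<Rightarrow> nat \<Rightarrow> nat \<Rightarrow> 'a \<Rightarrow> 'a" where
  "coeffs H T1 T2 = (SOME B. is_coeffs H T1 T2 B)"

definition Qpencil :: "'a hspace \<Rightarrow> ('a \<Rightarrow> 'a) \<Rightarrow> ('a \<Rightarrow> 'a) \<Rightarrow> real \<Rightarrow> real \<Rightarrow> 'a \<Rightarrow> 'a" where
  "Qpencil H T1 T2 = quad_pencil H (coeffs H T1 T2)"

definition Qhat ::
  "real \<Rightarrow> real \<Rightarrow> 'a hspace \<Rightarrow> ('a \<Rightarrow> 'a) \<Rightarrow> ('a \<Rightarrow> 'a) \<Rightarrow> real \<Rightarrow> real \<Rightarrow> 'a \<Rightarrow> 'a" where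
  "Qhat c d H T1 T2 \<alpha> \<beta> x =
     Qpencil H T1 T2 \<alpha> \<beta> x
       \<ominus>\<^bsub>H\<^esub> complex_of_real (1 / c\<^sup>2) \<odot>\<^bsub>H\<^esub> coeffs H T1 T2 2 0 x
       \<ominus>\<^bsub>H\<^esub> complex_of_real (1 / d\<^sup>2) \<odot>\<^bsub>H\<^esub> coeffs H T1 T2 0 2 x"

definition class_F :: "real \<Rightarrow> real \<Rightarrow> 'a hspace \<Rightarrow> ('a \<Rightarrow> 'a) \<Rightarrow> ('a \<Rightarrow> 'a) \<Rightarrow> bool" where
  "class_F c d H T1 T2 \<longleftrightarrow>
     three_isometric H T1 T2 \<and> (\<forall>\<alpha> \<beta>. pos_op H (Qhat c d H T1 T2 \<alpha> \<beta>))"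

section \<open>Factorizations and lifts\<close>

text \<open>
  The definitions \<open>pencil_factors\<close> and \<open>lifts_to_class_J\<close> ask for some auxiliary Hilbert space.
  HOL cannot quantify over the type of its elements, so the space is taken with carrier in
  \<open>'h universe\<close>, where \<open>'h\<close> is the type of the elements of the given space. This is no
  restriction: \<open>pencil_factorsI\<close> and \<open>lifts_to_class_JI\<close> below show that a
  factorization or lift through a Hilbert space over any type whatsoever yields one
  through a Hilbert space over \<open>'h universe\<close>.
\<close>

type_synonym 'h universe = "nat \<Rightarrow> (complex \<times> nat \<times> 'h) list"

definition factors_through ::
  "real \<Rightarrow> real \<Rightarrow> 'a hspace \<Rightarrow> ('a \<Rightarrow> 'a) \<Rightarrow> ('a \<Rightarrow> 'a) \<Rightarrow> 'k hspace \<Rightarrow> bool" where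
  "factors_through c d H T1 T2 K \<longleftrightarrow>
     (\<exists>V0 V1 V2. bounded_op H K V0 \<and> bounded_op H K V1 \<and> bounded_op H K V2 \<and>
        (\<forall>\<alpha> \<beta>. let W = (\<lambda>x. V0 x \<oplus>\<^bsub>K\<^esub> complex_of_real \<alpha> \<odot>\<^bsub>K\<^esub> V1 x
                                  \<oplus>\<^bsub>K\<^esub> complex_of_real \<beta> \<odot>\<^bsub>K\<^esub> V2 x)
               in \<forall>x\<in>carrier H. Qhat c d H T1 T2 \<alpha> \<beta> x = adj H K W (W x)))"

definition pencil_factors ::
  "real \<Rightarrow> real \<Rightarrow> 'h hspace \<Rightarrow> ('h \<Rightarrow> 'h) \<Rightarrow> ('h \<Rightarrow> 'h) \<Rightarrow> bool" where
  "pencil_factors c d H T1 T2 \<longleftrightarrow>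
     (\<exists>K :: 'h universe hspace. hilbert_space K \<and> factors_through c d H T1 T2 K)"

definition dsum3 :: "'a hspace \<Rightarrow> ('a \<times> 'a \<times> 'a) hspace" where
  "dsum3 F =
     \<lparr>carrier = carrier F \<times> carrier F \<times> carrier F,
      mult = undefined, one = undefined,
      zero = (\<zero>\<^bsub>F\<^esub>, \<zero>\<^bsub>F\<^esub>, \<zero>\<^bsub>F\<^esub>),
      add = (\<lambda>(f, g, h) (f', g', h'). (f \<oplus>\<^bsub>F\<^esub> f', g \<oplus>\<^bsub>F\<^esub> g', h \<oplus>\<^bsub>F\<^esub> h')),
      smult = (\<lambda>a (f, g, h). (a \<odot>\<^bsub>F\<^esub> f, a \<odot>\<^bsub>F\<^esub> g, a \<odot>\<^bsub>F\<^esub> h)),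
      ip = (\<lambda>(f, g, h) (f', g', h'). ip F f f' + ip F g g' + ip F h h')\<rparr>"

text \<open>\<open>F\<close> is the Hilbert space on which the unitaries act, so \<open>J1\<close> and \<open>J2\<close> act on
  \<open>dsum3 F\<close>.\<close>

definition class_J ::
  "real \<Rightarrow> real \<Rightarrow> 'f hspace \<Rightarrow> ('f \<times> 'f \<times> 'f \<Rightarrow> 'f \<times> 'f \<times> 'f) \<Rightarrow>
   ('f \<times> 'f \<times> 'f \<Rightarrow> 'f \<times> 'f \<times> 'f) \<Rightarrow> bool" where
  "class_J c d F J1 J2 \<longleftrightarrow>
     (\<exists>U1 U2. unitary F U1 \<and> unitary F U2 \<and> op_commute F U1 U2 \<and>
        (\<forall>f\<in>carrier F. \<forall>g\<in>carrier F. \<forall>h\<in>carrier F.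
           J1 (f, g, h) = (U1 f \<oplus>\<^bsub>F\<^esub> complex_of_real c \<odot>\<^bsub>F\<^esub> U1 g, U1 g, U1 h) \<and>
           J2 (f, g, h) = (U2 f \<oplus>\<^bsub>F\<^esub> complex_of_real d \<odot>\<^bsub>F\<^esub> U2 h, U2 g, U2 h)))"

definition lifts_to ::
  "'a hspace \<Rightarrow> ('a \<Rightarrow> 'a) \<Rightarrow> ('a \<Rightarrow> 'a) \<Rightarrow> 'k hspace \<Rightarrow> ('k \<Rightarrow> 'k) \<Rightarrow> ('k \<Rightarrow> 'k) \<Rightarrow> bool" where
  "lifts_to H T1 T2 K J1 J2 \<longleftrightarrow>
     (\<exists>V. isometry H K V \<and> (\<forall>x\<in>carrier H. V (T1 x) = J1 (V x) \<and> V (T2 x) = J2 (V x)))"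

definition lifts_to_class_J ::
  "real \<Rightarrow> real \<Rightarrow> 'h hspace \<Rightarrow> ('h \<Rightarrow> 'h) \<Rightarrow> ('h \<Rightarrow> 'h) \<Rightarrow> bool" where
  "lifts_to_class_J c d H T1 T2 \<longleftrightarrow>
     (\<exists>(F :: 'h universe hspace) J1 J2.
        hilbert_space F \<and> class_J c d F J1 J2 \<and> lifts_to H T1 T2 (dsum3 F) J1 J2)"

section \<open>Basic facts\<close>

lemma complex_ring_simps [simp]:
  "carrier complex_ring = UNIV" "add complex_ring = (+)" "mult complex_ring = (*)"
  "zero complex_ring = 0" "one complex_ring = 1"
  by (auto simp: complex_ring_def)

lemma cring_complex_ring: "cring complex_ring"
proof (rule cringI)
  show "abelian_group complex_ring"
    by (rule abelian_groupI) (auto simp: algebra_simps, metis add.right_inverse add.commute)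
  show "comm_monoid complex_ring"
    by (rule comm_monoidI) (auto simp: algebra_simps)
qed (auto simp: algebra_simps)

lemma complex_ring_a_inv [simp]: "a_inv complex_ring a = - a"
proof -
  interpret cring complex_ring by (rule cring_complex_ring)
  show ?thesis using minus_equality[of "- a" a] by simp
qed

lemma quadratic_nonneg_imp_linear_zero:
  fixes a b :: real
  assumes "\<And>t. 0 \<le> t\<^sup>2 * a + t * b"
  shows "b = 0"
proof (rule ccontr)
  assume b: "b \<noteq> 0"
  have a: "a \<ge> 0"
    using assms[of 1] assms[of "-1"] by simp
  define t where "t = - b / (a + 1)"
  have "t\<^sup>2 * a + t * b = t * (t * a + b)" by (simp add: power2_eq_square algebra_simps)
  also have "t * a + b = b / (a + 1)" using a by (simp add: t_def field_simps)
  also have "t * (b / (a + 1)) = - (b\<^sup>2 / (a + 1)\<^sup>2)" by (simp add: t_def power2_eq_square)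
  also have "\<dots> < 0" using a b by simp
  finally show False using assms[of t] by simp
qed

context hilbert_space
begin

lemma sm_closed [simp, intro]: "x \<in> carrier H \<Longrightarrow> a \<odot> x \<in> carrier H"
  using smult_closed by simp

lemma sm_add_left: "x \<in> carrier H \<Longrightarrow> (a + b) \<odot> x = a \<odot> x \<oplus> b \<odot> x"
  using smult_l_distr by simp

lemma sm_add_right:
  "x \<in> carrier H \<Longrightarrow> y \<in> carrier H \<Longrightarrow> a \<odot> (x \<oplus> y) = a \<odot> x \<oplus> a \<odot> y"
  using smult_r_distr by simp

lemma sm_sm: "x \<in> carrier H \<Longrightarrow> a \<odot> (b \<odot> x) = (a * b) \<odot> x"
  using smult_assoc1 by simp

lemma sm_one [simp]: "x \<in> carrier H \<Longrightarrow> 1 \<odot> x = x"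
  using smult_one by simp

lemma sm_null [simp]: "x \<in> carrier H \<Longrightarrow> 0 \<odot> x = \<zero>"
  using smult_l_null by simp

lemma sm_zero [simp]: "a \<odot> \<zero> = \<zero>"
  using smult_r_null by simp

lemma a_inv_eq: "x \<in> carrier H \<Longrightarrow> \<ominus> x = (-1) \<odot> x"
  using smult_l_minus[of 1 x] by simp

lemma minus_eq': "x \<in> carrier H \<Longrightarrow> y \<in> carrier H \<Longrightarrow> x \<ominus> y = x \<oplus> (-1) \<odot> y"
  by (simp add: a_minus_def a_inv_eq)

lemma ip_add_right:
  "\<lbrakk>x \<in> carrier H; y \<in> carrier H; z \<in> carrier H\<rbrakk> \<Longrightarrow> ip H x (y \<oplus> z) = ip H x y + ip H x z"
  by (simp add: ip_cnj[of x] ip_add)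

lemma ip_smult_right:
  "\<lbrakk>x \<in> carrier H; y \<in> carrier H\<rbrakk> \<Longrightarrow> ip H x (a \<odot> y) = cnj a * ip H x y"
  by (simp add: ip_cnj[of x] ip_smult)

lemma ip_minus:
  "\<lbrakk>x \<in> carrier H; y \<in> carrier H; z \<in> carrier H\<rbrakk> \<Longrightarrow> ip H (x \<ominus> y) z = ip H x z - ip H y z"
  by (simp add: minus_eq' ip_add ip_smult)

lemma ip_minus_right:
  "\<lbrakk>x \<in> carrier H; y \<in> carrier H; z \<in> carrier H\<rbrakk> \<Longrightarrow> ip H x (y \<ominus> z) = ip H x y - ip H x z"
  by (simp add: minus_eq' ip_add_right ip_smult_right)

lemma ip_zero [simp]: "y \<in> carrier H \<Longrightarrow> ip H \<zero> y = 0"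
  using ip_smult[of y y 0] by simp

lemma ip_zero_right [simp]: "y \<in> carrier H \<Longrightarrow> ip H y \<zero> = 0"
  using ip_smult_right[of y y 0] by simp

lemmas ip_simps = ip_add ip_smult ip_add_right ip_smult_right ip_minus ip_minus_right

lemma ip_finsum:
  assumes "finite A" "f \<in> A \<rightarrow> carrier H" "y \<in> carrier H"
  shows "ip H (finsum H f A) y = (\<Sum>i\<in>A. ip H (f i) y)"
  using assms by (induction A rule: finite_induct) (auto simp: Pi_def ip_add)

lemma ip_self_nonneg: "x \<in> carrier H \<Longrightarrow> Re (ip H x x) \<ge> 0"
  using ip_nonneg[of x] by (simp add: nonneg_Reals_def) force

lemma hnorm_sq: "x \<in> carrier H \<Longrightarrow> (hnorm H x)\<^sup>2 = Re (ip H x x)"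
  by (simp add: hnorm_def ip_self_nonneg)

lemma ip_self: "x \<in> carrier H \<Longrightarrow> ip H x x = of_real ((hnorm H x)\<^sup>2)"
  using ip_nonneg[of x] by (auto simp: hnorm_sq nonneg_Reals_def elim!: Reals_cases)

lemma hnorm_nonneg [simp]: "x \<in> carrier H \<Longrightarrow> hnorm H x \<ge> 0"
  by (simp add: hnorm_def ip_self_nonneg)

lemma hnorm_zero [simp]: "hnorm H \<zero> = 0"
  by (simp add: hnorm_def)

lemma hnorm_eq_0: "x \<in> carrier H \<Longrightarrow> hnorm H x = 0 \<longleftrightarrow> x = \<zero>"
  using ip_self[of x] ip_definite[of x] by auto

lemma hnorm_smult: "x \<in> carrier H \<Longrightarrow> hnorm H (a \<odot> x) = cmod a * hnorm H x"
proof -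
  assume x: "x \<in> carrier H"
  have "ip H (a \<odot> x) (a \<odot> x) = (a * cnj a) * ip H x x"
    using x by (simp add: ip_simps)
  also have "\<dots> = of_real ((cmod a * hnorm H x)\<^sup>2)"
    by (simp add: ip_self[OF x] complex_norm_square[symmetric] power_mult_distrib)
  finally have "(hnorm H (a \<odot> x))\<^sup>2 = (cmod a * hnorm H x)\<^sup>2"
    using x by (simp add: hnorm_sq)
  thus ?thesis using x by (simp add: power2_eq_iff_nonneg)
qed

lemma minus_zero_iff: "x \<in> carrier H \<Longrightarrow> y \<in> carrier H \<Longrightarrow> x \<ominus> y = \<zero> \<longleftrightarrow> x = y"
  by (metis a_minus_def add.inv_closed add.inv_solve_right l_zero r_neg zero_closed)

lemma hnorm_minus_eq_0: "x \<in> carrier H \<Longrightarrow> y \<in> carrier H \<Longrightarrow> hnorm H (x \<ominus> y) = 0 \<longleftrightarrow> x = y"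
  by (simp add: hnorm_eq_0 minus_zero_iff)

lemma hnorm_minus_self [simp]: "x \<in> carrier H \<Longrightarrow> hnorm H (x \<ominus> x) = 0"
  by (simp add: hnorm_minus_eq_0)

lemma hnorm_minus_commute:
  "x \<in> carrier H \<Longrightarrow> y \<in> carrier H \<Longrightarrow> hnorm H (x \<ominus> y) = hnorm H (y \<ominus> x)"
  by (simp add: hnorm_def ip_simps)

lemma ip_eqI:
  assumes x: "x \<in> carrier H" and y: "y \<in> carrier H"
    and eq: "\<And>z. z \<in> carrier H \<Longrightarrow> ip H x z = ip H y z"
  shows "x = y"
proof -
  have "ip H (x \<ominus> y) (x \<ominus> y) = 0"
    using x y eq[of "x \<ominus> y"] by (simp add: ip_minus)
  thus ?thesis using x y ip_definite[of "x \<ominus> y"] minus_zero_iff by auto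
qed

lemma ip_eqI_right:
  assumes x: "x \<in> carrier H" and y: "y \<in> carrier H"
    and eq: "\<And>z. z \<in> carrier H \<Longrightarrow> ip H z x = ip H z y"
  shows "x = y"
  using x y eq by (intro ip_eqI) (simp_all add: ip_cnj[of x] ip_cnj[of y])

lemma cauchy_schwarz:
  assumes x: "x \<in> carrier H" and y: "y \<in> carrier H"
  shows "cmod (ip H x y) \<le> hnorm H x * hnorm H y"
proof (cases "hnorm H y = 0")
  case True
  thus ?thesis using x y by (simp add: hnorm_eq_0)
next
  case False
  define N where "N = (hnorm H y)\<^sup>2"
  define p where "p = ip H x y"
  have N: "N > 0" using False by (simp add: N_def)
  define l where "l = p / of_real N"
  have yx: "ip H y x = cnj p" using x y ip_cnj[of y x] by (simp add: p_def)
  have "0 \<le> Re (ip H (x \<ominus> l \<odot> y) (x \<ominus> l \<odot> y))"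
    using x y by (intro ip_self_nonneg) auto
  also have "ip H (x \<ominus> l \<odot> y) (x \<ominus> l \<odot> y) =
      of_real ((hnorm H x)\<^sup>2) - cnj l * p - l * cnj p + l * cnj l * of_real N"
    using x y by (simp add: ip_simps ip_self[of x] ip_self[of y] yx p_def[symmetric] N_def algebra_simps)
  also have "\<dots> = of_real ((hnorm H x)\<^sup>2) - p * cnj p / of_real N"
    using N by (simp add: l_def field_simps)
  also have "\<dots> = of_real ((hnorm H x)\<^sup>2 - (cmod p)\<^sup>2 / N)"
    by (simp add: complex_norm_square[symmetric] del: of_real_power)
  finally have "(cmod p)\<^sup>2 \<le> (hnorm H x * hnorm H y)\<^sup>2"
    using N by (simp add: field_simps N_def)
  thus ?thesis using x y by (simp add: p_def power2_le_iff_abs_le)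
qed

lemma hnorm_triangle:
  assumes x: "x \<in> carrier H" and y: "y \<in> carrier H"
  shows "hnorm H (x \<oplus> y) \<le> hnorm H x + hnorm H y"
proof -
  have yx: "ip H y x = cnj (ip H x y)" using x y by (intro ip_cnj)
  have "(hnorm H (x \<oplus> y))\<^sup>2 = (hnorm H x)\<^sup>2 + (hnorm H y)\<^sup>2 + 2 * Re (ip H x y)"
    using x y by (simp add: hnorm_sq ip_simps yx)
  also have "\<dots> \<le> (hnorm H x)\<^sup>2 + (hnorm H y)\<^sup>2 + 2 * (hnorm H x * hnorm H y)"
    using cauchy_schwarz[OF x y] complex_Re_le_cmod[of "ip H x y"] by linarith
  also have "\<dots> = (hnorm H x + hnorm H y)\<^sup>2" by (simp add: power2_eq_square algebra_simps)
  finally show ?thesis using x y by (simp add: power2_le_iff_abs_le)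
qed

lemma minus_split:
  "\<lbrakk>x \<in> carrier H; y \<in> carrier H; z \<in> carrier H\<rbrakk> \<Longrightarrow> x \<ominus> z = (x \<ominus> y) \<oplus> (y \<ominus> z)"
  by (rule ip_eqI) (simp_all add: ip_simps)

lemma hdist_triangle:
  assumes "x \<in> carrier H" "y \<in> carrier H" "z \<in> carrier H"
  shows "hnorm H (x \<ominus> z) \<le> hnorm H (x \<ominus> y) + hnorm H (y \<ominus> z)"
  using assms hnorm_triangle[of "x \<ominus> y" "y \<ominus> z"] minus_split[of x y z] by simp

lemma limit_unique:
  assumes "\<And>n. s n \<in> carrier H" "x \<in> carrier H" "y \<in> carrier H"
    and "(\<lambda>n. hnorm H (s n \<ominus> x)) \<longlonglongrightarrow> 0" "(\<lambda>n. hnorm H (s n \<ominus> y)) \<longlonglongrightarrow> 0"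
  shows "x = y"
proof -
  have "(\<lambda>n. hnorm H (s n \<ominus> x) + hnorm H (s n \<ominus> y)) \<longlonglongrightarrow> 0"
    using tendsto_add[OF assms(4,5)] by simp
  moreover have "hnorm H (x \<ominus> y) \<le> hnorm H (s n \<ominus> x) + hnorm H (s n \<ominus> y)" for n
    using assms(1-3) hdist_triangle[of x "s n" y] hnorm_minus_commute[of x "s n"] by simp
  ultimately have "hnorm H (x \<ominus> y) \<le> 0"
    by (intro tendsto_lowerbound[of _ 0 sequentially]) auto
  moreover have "hnorm H (x \<ominus> y) \<ge> 0" using assms(2,3) by simp
  ultimately show ?thesis using assms(2,3) hnorm_minus_eq_0[of x y] by linarith
qed

end

subsection \<open>Adjoints\<close>

lemma bounded_op_bound:
  assumes "bounded_op H K A" "hilbert_space H"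
  obtains C where "C \<ge> 0" "\<And>x. x \<in> carrier H \<Longrightarrow> hnorm K (A x) \<le> C * hnorm H x"
proof -
  obtain C where C: "\<And>x. x \<in> carrier H \<Longrightarrow> hnorm K (A x) \<le> C * hnorm H x"
    using assms(1) unfolding bounded_op_def by blast
  show ?thesis
  proof (rule that[of "\<bar>C\<bar>"])
    fix x assume x: "x \<in> carrier H"
    have "C * hnorm H x \<le> \<bar>C\<bar> * hnorm H x"
      by (intro mult_right_mono) (auto simp: x hilbert_space.hnorm_nonneg[OF assms(2)])
    thus "hnorm K (A x) \<le> \<bar>C\<bar> * hnorm H x" using C[OF x] by linarith
  qed auto
qed

lemma bounded_opD:
  assumes "bounded_op H K A"
  shows "x \<in> carrier H \<Longrightarrow> A x \<in> carrier K"
    and "x \<in> carrier H \<Longrightarrow> y \<in> carrier H \<Longrightarrow> A (x \<oplus>\<^bsub>H\<^esub> y) = A x \<oplus>\<^bsub>K\<^esub> A y"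
    and "x \<in> carrier H \<Longrightarrow> A (a \<odot>\<^bsub>H\<^esub> x) = a \<odot>\<^bsub>K\<^esub> A x"
  using assms unfolding bounded_op_def by auto

lemma riesz:
  assumes "hilbert_space H"
    and add: "\<And>x y. x \<in> carrier H \<Longrightarrow> y \<in> carrier H \<Longrightarrow> \<phi> (x \<oplus>\<^bsub>H\<^esub> y) = \<phi> x + \<phi> y"
    and smult: "\<And>a x. x \<in> carrier H \<Longrightarrow> \<phi> (a \<odot>\<^bsub>H\<^esub> x) = a * (\<phi> x :: complex)"
    and bound: "\<And>x. x \<in> carrier H \<Longrightarrow> cmod (\<phi> x) \<le> C * hnorm H x"
  shows "\<exists>z\<in>carrier H. \<forall>x\<in>carrier H. \<phi> x = ip H x z"
proof -
  interpret hilbert_space H by fact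
  have minus: "\<phi> (x \<ominus>\<^bsub>H\<^esub> y) = \<phi> x - \<phi> y" if "x \<in> carrier H" "y \<in> carrier H" for x y
    using that by (simp add: minus_eq' add smult)
  define J where "J x = (hnorm H x)\<^sup>2 - 2 * Re (\<phi> x)" for x
  have J_lb: "J x \<ge> - (C\<^sup>2)" if x: "x \<in> carrier H" for x
  proof -
    have "Re (\<phi> x) \<le> C * hnorm H x"
      using bound[OF x] complex_Re_le_cmod[of "\<phi> x"] by linarith
    moreover have "0 \<le> (hnorm H x - C)\<^sup>2" by simp
    ultimately show ?thesis unfolding J_def by (simp add: power2_eq_square algebra_simps)
  qed
  define m where "m = Inf (J ` carrier H)"
  have bdd: "bdd_below (J ` carrier H)" using J_lb by (auto intro!: bdd_belowI2)
  have m_le: "m \<le> J x" if "x \<in> carrier H" for x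
    unfolding m_def using that bdd by (intro cInf_lower) auto
  have "\<exists>x\<in>carrier H. J x < m + 1 / real (Suc n)" for n
  proof -
    have "J ` carrier H \<noteq> {}" by blast
    moreover have "m < m + 1 / real (Suc n)" by simp
    ultimately obtain r where "r \<in> J ` carrier H" "r < m + 1 / real (Suc n)"
      using cInf_lessD[of "J ` carrier H" "m + 1 / real (Suc n)"] unfolding m_def by blast
    thus ?thesis by blast
  qed
  then obtain s where s: "\<And>n. s n \<in> carrier H" and sJ: "\<And>n. J (s n) < m + 1 / real (Suc n)"
    by metis
  have mid: "(hnorm H (x \<ominus>\<^bsub>H\<^esub> y))\<^sup>2 \<le> 2 * J x + 2 * J y - 4 * m"
    if x: "x \<in> carrier H" and y: "y \<in> carrier H" for x y
  proof -
    define w where "w = (1/2) \<odot>\<^bsub>H\<^esub> (x \<oplus>\<^bsub>H\<^esub> y)"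
    have w: "w \<in> carrier H" using x y by (simp add: w_def)
    have \<phi>w: "\<phi> w = (\<phi> x + \<phi> y) / 2" using x y by (simp add: w_def smult add)
    have aux: "4 * (a - 2 * b) = u - 4 * v" if "a = u / 4" "b = v / 2" for a b u v :: real
      using that by simp
    have "ip H w w = (ip H x x + ip H x y + ip H y x + ip H y y) / 4"
      using x y by (simp add: w_def ip_simps add_divide_distrib)
    hence "Re (ip H w w) = Re (ip H x x + ip H x y + ip H y x + ip H y y) / 4" by (simp only: Re_divide_numeral)
    moreover have "Re (\<phi> w) = Re (\<phi> x + \<phi> y) / 2" by (simp add: \<phi>w)
    ultimately have "4 * J w = Re (ip H x x + ip H x y + ip H y x + ip H y y) - 4 * Re (\<phi> x + \<phi> y)"
      unfolding J_def hnorm_sq[OF w] by (rule aux)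
    moreover have "(hnorm H (x \<ominus>\<^bsub>H\<^esub> y))\<^sup>2 = Re (ip H x x - ip H x y - ip H y x + ip H y y)"
      using x y by (simp add: hnorm_sq ip_simps)
    moreover have "J x = Re (ip H x x) - 2 * Re (\<phi> x)" "J y = Re (ip H y y) - 2 * Re (\<phi> y)"
      using x y by (simp_all add: J_def hnorm_sq)
    ultimately show ?thesis using m_le[OF w] by simp
  qed
  have "\<exists>x\<in>carrier H. (\<lambda>n. hnorm H (s n \<ominus>\<^bsub>H\<^esub> x)) \<longlonglongrightarrow> 0"
  proof (rule complete)
    show "range s \<subseteq> carrier H" using s by auto
    fix e :: real assume e: "e > 0"
    obtain N where N: "1 / real (Suc N) < e\<^sup>2 / 4" using e nat_approx_posE[of "e\<^sup>2 / 4"] by auto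
    have small: "J (s n) - m < e\<^sup>2 / 4" if "n \<ge> N" for n
    proof -
      have "1 / real (Suc n) \<le> 1 / real (Suc N)" using that by (simp add: frac_le)
      thus ?thesis using sJ[of n] N by linarith
    qed
    have "hnorm H (s i \<ominus>\<^bsub>H\<^esub> s j) < e" if "i \<ge> N" "j \<ge> N" for i j
    proof -
      have "(hnorm H (s i \<ominus>\<^bsub>H\<^esub> s j))\<^sup>2 < e\<^sup>2"
        using mid[OF s s, of i j] small[OF that(1)] small[OF that(2)] by linarith
      thus ?thesis using e by (simp add: power2_less_imp_less)
    qed
    thus "\<exists>N. \<forall>i\<ge>N. \<forall>j\<ge>N. hnorm H (s i \<ominus>\<^bsub>H\<^esub> s j) < e" by blast
  qed
  then obtain z where z: "z \<in> carrier H" and lim: "(\<lambda>n. hnorm H (s n \<ominus>\<^bsub>H\<^esub> z)) \<longlonglongrightarrow> 0"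
    by blast
  have Jz: "J z \<le> m"
  proof -
    define D where "D = 2 * hnorm H z + 2 * \<bar>C\<bar>"
    have le: "J z \<le> m + 1 / real (Suc n) + D * hnorm H (s n \<ominus>\<^bsub>H\<^esub> z)" for n
    proof -
      define v where "v = s n \<ominus>\<^bsub>H\<^esub> z"
      have v: "v \<in> carrier H" using s z by (simp add: v_def)
      have vz: "ip H v z = cnj (ip H z v)" using ip_cnj v z by blast
      have "ip H (s n) (s n) = ip H v v + ip H v z + ip H z v + ip H z z"
        unfolding v_def using s z by (simp add: ip_simps)
      hence "J (s n) = J z + (hnorm H v)\<^sup>2 + 2 * Re (ip H v z) - 2 * Re (\<phi> v)"
        using s z v vz by (simp add: J_def hnorm_sq v_def minus)
      moreover have "\<bar>Re (ip H v z)\<bar> \<le> hnorm H v * hnorm H z"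
        using cauchy_schwarz[OF v z] abs_Re_le_cmod[of "ip H v z"] by linarith
      moreover have "\<bar>Re (\<phi> v)\<bar> \<le> \<bar>C\<bar> * hnorm H v"
        using bound[OF v] abs_Re_le_cmod[of "\<phi> v"]
          mult_right_mono[of C "\<bar>C\<bar>" "hnorm H v", OF abs_ge_self hnorm_nonneg[OF v]] by linarith
      moreover have "D * hnorm H v = 2 * (hnorm H v * hnorm H z) + 2 * (\<bar>C\<bar> * hnorm H v)"
        by (simp add: D_def algebra_simps)
      moreover have "0 \<le> (hnorm H v)\<^sup>2" by simp
      ultimately have "J z \<le> J (s n) + D * hnorm H v" by linarith
      thus ?thesis using sJ[of n] by (simp add: v_def)
    qed
    have "(\<lambda>n. m + 1 / real (Suc n) + D * hnorm H (s n \<ominus>\<^bsub>H\<^esub> z)) \<longlonglongrightarrow> m + 0 + D * 0"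
      by (intro tendsto_intros lim lim_1_over_n[THEN LIMSEQ_Suc])
    thus ?thesis using le by (intro tendsto_lowerbound[of _ m sequentially]) auto
  qed
  have re: "Re (ip H y z) = Re (\<phi> y)" if y: "y \<in> carrier H" for y
  proof -
    have zy: "ip H z y = cnj (ip H y z)" using ip_cnj y z by blast
    have "0 \<le> t\<^sup>2 * (hnorm H y)\<^sup>2 + t * (2 * Re (ip H y z) - 2 * Re (\<phi> y))" for t
    proof -
      define w where "w = z \<oplus>\<^bsub>H\<^esub> of_real t \<odot>\<^bsub>H\<^esub> y"
      have w: "w \<in> carrier H" using y z by (simp add: w_def)
      have \<phi>w: "\<phi> w = \<phi> z + of_real t * \<phi> y" using y z by (simp add: w_def add smult)
      have "J w = J z + t\<^sup>2 * (hnorm H y)\<^sup>2 + t * (2 * Re (ip H y z) - 2 * Re (\<phi> y))"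
        using w y z unfolding J_def hnorm_sq[OF w] hnorm_sq[OF y] hnorm_sq[OF z] \<phi>w
        by (simp add: w_def ip_simps zy power2_eq_square algebra_simps)
      thus ?thesis using m_le[OF w] Jz by linarith
    qed
    from quadratic_nonneg_imp_linear_zero[OF this] show ?thesis by simp
  qed
  have "\<phi> y = ip H y z" if y: "y \<in> carrier H" for y
  proof (rule complex_eqI)
    show "Re (\<phi> y) = Re (ip H y z)" using re[OF y] by simp
    have "Re (\<phi> ((-\<i>) \<odot>\<^bsub>H\<^esub> y)) = Re (ip H ((-\<i>) \<odot>\<^bsub>H\<^esub> y) z)" using re[of "(-\<i>) \<odot>\<^bsub>H\<^esub> y"] y by simp
    thus "Im (\<phi> y) = Im (ip H y z)" using y z by (simp add: smult ip_simps)
  qed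
  thus ?thesis using z by blast
qed

lemma adjoint_exists:
  assumes "hilbert_space H" "hilbert_space K" and A: "bounded_op H K A"
  shows "\<exists>A'. is_adjoint H K A A'"
proof -
  interpret H: hilbert_space H by fact
  interpret K: hilbert_space K by fact
  note AD = bounded_opD[OF A]
  obtain C where C0: "C \<ge> 0" and C: "\<And>x. x \<in> carrier H \<Longrightarrow> hnorm K (A x) \<le> C * hnorm H x"
    using bounded_op_bound[OF A assms(1)] by blast
  have "\<exists>z\<in>carrier H. \<forall>x\<in>carrier H. ip K (A x) y = ip H x z" if y: "y \<in> carrier K" for y
  proof (rule riesz[OF assms(1), where C = "C * hnorm K y"])
    fix x assume x: "x \<in> carrier H"
    have "cmod (ip K (A x) y) \<le> hnorm K (A x) * hnorm K y"
      using K.cauchy_schwarz AD(1) x y by blast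
    also have "\<dots> \<le> (C * hnorm H x) * hnorm K y"
      using C[OF x] y by (intro mult_right_mono) auto
    finally show "cmod (ip K (A x) y) \<le> C * hnorm K y * hnorm H x" by (simp add: mult_ac)
  qed (use AD y in \<open>auto simp: K.ip_simps\<close>)
  then obtain A' where A': "\<And>y. y \<in> carrier K \<Longrightarrow> A' y \<in> carrier H"
    and eq: "\<And>x y. y \<in> carrier K \<Longrightarrow> x \<in> carrier H \<Longrightarrow> ip K (A x) y = ip H x (A' y)"
    by metis
  have "hnorm H (A' y) \<le> C * hnorm K y" if y: "y \<in> carrier K" for y
  proof -
    have "(hnorm H (A' y))\<^sup>2 = cmod (ip H (A' y) (A' y))"
      unfolding H.ip_self[OF A'[OF y]] by (simp add: norm_power)
    also have "\<dots> = cmod (ip K (A (A' y)) y)" using eq A' y by simp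
    also have "\<dots> \<le> hnorm K (A (A' y)) * hnorm K y"
      using K.cauchy_schwarz AD(1) A' y by blast
    also have "\<dots> \<le> (C * hnorm H (A' y)) * hnorm K y"
      using C A' y by (intro mult_right_mono) auto
    finally have "hnorm H (A' y) * hnorm H (A' y) \<le> (C * hnorm K y) * hnorm H (A' y)"
      by (simp add: power2_eq_square mult_ac)
    moreover have "0 \<le> hnorm H (A' y)" "0 \<le> C * hnorm K y" using A' y C0 by auto
    ultimately show ?thesis by (metis mult_right_le_imp_le order_le_less)
  qed
  moreover have "A' (y \<oplus>\<^bsub>K\<^esub> z) = A' y \<oplus>\<^bsub>H\<^esub> A' z" if "y \<in> carrier K" "z \<in> carrier K" for y z
    using that A' AD(1)
    by (intro H.ip_eqI_right) (auto simp: H.ip_simps K.ip_simps eq[symmetric])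
  moreover have "A' (a \<odot>\<^bsub>K\<^esub> y) = a \<odot>\<^bsub>H\<^esub> A' y" if "y \<in> carrier K" for a y
    using that A' AD(1)
    by (intro H.ip_eqI_right) (auto simp: H.ip_simps K.ip_simps eq[symmetric])
  ultimately have "is_adjoint H K A A'"
    unfolding is_adjoint_def bounded_op_def using A' eq by auto
  thus ?thesis by blast
qed

lemma is_adjoint_adj:
  assumes "hilbert_space H" "hilbert_space K" "bounded_op H K A"
  shows "is_adjoint H K A (adj H K A)"
  unfolding adj_def using adjoint_exists[OF assms] by (rule someI_ex)

lemma adj_unique:
  assumes "hilbert_space H" "is_adjoint H K A A'" "y \<in> carrier K"
  shows "adj H K A y = A' y"
proof -
  have adj: "is_adjoint H K A (adj H K A)" unfolding adj_def by (rule someI[of "is_adjoint H K A", OF assms(2)])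
  show ?thesis
    using adj assms(2,3) unfolding is_adjoint_def
    by (intro hilbert_space.ip_eqI_right[OF assms(1)]) (auto dest: bounded_opD(1))
qed

subsection \<open>Uniqueness of the coefficients\<close>

lemma coeff_index_set:
  "{(i, j). i + j \<le> (2::nat)} = {(0, 0), (1, 0), (0, 1), (2, 0), (1, 1), (0, 2)}"
  by auto

lemma ip_quad_pencil:
  assumes "hilbert_space H" and B: "\<And>i j. i + j \<le> 2 \<Longrightarrow> bounded_op H H (B i j)"
    and x: "x \<in> carrier H" and y: "y \<in> carrier H"
  shows "ip H (quad_pencil H B \<alpha> \<beta> x) y =
    ip H (B 0 0 x) y + \<alpha> * ip H (B 1 0 x) y + \<beta> * ip H (B 0 1 x) y +
    \<alpha>\<^sup>2 * ip H (B 2 0 x) y + \<alpha> * \<beta> * ip H (B 1 1 x) y + \<beta>\<^sup>2 * ip H (B 0 2 x) y"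
proof -
  interpret hilbert_space H by fact
  have Bx: "B i j x \<in> carrier H" if "i + j \<le> 2" for i j
    using bounded_opD(1)[OF B[OF that] x] .
  have "ip H (quad_pencil H B \<alpha> \<beta> x) y =
      (\<Sum>(i, j)\<in>{(i, j). i + j \<le> 2}. complex_of_real (\<alpha> ^ i * \<beta> ^ j) * ip H (B i j x) y)"
    unfolding quad_pencil_def using Bx y
    by (subst ip_finsum) (auto simp: coeff_index_set ip_smult intro!: sum.cong)
  thus ?thesis by (simp add: coeff_index_set algebra_simps)
qed

lemma coeffs_unique:
  assumes "hilbert_space H" and B: "is_coeffs H T1 T2 B" and B': "is_coeffs H T1 T2 B'"
    and ij: "i + j \<le> 2" and x: "x \<in> carrier H"
  shows "B i j x = B' i j x"
proof -
  have bd: "\<And>i j. i + j \<le> 2 \<Longrightarrow> bounded_op H H (B i j)"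
      "\<And>i j. i + j \<le> 2 \<Longrightarrow> bounded_op H H (B' i j)"
    using B B' unfolding is_coeffs_def by auto
  have eq: "quad_pencil H B (real n) (real m) x = quad_pencil H B' (real n) (real m) x" for n m
    using B B' x unfolding is_coeffs_def by metis
  show ?thesis
  proof (rule hilbert_space.ip_eqI[OF assms(1)])
    fix y assume y: "y \<in> carrier H"
    define D where "D i j = ip H (B i j x) y - ip H (B' i j x) y" for i j
    have D: "D 0 0 + of_nat n * D 1 0 + of_nat m * D 0 1 + (of_nat n)\<^sup>2 * D 2 0 +
        of_nat n * of_nat m * D 1 1 + (of_nat m)\<^sup>2 * D 0 2 = 0" for n m
      using arg_cong[OF eq[of n m], of "\<lambda>z. ip H z y"]
        ip_quad_pencil[OF assms(1) bd(1) x y, where \<alpha> = "real n" and \<beta> = "real m"]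
        ip_quad_pencil[OF assms(1) bd(2) x y, where \<alpha> = "real n" and \<beta> = "real m"]
      by (simp add: D_def algebra_simps)
    have 0: "D 0 0 = 0" using D[of 0 0] by simp
    have "D 1 0 + D 2 0 = 0" "2 * D 1 0 + 4 * D 2 0 = 0"
      using D[of 1 0] D[of 2 0] 0 by simp_all
    hence 1: "D 1 0 = 0" "D 2 0 = 0" by (auto simp: complex_eq_iff)
    have "D 0 1 + D 0 2 = 0" "2 * D 0 1 + 4 * D 0 2 = 0"
      using D[of 0 1] D[of 0 2] 0 by simp_all
    hence 2: "D 0 1 = 0" "D 0 2 = 0" by (auto simp: complex_eq_iff)
    have 3: "D 1 1 = 0" using D[of 1 1] 0 1 2 by simp
    have "(i, j) \<in> {(0, 0), (1, 0), (0, 1), (2, 0), (1, 1), (0, 2)}"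
      using ij coeff_index_set by blast
    hence "D i j = 0" using 0 1 2 3 by auto
    thus "ip H (B i j x) y = ip H (B' i j x) y" by (simp add: D_def)
  qed (use bd[OF ij] x in \<open>auto dest: bounded_opD(1)\<close>)
qed

lemma is_coeffs_coeffs:
  assumes "three_isometric H T1 T2"
  shows "is_coeffs H T1 T2 (coeffs H T1 T2)"
proof -
  obtain B where B: "is_coeffs H T1 T2 B" using assms unfolding three_isometric_def by blast
  show ?thesis unfolding coeffs_def by (rule someI[of "is_coeffs H T1 T2", OF B])
qed

subsection \<open>Operator arithmetic\<close>

lemma bounded_op_comp:
  assumes "hilbert_space K" "bounded_op H K A" "bounded_op K L B"
  shows "bounded_op H L (\<lambda>x. B (A x))"
proof -
  obtain C where C: "C \<ge> 0" "\<And>x. x \<in> carrier K \<Longrightarrow> hnorm L (B x) \<le> C * hnorm K x"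
    using bounded_op_bound[OF assms(3,1)] by blast
  obtain D where D: "\<And>x. x \<in> carrier H \<Longrightarrow> hnorm K (A x) \<le> D * hnorm H x"
    using assms(2) unfolding bounded_op_def by blast
  have "hnorm L (B (A x)) \<le> (C * D) * hnorm H x" if x: "x \<in> carrier H" for x
  proof -
    have "hnorm L (B (A x)) \<le> C * hnorm K (A x)" using C(2) bounded_opD(1)[OF assms(2) x] by blast
    also have "\<dots> \<le> C * (D * hnorm H x)" using D[OF x] C(1) by (rule mult_left_mono)
    finally show ?thesis by (simp add: mult.assoc)
  qed
  thus ?thesis
    using bounded_opD[OF assms(2)] bounded_opD[OF assms(3)] unfolding bounded_op_def by auto
qed

lemma bounded_op_add:
  assumes "hilbert_space K" "bounded_op H K A" "bounded_op H K B"
  shows "bounded_op H K (\<lambda>x. A x \<oplus>\<^bsub>K\<^esub> B x)"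
proof -
  interpret K: hilbert_space K by fact
  note AD = bounded_opD[OF assms(2)] and BD = bounded_opD[OF assms(3)]
  obtain C where C: "\<And>x. x \<in> carrier H \<Longrightarrow> hnorm K (A x) \<le> C * hnorm H x"
    using assms(2) unfolding bounded_op_def by blast
  obtain D where D: "\<And>x. x \<in> carrier H \<Longrightarrow> hnorm K (B x) \<le> D * hnorm H x"
    using assms(3) unfolding bounded_op_def by blast
  have "hnorm K (A x \<oplus>\<^bsub>K\<^esub> B x) \<le> (C + D) * hnorm H x" if x: "x \<in> carrier H" for x
    using K.hnorm_triangle[OF AD(1)[OF x] BD(1)[OF x]] C[OF x] D[OF x]
    by (simp add: algebra_simps)
  thus ?thesis unfolding bounded_op_def using AD BD
    by (auto simp: K.a_ac K.sm_add_right)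
qed

lemma bounded_op_smult:
  assumes "hilbert_space K" "bounded_op H K A"
  shows "bounded_op H K (\<lambda>x. a \<odot>\<^bsub>K\<^esub> A x)"
proof -
  interpret K: hilbert_space K by fact
  note AD = bounded_opD[OF assms(2)]
  obtain C where C: "\<And>x. x \<in> carrier H \<Longrightarrow> hnorm K (A x) \<le> C * hnorm H x"
    using assms(2) unfolding bounded_op_def by blast
  have "hnorm K (a \<odot>\<^bsub>K\<^esub> A x) \<le> (cmod a * C) * hnorm H x" if x: "x \<in> carrier H" for x
    using C[OF x] AD(1)[OF x] by (simp add: K.hnorm_smult mult.assoc mult_left_mono)
  hence "\<exists>C. \<forall>x\<in>carrier H. hnorm K (a \<odot>\<^bsub>K\<^esub> A x) \<le> C * hnorm H x" by blast
  thus ?thesis unfolding bounded_op_def using AD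
    by (auto simp: K.sm_add_right K.sm_sm mult.commute)
qed

subsection \<open>Changing the type of a Hilbert space\<close>

definition closed_subspace :: "'a hspace \<Rightarrow> 'a set \<Rightarrow> bool" where
  "closed_subspace K M \<longleftrightarrow> M \<subseteq> carrier K \<and> \<zero>\<^bsub>K\<^esub> \<in> M \<and>
     (\<forall>x\<in>M. \<forall>y\<in>M. x \<oplus>\<^bsub>K\<^esub> y \<in> M) \<and> (\<forall>a. \<forall>x\<in>M. a \<odot>\<^bsub>K\<^esub> x \<in> M) \<and>
     (\<forall>s x. range s \<subseteq> M \<longrightarrow> x \<in> carrier K \<longrightarrow>
        (\<lambda>n. hnorm K (s n \<ominus>\<^bsub>K\<^esub> x)) \<longlonglongrightarrow> 0 \<longrightarrow> x \<in> M)"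

definition transport :: "'a hspace \<Rightarrow> 'a set \<Rightarrow> ('a \<Rightarrow> 'b) \<Rightarrow> 'b hspace" where
  "transport K M g = (let r = inv_into M g in
     \<lparr>carrier = g ` M, mult = undefined, one = undefined, zero = g \<zero>\<^bsub>K\<^esub>,
      add = (\<lambda>u v. g (r u \<oplus>\<^bsub>K\<^esub> r v)), smult = (\<lambda>a u. g (a \<odot>\<^bsub>K\<^esub> r u)),
      ip = (\<lambda>u v. ip K (r u) (r v))\<rparr>)"

locale transported = K: hilbert_space K for K :: "'a hspace" +
  fixes M :: "'a set" and g :: "'a \<Rightarrow> 'b"
  assumes sub: "closed_subspace K M" and inj: "inj_on g M"
begin

abbreviation "K' \<equiv> transport K M g"
abbreviation "r \<equiv> inv_into M g"

lemma M_carrier: "x \<in> M \<Longrightarrow> x \<in> carrier K"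
  and M_zero: "\<zero>\<^bsub>K\<^esub> \<in> M"
  and M_add: "x \<in> M \<Longrightarrow> y \<in> M \<Longrightarrow> x \<oplus>\<^bsub>K\<^esub> y \<in> M"
  and M_smult: "x \<in> M \<Longrightarrow> a \<odot>\<^bsub>K\<^esub> x \<in> M"
  and M_lim: "range s \<subseteq> M \<Longrightarrow> x \<in> carrier K \<Longrightarrow> (\<lambda>n. hnorm K (s n \<ominus>\<^bsub>K\<^esub> x)) \<longlonglongrightarrow> 0 \<Longrightarrow> x \<in> M"
  using sub unfolding closed_subspace_def by blast+

lemma M_minus: "x \<in> M \<Longrightarrow> y \<in> M \<Longrightarrow> x \<ominus>\<^bsub>K\<^esub> y \<in> M"
  by (simp add: K.minus_eq' M_carrier M_add M_smult)

lemma r_g [simp]: "x \<in> M \<Longrightarrow> r (g x) = x"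
  using inj by simp

lemma K'_carrier: "carrier K' = g ` M"
  and K'_zero: "\<zero>\<^bsub>K'\<^esub> = g \<zero>\<^bsub>K\<^esub>"
  and K'_add: "x \<in> M \<Longrightarrow> y \<in> M \<Longrightarrow> g x \<oplus>\<^bsub>K'\<^esub> g y = g (x \<oplus>\<^bsub>K\<^esub> y)"
  and K'_smult: "x \<in> M \<Longrightarrow> a \<odot>\<^bsub>K'\<^esub> g x = g (a \<odot>\<^bsub>K\<^esub> x)"
  and K'_ip: "x \<in> M \<Longrightarrow> y \<in> M \<Longrightarrow> ip K' (g x) (g y) = ip K x y"
  by (simp_all add: transport_def Let_def)

lemma K'_hnorm: "x \<in> M \<Longrightarrow> hnorm K' (g x) = hnorm K x"
  by (simp add: hnorm_def K'_ip)

lemma g_carrier [simp]: "x \<in> M \<Longrightarrow> g x \<in> carrier K'"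
  by (simp add: K'_carrier)

lemma K'_cases:
  assumes "u \<in> carrier K'" obtains x where "x \<in> M" "u = g x"
  using assms by (auto simp: K'_carrier)

lemma r_M: "u \<in> carrier K' \<Longrightarrow> r u \<in> M"
  and g_r: "u \<in> carrier K' \<Longrightarrow> g (r u) = u"
  by (auto simp: K'_carrier)

lemmas K'_simps = K'_zero K'_add K'_smult K'_ip K'_hnorm M_carrier M_zero M_add M_smult M_minus

lemma abelian_group_K': "abelian_group K'"
proof (rule abelian_groupI)
  fix u assume "u \<in> carrier K'"
  then obtain x where x: "x \<in> M" "u = g x" by (rule K'_cases)
  have "g ((-1) \<odot>\<^bsub>K\<^esub> x) \<oplus>\<^bsub>K'\<^esub> u = \<zero>\<^bsub>K'\<^esub>"
    using x K.l_neg[of x] by (simp add: K'_simps K.a_inv_eq)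
  thus "\<exists>v\<in>carrier K'. v \<oplus>\<^bsub>K'\<^esub> u = \<zero>\<^bsub>K'\<^esub>" using x M_smult g_carrier by blast
qed (auto elim!: K'_cases simp: K'_simps K.a_ac)

lemma K'_minus: "x \<in> M \<Longrightarrow> y \<in> M \<Longrightarrow> g x \<ominus>\<^bsub>K'\<^esub> g y = g (x \<ominus>\<^bsub>K\<^esub> y)"
proof -
  assume x: "x \<in> M" and y: "y \<in> M"
  interpret K': abelian_group K' by (rule abelian_group_K')
  have "g ((-1) \<odot>\<^bsub>K\<^esub> y) \<oplus>\<^bsub>K'\<^esub> g y = \<zero>\<^bsub>K'\<^esub>"
    using y K.l_neg[of y] by (simp add: K'_simps K.a_inv_eq)
  hence "\<ominus>\<^bsub>K'\<^esub> g y = g ((-1) \<odot>\<^bsub>K\<^esub> y)"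
    using y by (intro K'.minus_equality) (auto simp: M_smult)
  thus ?thesis using x y by (simp add: a_minus_def[of K'] K'_simps K.minus_eq')
qed

lemma hilbert_K': "hilbert_space K'"
proof (intro hilbert_space.intro hilbert_space_axioms.intro)
  show "Module.module complex_ring K'"
    by (rule Module.moduleI)
      (auto elim!: K'_cases simp: K'_simps cring_complex_ring abelian_group_K'
        K.sm_add_left K.sm_add_right K.sm_sm)
next
  fix s :: "nat \<Rightarrow> 'b"
  assume s: "range s \<subseteq> carrier K'"
    and cauchy: "\<And>e. e > 0 \<Longrightarrow> \<exists>N. \<forall>m\<ge>N. \<forall>n\<ge>N. hnorm K' (s m \<ominus>\<^bsub>K'\<^esub> s n) < e"
  define t where "t n = r (s n)" for n
  have sc: "s n \<in> carrier K'" for n using s by auto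
  have t: "t n \<in> M" and st: "s n = g (t n)" for n
    using sc r_M g_r by (simp_all add: t_def)
  have "\<exists>x\<in>carrier K. (\<lambda>n. hnorm K (t n \<ominus>\<^bsub>K\<^esub> x)) \<longlonglongrightarrow> 0"
    using t cauchy by (intro K.complete) (auto simp: st K'_simps K'_minus)
  then obtain x where x: "x \<in> carrier K" "(\<lambda>n. hnorm K (t n \<ominus>\<^bsub>K\<^esub> x)) \<longlonglongrightarrow> 0" by blast
  have "x \<in> M" using M_lim[of t x] t x by blast
  thus "\<exists>x\<in>carrier K'. (\<lambda>n. hnorm K' (s n \<ominus>\<^bsub>K'\<^esub> x)) \<longlonglongrightarrow> 0"
    using x t by (intro bexI[of _ "g x"]) (auto simp: st K'_simps K'_minus)
next
  fix u v assume "u \<in> carrier K'" "v \<in> carrier K'"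
  then obtain x y where "x \<in> M" "y \<in> M" "u = g x" "v = g y" by (auto elim!: K'_cases)
  thus "ip K' u v = cnj (ip K' v u)" using K.ip_cnj[of x y] by (simp add: K'_simps)
next
  fix u assume "u \<in> carrier K'" "ip K' u u = 0"
  then obtain x where "x \<in> M" "u = g x" "ip K x x = 0" by (auto elim!: K'_cases simp: K'_simps)
  thus "u = \<zero>\<^bsub>K'\<^esub>" using K.ip_definite[of x] by (simp add: K'_simps)
qed (auto elim!: K'_cases simp: K'_simps K.ip_add K.ip_smult K.ip_nonneg)

lemma bounded_into:
  assumes "bounded_op H K V" "\<And>x. x \<in> carrier H \<Longrightarrow> V x \<in> M"
  shows "bounded_op H K' (\<lambda>x. g (V x))"
proof -
  obtain C where "\<And>x. x \<in> carrier H \<Longrightarrow> hnorm K (V x) \<le> C * hnorm H x"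
    using assms(1) unfolding bounded_op_def by blast
  hence "\<exists>C. \<forall>x\<in>carrier H. hnorm K' (g (V x)) \<le> C * hnorm H x"
    using assms(2) by (auto simp: K'_simps)
  thus ?thesis unfolding bounded_op_def using assms bounded_opD[OF assms(1)]
    by (auto simp: K'_simps)
qed

lemma bounded_r: "bounded_op K' K r"
  unfolding bounded_op_def by (auto elim!: K'_cases simp: K'_simps intro!: exI[of _ 1])

lemma adjoint_into:
  assumes H: "hilbert_space H" and V: "bounded_op H K V"
    and VM: "\<And>x. x \<in> carrier H \<Longrightarrow> V x \<in> M"
    and eq: "\<And>x. x \<in> carrier H \<Longrightarrow> V' x = g (V x)" and u: "u \<in> carrier K'"
  shows "adj H K' V' u = adj H K V (r u)"
proof (rule adj_unique[OF H _ u])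
  have adj: "is_adjoint H K V (adj H K V)"
    using is_adjoint_adj[OF H K.hilbert_space_axioms V] .
  have "bounded_op K' H (\<lambda>u. adj H K V (r u))"
    using adj bounded_op_comp[OF K.hilbert_space_axioms bounded_r] unfolding is_adjoint_def by blast
  thus "is_adjoint H K' V' (\<lambda>u. adj H K V (r u))"
    using adj eq VM unfolding is_adjoint_def by (auto elim!: K'_cases simp: K'_simps)
qed

lemma bounded_restrict:
  assumes "bounded_op K K A" "\<And>x. x \<in> M \<Longrightarrow> A x \<in> M"
  shows "bounded_op K' K' (\<lambda>u. g (A (r u)))"
  using bounded_into[OF bounded_op_comp[OF K.hilbert_space_axioms bounded_r assms(1)]] assms(2) r_M
  by blast

lemma adjoint_restrict:
  assumes A: "bounded_op K K A" and AM: "\<And>x. x \<in> M \<Longrightarrow> A x \<in> M"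
    and A'M: "\<And>x. x \<in> M \<Longrightarrow> adj K K A x \<in> M" and u: "u \<in> carrier K'"
  shows "adj K' K' (\<lambda>u. g (A (r u))) u = g (adj K K A (r u))"
proof (rule adj_unique[OF hilbert_K' _ u])
  have adj: "is_adjoint K K A (adj K K A)"
    using is_adjoint_adj[OF K.hilbert_space_axioms K.hilbert_space_axioms A] .
  have "bounded_op K' K' (\<lambda>u. g (adj K K A (r u)))"
    using adj A'M unfolding is_adjoint_def by (intro bounded_restrict) auto
  thus "is_adjoint K' K' (\<lambda>u. g (A (r u))) (\<lambda>u. g (adj K K A (r u)))"
    using adj AM A'M unfolding is_adjoint_def by (auto elim!: K'_cases simp: K'_simps)
qed

lemma unitary_restrict:
  assumes U: "unitary K U" and UM: "\<And>x. x \<in> M \<Longrightarrow> U x \<in> M"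
    and U'M: "\<And>x. x \<in> M \<Longrightarrow> adj K K U x \<in> M"
  shows "unitary K' (\<lambda>u. g (U (r u)))"
proof -
  have bd: "bounded_op K K U" and eq: "\<And>x. x \<in> carrier K \<Longrightarrow> adj K K U (U x) = x"
    "\<And>x. x \<in> carrier K \<Longrightarrow> U (adj K K U x) = x"
    using U unfolding unitary_def by auto
  show ?thesis unfolding unitary_def
    using UM U'M by (auto elim!: K'_cases simp: bounded_restrict[OF bd UM]
      adjoint_restrict[OF bd UM U'M] M_carrier eq)
qed

end

text \<open>The closed linear span of a family indexed by \<open>nat \<times> 'h\<close> injects into \<open>'h universe\<close>,
  by sending a vector to a sequence of finite formal combinations approximating it.\<close>

definition lin_comb ::
  "'a hspace \<Rightarrow> (nat \<Rightarrow> 'h \<Rightarrow> 'a) \<Rightarrow> (complex \<times> nat \<times> 'h) list \<Rightarrow> 'a" where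
  "lin_comb K x l = foldr (\<lambda>(a, n, h) s. a \<odot>\<^bsub>K\<^esub> x n h \<oplus>\<^bsub>K\<^esub> s) l \<zero>\<^bsub>K\<^esub>"

locale spanning = hilbert_space K for K :: "'a hspace" (structure) +
  fixes x :: "nat \<Rightarrow> 'h \<Rightarrow> 'a"
  assumes x_carrier [simp]: "x n h \<in> carrier K"
begin

definition approx :: "'h universe \<Rightarrow> 'a \<Rightarrow> bool" where
  "approx L m \<longleftrightarrow> (\<lambda>n. hnorm K (lin_comb K x (L n) \<ominus> m)) \<longlonglongrightarrow> 0"

definition cspan :: "'a set" where
  "cspan = {m \<in> carrier K. \<exists>L. approx L m}"

definition code :: "'a \<Rightarrow> 'h universe" where
  "code m = (SOME L. approx L m)"

lemma lin_comb_Nil [simp]: "lin_comb K x [] = \<zero>"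
  by (simp add: lin_comb_def)

lemma lin_comb_Cons [simp]: "lin_comb K x ((a, n, h) # l) = a \<odot> x n h \<oplus> lin_comb K x l"
  by (simp add: lin_comb_def)

lemma lin_comb_carrier [simp]: "lin_comb K x l \<in> carrier K"
  by (induction l) auto

lemma lin_comb_append:
  "lin_comb K x (l @ l') = lin_comb K x l \<oplus> lin_comb K x l'"
  by (induction l) (auto simp: a_assoc)

lemma lin_comb_scale:
  "lin_comb K x (map (\<lambda>(b, n, h). (a * b, n, h)) l) = a \<odot> lin_comb K x l"
  by (induction l) (auto simp: sm_add_right sm_sm)

lemma approxI_bound:
  assumes "\<And>n. hnorm K (lin_comb K x (L n) \<ominus> m) \<le> f n" "f \<longlonglongrightarrow> 0" "m \<in> carrier K"
  shows "approx L m"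
  unfolding approx_def
  by (rule tendsto_sandwich[OF _ _ tendsto_const assms(2)]) (use assms in auto)

lemma x_cspan: "x n h \<in> cspan"
proof -
  have "approx (\<lambda>_. [(1, n, h)]) (x n h)"
    by (rule approxI_bound[where f = "\<lambda>_. 0"]) (auto simp: hnorm_minus_eq_0)
  thus ?thesis by (auto simp: cspan_def)
qed

lemma approx_code: "m \<in> cspan \<Longrightarrow> approx (code m) m"
  unfolding cspan_def code_def by (auto intro: someI[of "\<lambda>L. approx L m" for m])

lemma inj_code: "inj_on code cspan"
proof (rule inj_onI)
  fix m m' assume m: "m \<in> cspan" "m' \<in> cspan" "code m = code m'"
  hence "approx (code m) m" "approx (code m) m'" using approx_code by metis+
  thus "m = m'" unfolding approx_def using m
    by (intro limit_unique[of "\<lambda>n. lin_comb K x (code m n)"]) (auto simp: cspan_def)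
qed

lemma closed_subspace_cspan: "closed_subspace K cspan"
  unfolding closed_subspace_def
proof (intro conjI ballI allI impI)
  show "cspan \<subseteq> carrier K" by (auto simp: cspan_def)
  show "\<zero> \<in> cspan"
    by (auto simp: cspan_def intro!: exI[of _ "\<lambda>_. []"] approxI_bound[where f = "\<lambda>_. 0"]
      simp: hnorm_minus_eq_0)
next
  fix m m' assume m: "m \<in> cspan" and m': "m' \<in> cspan"
  obtain L L' where L: "approx L m" "approx L' m'" using m m' by (auto simp: cspan_def)
  have c: "m \<in> carrier K" "m' \<in> carrier K" using m m' by (auto simp: cspan_def)
  have "approx (\<lambda>n. L n @ L' n) (m \<oplus> m')"
  proof (rule approxI_bound)
    show "(\<lambda>n. hnorm K (lin_comb K x (L n) \<ominus> m) + hnorm K (lin_comb K x (L' n) \<ominus> m')) \<longlonglongrightarrow> 0"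
      using tendsto_add[OF L[unfolded approx_def]] by simp
    fix n
    let ?a = "lin_comb K x (L n)" and ?b = "lin_comb K x (L' n)"
    have "(?a \<oplus> ?b) \<ominus> (m \<oplus> m') = (?a \<ominus> m) \<oplus> (?b \<ominus> m')"
      using c by (intro ip_eqI) (auto simp: ip_simps)
    thus "hnorm K (lin_comb K x (L n @ L' n) \<ominus> (m \<oplus> m'))
        \<le> hnorm K (?a \<ominus> m) + hnorm K (?b \<ominus> m')"
      using c by (simp add: lin_comb_append hnorm_triangle)
  qed (use c in auto)
  thus "m \<oplus> m' \<in> cspan" using c by (auto simp: cspan_def)
next
  fix a m assume m: "m \<in> cspan"
  obtain L where L: "approx L m" using m by (auto simp: cspan_def)
  have c: "m \<in> carrier K" using m by (auto simp: cspan_def)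
  have "approx (\<lambda>n. map (\<lambda>(b, n, h). (a * b, n, h)) (L n)) (a \<odot> m)"
  proof (rule approxI_bound)
    show "(\<lambda>n. cmod a * hnorm K (lin_comb K x (L n) \<ominus> m)) \<longlonglongrightarrow> 0"
      using tendsto_mult_left[OF L[unfolded approx_def], of "cmod a"] by simp
    fix n
    have "a \<odot> lin_comb K x (L n) \<ominus> a \<odot> m = a \<odot> (lin_comb K x (L n) \<ominus> m)"
      using c by (intro ip_eqI) (auto simp: ip_simps algebra_simps)
    thus "hnorm K (lin_comb K x (map (\<lambda>(b, n, h). (a * b, n, h)) (L n)) \<ominus> a \<odot> m)
        \<le> cmod a * hnorm K (lin_comb K x (L n) \<ominus> m)"
      using c unfolding lin_comb_scale by (simp add: hnorm_smult)
  qed (use c in auto)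
  thus "a \<odot> m \<in> cspan" using c by (auto simp: cspan_def)
next
  fix s m assume s: "range s \<subseteq> cspan" and m: "m \<in> carrier K"
    and lim: "(\<lambda>n. hnorm K (s n \<ominus> m)) \<longlonglongrightarrow> 0"
  have sc: "s n \<in> carrier K" for n using s by (auto simp: cspan_def)
  have "\<exists>l. hnorm K (lin_comb K x l \<ominus> s n) < 1 / real (Suc n)" for n
  proof -
    obtain L where "approx L (s n)" using s by (auto simp: cspan_def)
    hence "eventually (\<lambda>k. hnorm K (lin_comb K x (L k) \<ominus> s n) < 1 / real (Suc n)) sequentially"
      unfolding approx_def by (rule order_tendstoD) simp
    thus ?thesis by (auto simp: eventually_sequentially)
  qed
  then obtain L where L: "\<And>n. hnorm K (lin_comb K x (L n) \<ominus> s n) < 1 / real (Suc n)" by metis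
  have "approx L m"
  proof (rule approxI_bound)
    show "(\<lambda>n. 1 / real (Suc n) + hnorm K (s n \<ominus> m)) \<longlonglongrightarrow> 0"
      using tendsto_add[OF lim_1_over_n[THEN LIMSEQ_Suc] lim] by simp
    fix n
    show "hnorm K (lin_comb K x (L n) \<ominus> m) \<le> 1 / real (Suc n) + hnorm K (s n \<ominus> m)"
      using hdist_triangle[of "lin_comb K x (L n)" "s n" m] L[of n] sc m by force
  qed (use m in auto)
  thus "m \<in> cspan" using m by (auto simp: cspan_def)
qed

lemma cspan_invariant:
  assumes A: "bounded_op K K A" and inv: "\<And>n h. \<exists>n'. A (x n h) = x n' h" and m: "m \<in> cspan"
  shows "A m \<in> cspan"
proof -
  note AD = bounded_opD[OF A]
  obtain f where f: "\<And>n h. A (x n h) = x (f n h) h" using inv by metis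
  obtain C where C: "\<And>x. x \<in> carrier K \<Longrightarrow> hnorm K (A x) \<le> C * hnorm K x"
    using A unfolding bounded_op_def by blast
  obtain L where L: "approx L m" using m by (auto simp: cspan_def)
  have c: "m \<in> carrier K" using m by (auto simp: cspan_def)
  have zero: "A \<zero> = \<zero>" using AD(3)[of \<zero> 0] AD(1)[of \<zero>] by simp
  have lin: "lin_comb K x (map (\<lambda>(a, n, h). (a, f n h, h)) l) = A (lin_comb K x l)" for l
    by (induction l) (auto simp: AD f zero)
  have "approx (\<lambda>n. map (\<lambda>(a, n, h). (a, f n h, h)) (L n)) (A m)"
  proof (rule approxI_bound)
    show "(\<lambda>n. C * hnorm K (lin_comb K x (L n) \<ominus> m)) \<longlonglongrightarrow> 0"
      using tendsto_mult_left[OF L[unfolded approx_def], of C] by simp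
    fix n
    have "A (lin_comb K x (L n)) \<ominus> A m = A (lin_comb K x (L n) \<ominus> m)"
      using c AD by (simp add: minus_eq')
    thus "hnorm K (lin_comb K x (map (\<lambda>(a, n, h). (a, f n h, h)) (L n)) \<ominus> A m)
        \<le> C * hnorm K (lin_comb K x (L n) \<ominus> m)"
      using c C by (simp add: lin)
  qed (use c AD in auto)
  thus ?thesis using c AD by (auto simp: cspan_def)
qed

lemma transported_cspan: "transported K cspan code"
  by (intro transported.intro transported_axioms.intro hilbert_space_axioms
    closed_subspace_cspan inj_code)

end

subsection \<open>Factorizations through arbitrary Hilbert spaces\<close>

theorem pencil_factorsI:
  fixes H :: "'h hspace" and K :: "'k hspace"
  assumes H: "hilbert_space H" and K: "hilbert_space K" and fac: "factors_through c d H T1 T2 K"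
  shows "pencil_factors c d H T1 T2"
proof -
  interpret K: hilbert_space K by fact
  obtain V0 V1 V2 where V: "bounded_op H K V0" "bounded_op H K V1" "bounded_op H K V2"
    and eq: "\<And>\<alpha> \<beta> x. x \<in> carrier H \<Longrightarrow> Qhat c d H T1 T2 \<alpha> \<beta> x =
        adj H K (\<lambda>x. V0 x \<oplus>\<^bsub>K\<^esub> complex_of_real \<alpha> \<odot>\<^bsub>K\<^esub> V1 x \<oplus>\<^bsub>K\<^esub> complex_of_real \<beta> \<odot>\<^bsub>K\<^esub> V2 x)
          (V0 x \<oplus>\<^bsub>K\<^esub> complex_of_real \<alpha> \<odot>\<^bsub>K\<^esub> V1 x \<oplus>\<^bsub>K\<^esub> complex_of_real \<beta> \<odot>\<^bsub>K\<^esub> V2 x)"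
    using fac unfolding factors_through_def Let_def by blast
  note VD = bounded_opD[OF V(1)] bounded_opD[OF V(2)] bounded_opD[OF V(3)]
  define x :: "nat \<Rightarrow> 'h \<Rightarrow> 'k" where
    "x n h = (if h \<in> carrier H then if n = 0 then V0 h else if n = 1 then V1 h else V2 h
              else \<zero>\<^bsub>K\<^esub>)" for n h
  interpret spanning K x
    by unfold_locales (auto simp: x_def VD)
  interpret tr: transported K "cspan" "code" by (rule transported_cspan)
  have VM: "V0 h \<in> cspan" "V1 h \<in> cspan" "V2 h \<in> cspan" if "h \<in> carrier H" for h
    using x_cspan[of 0 h] x_cspan[of 1 h] x_cspan[of 2 h] that by (auto simp: x_def)
  have "factors_through c d H T1 T2 tr.K'"
    unfolding factors_through_def Let_def
  proof (intro exI conjI allI ballI)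
    show "bounded_op H tr.K' (\<lambda>h. code (V0 h))" "bounded_op H tr.K' (\<lambda>h. code (V1 h))"
      "bounded_op H tr.K' (\<lambda>h. code (V2 h))"
      using VM V by (auto intro!: tr.bounded_into)
  next
    fix \<alpha> \<beta> h assume h: "h \<in> carrier H"
    let ?W = "\<lambda>x. V0 x \<oplus>\<^bsub>K\<^esub> complex_of_real \<alpha> \<odot>\<^bsub>K\<^esub> V1 x \<oplus>\<^bsub>K\<^esub> complex_of_real \<beta> \<odot>\<^bsub>K\<^esub> V2 x"
    let ?W' = "\<lambda>x. code (V0 x) \<oplus>\<^bsub>tr.K'\<^esub> complex_of_real \<alpha> \<odot>\<^bsub>tr.K'\<^esub> code (V1 x)
                 \<oplus>\<^bsub>tr.K'\<^esub> complex_of_real \<beta> \<odot>\<^bsub>tr.K'\<^esub> code (V2 x)"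
    have W: "bounded_op H K ?W"
      using V K by (intro bounded_op_add bounded_op_smult)
    have W': "?W' x = code (?W x)" and WM: "?W x \<in> cspan" if "x \<in> carrier H" for x
      using VM[OF that] by (simp_all add: tr.K'_simps)
    have "adj H tr.K' ?W' (?W' h) = adj H K ?W (tr.r (?W' h))"
      using W W' WM h by (intro tr.adjoint_into[OF H]) auto
    also have "tr.r (?W' h) = ?W h" using W'[OF h] WM[OF h] by simp
    finally show "Qhat c d H T1 T2 \<alpha> \<beta> h = adj H tr.K' ?W' (?W' h)"
      using eq[OF h] by simp
  qed
  thus ?thesis unfolding pencil_factors_def using tr.hilbert_K' by blast
qed

subsection \<open>Lifts through arbitrary Hilbert spaces\<close>

lemma dsum3_simps [simp]:
  "carrier (dsum3 F) = carrier F \<times> carrier F \<times> carrier F"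
  "\<zero>\<^bsub>dsum3 F\<^esub> = (\<zero>\<^bsub>F\<^esub>, \<zero>\<^bsub>F\<^esub>, \<zero>\<^bsub>F\<^esub>)"
  "(f, g, h) \<oplus>\<^bsub>dsum3 F\<^esub> (f', g', h') = (f \<oplus>\<^bsub>F\<^esub> f', g \<oplus>\<^bsub>F\<^esub> g', h \<oplus>\<^bsub>F\<^esub> h')"
  "a \<odot>\<^bsub>dsum3 F\<^esub> (f, g, h) = (a \<odot>\<^bsub>F\<^esub> f, a \<odot>\<^bsub>F\<^esub> g, a \<odot>\<^bsub>F\<^esub> h)"
  "ip (dsum3 F) (f, g, h) (f', g', h') = ip F f f' + ip F g g' + ip F h h'"
  by (simp_all add: dsum3_def)

lemma hilbert_dsum3:
  fixes F :: "'f hspace"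
  assumes F: "hilbert_space F"
  shows "hilbert_space (dsum3 F)"
proof -
  interpret F: hilbert_space F by fact
  let ?D = "dsum3 F"
  have grp: "abelian_group ?D"
  proof (rule abelian_groupI)
    fix v assume "v \<in> carrier ?D"
    then obtain f g h where v: "v = (f, g, h)" "f \<in> carrier F" "g \<in> carrier F" "h \<in> carrier F"
      by auto
    thus "\<exists>w\<in>carrier ?D. w \<oplus>\<^bsub>?D\<^esub> v = \<zero>\<^bsub>?D\<^esub>"
      by (intro bexI[of _ "(\<ominus>\<^bsub>F\<^esub> f, \<ominus>\<^bsub>F\<^esub> g, \<ominus>\<^bsub>F\<^esub> h)"]) (auto simp: F.l_neg)
  qed (auto simp: F.a_ac)
  interpret D: abelian_group ?D by (rule grp)
  have minus: "(f, g, h) \<ominus>\<^bsub>?D\<^esub> (f', g', h') = (f \<ominus>\<^bsub>F\<^esub> f', g \<ominus>\<^bsub>F\<^esub> g', h \<ominus>\<^bsub>F\<^esub> h')"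
    if "f' \<in> carrier F" "g' \<in> carrier F" "h' \<in> carrier F" for f g h f' g' h'
  proof -
    have "\<ominus>\<^bsub>?D\<^esub> (f', g', h') = (\<ominus>\<^bsub>F\<^esub> f', \<ominus>\<^bsub>F\<^esub> g', \<ominus>\<^bsub>F\<^esub> h')"
      using that by (intro D.minus_equality) (auto simp: F.l_neg)
    thus ?thesis by (simp add: a_minus_def)
  qed
  have nrm: "(hnorm ?D (f, g, h))\<^sup>2 = (hnorm F f)\<^sup>2 + (hnorm F g)\<^sup>2 + (hnorm F h)\<^sup>2"
    if "f \<in> carrier F" "g \<in> carrier F" "h \<in> carrier F" for f g h
    using that by (simp add: hnorm_def F.ip_self_nonneg)
  have nn: "hnorm ?D v \<ge> 0" if "v \<in> carrier ?D" for v
    using that by (auto simp: hnorm_def F.ip_self_nonneg)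
  show ?thesis
  proof (intro hilbert_space.intro hilbert_space_axioms.intro)
    show "Module.module complex_ring ?D"
      by (rule Module.moduleI)
        (auto simp: cring_complex_ring grp F.sm_add_left F.sm_add_right F.sm_sm)
  next
    fix s :: "nat \<Rightarrow> 'f \<times> 'f \<times> 'f"
    assume s: "range s \<subseteq> carrier ?D"
      and cauchy: "\<And>e. e > 0 \<Longrightarrow> \<exists>N. \<forall>m\<ge>N. \<forall>n\<ge>N. hnorm ?D (s m \<ominus>\<^bsub>?D\<^esub> s n) < e"
    define f g h where "f n = fst (s n)" and "g n = fst (snd (s n))" and "h n = snd (snd (s n))" for n
    have sc: "s n \<in> carrier ?D" for n using s by blast
    have s_eq: "s n = (f n, g n, h n)" for n by (simp add: f_def g_def h_def)
    have c: "f n \<in> carrier F" "g n \<in> carrier F" "h n \<in> carrier F" for n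
      using sc[of n] by (auto simp: s_eq)
    have le: "hnorm F (f m \<ominus>\<^bsub>F\<^esub> f n) \<le> hnorm ?D (s m \<ominus>\<^bsub>?D\<^esub> s n)"
      "hnorm F (g m \<ominus>\<^bsub>F\<^esub> g n) \<le> hnorm ?D (s m \<ominus>\<^bsub>?D\<^esub> s n)"
      "hnorm F (h m \<ominus>\<^bsub>F\<^esub> h n) \<le> hnorm ?D (s m \<ominus>\<^bsub>?D\<^esub> s n)" for m n
      by (rule power2_le_imp_le[OF _ nn]; use c in \<open>simp add: s_eq minus nrm\<close>)+
    have "\<exists>a\<in>carrier F. (\<lambda>n. hnorm F (f n \<ominus>\<^bsub>F\<^esub> a)) \<longlonglongrightarrow> 0"
      by (rule F.complete) (use c in blast, use cauchy le_less_trans[OF le(1)] in metis)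
    then obtain a where a: "a \<in> carrier F" "(\<lambda>n. hnorm F (f n \<ominus>\<^bsub>F\<^esub> a)) \<longlonglongrightarrow> 0" by blast
    have "\<exists>a\<in>carrier F. (\<lambda>n. hnorm F (g n \<ominus>\<^bsub>F\<^esub> a)) \<longlonglongrightarrow> 0"
      by (rule F.complete) (use c in blast, use cauchy le_less_trans[OF le(2)] in metis)
    then obtain b where b: "b \<in> carrier F" "(\<lambda>n. hnorm F (g n \<ominus>\<^bsub>F\<^esub> b)) \<longlonglongrightarrow> 0" by blast
    have "\<exists>a\<in>carrier F. (\<lambda>n. hnorm F (h n \<ominus>\<^bsub>F\<^esub> a)) \<longlonglongrightarrow> 0"
      by (rule F.complete) (use c in blast, use cauchy le_less_trans[OF le(3)] in metis)
    then obtain e where e: "e \<in> carrier F" "(\<lambda>n. hnorm F (h n \<ominus>\<^bsub>F\<^esub> e)) \<longlonglongrightarrow> 0" by blast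
    have "(\<lambda>n. sqrt ((hnorm ?D (s n \<ominus>\<^bsub>?D\<^esub> (a, b, e)))\<^sup>2)) \<longlonglongrightarrow> sqrt (0\<^sup>2 + 0\<^sup>2 + 0\<^sup>2)"
      using a b e c by (simp only: s_eq minus nrm F.minus_closed) (intro tendsto_intros)
    moreover have "sqrt ((hnorm ?D (s n \<ominus>\<^bsub>?D\<^esub> (a, b, e)))\<^sup>2) = hnorm ?D (s n \<ominus>\<^bsub>?D\<^esub> (a, b, e))" for n
      using a b e by (intro real_sqrt_unique nn D.minus_closed sc) auto
    ultimately have "(\<lambda>n. hnorm ?D (s n \<ominus>\<^bsub>?D\<^esub> (a, b, e))) \<longlonglongrightarrow> 0" by simp
    thus "\<exists>v\<in>carrier ?D. (\<lambda>n. hnorm ?D (s n \<ominus>\<^bsub>?D\<^esub> v)) \<longlonglongrightarrow> 0"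
      using a b e by (intro bexI[of _ "(a, b, e)"]) auto
  next
    fix v assume "v \<in> carrier ?D" "ip ?D v v = 0"
    then obtain f g h where v: "v = (f, g, h)" "f \<in> carrier F" "g \<in> carrier F" "h \<in> carrier F"
      and "ip F f f + ip F g g + ip F h h = 0" by auto
    hence "Re (ip F f f) + Re (ip F g g) + Re (ip F h h) = 0" by (simp add: complex_eq_iff)
    hence "Re (ip F f f) = 0" "Re (ip F g g) = 0" "Re (ip F h h) = 0"
      using F.ip_self_nonneg[OF v(2)] F.ip_self_nonneg[OF v(3)] F.ip_self_nonneg[OF v(4)]
      by linarith+
    thus "v = \<zero>\<^bsub>?D\<^esub>" using v F.hnorm_eq_0 by (auto simp: hnorm_def)
  next
    fix v w assume "v \<in> carrier ?D" "w \<in> carrier ?D"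
    thus "ip ?D v w = cnj (ip ?D w v)" by (auto simp: F.ip_cnj[symmetric])
  qed (auto simp: F.ip_simps F.ip_nonneg nonneg_Reals_add_I algebra_simps)
qed

theorem lifts_to_class_JI:
  fixes H :: "'h hspace" and F :: "'f hspace"
  assumes H: "hilbert_space H" and F: "hilbert_space F"
    and J: "class_J c d F J1 J2" and lift: "lifts_to H T1 T2 (dsum3 F) J1 J2"
    and T: "bounded_op H H T1" "bounded_op H H T2"
  shows "lifts_to_class_J c d H T1 T2"
proof -
  interpret F: hilbert_space F by fact
  obtain U1 U2 where U: "unitary F U1" "unitary F U2" and comm: "op_commute F U1 U2"
    and J_eq: "\<And>f g h. f \<in> carrier F \<Longrightarrow> g \<in> carrier F \<Longrightarrow> h \<in> carrier F \<Longrightarrow>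
           J1 (f, g, h) = (U1 f \<oplus>\<^bsub>F\<^esub> complex_of_real c \<odot>\<^bsub>F\<^esub> U1 g, U1 g, U1 h) \<and>
           J2 (f, g, h) = (U2 f \<oplus>\<^bsub>F\<^esub> complex_of_real d \<odot>\<^bsub>F\<^esub> U2 h, U2 g, U2 h)"
    using J unfolding class_J_def by blast
  obtain V where iso: "isometry H (dsum3 F) V"
    and VT: "\<And>h. h \<in> carrier H \<Longrightarrow> V (T1 h) = J1 (V h)" "\<And>h. h \<in> carrier H \<Longrightarrow> V (T2 h) = J2 (V h)"
    using lift unfolding lifts_to_def by blast
  have Vb: "bounded_op H (dsum3 F) V" and Vn: "\<And>h. h \<in> carrier H \<Longrightarrow> hnorm (dsum3 F) (V h) = hnorm H h"
    using iso unfolding isometry_def by auto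
  define p where "p k h = (if h \<in> carrier H
      then if k = 0 then fst (V h) else if k = 1 then fst (snd (V h)) else snd (snd (V h))
      else \<zero>\<^bsub>F\<^esub>)" for k :: nat and h
  have p_carrier [simp]: "p k h \<in> carrier F" for k h
    using bounded_opD(1)[OF Vb, of h] by (auto simp: p_def split: prod.splits)
  have V_eq: "V h = (p 0 h, p 1 h, p 2 h)" if "h \<in> carrier H" for h
    using that by (simp add: p_def)
  have Ub: "bounded_op F F U1" "bounded_op F F U2" using U by (auto simp: unitary_def)
  have U'b: "bounded_op F F (adj F F U1)" "bounded_op F F (adj F F U2)"
    using is_adjoint_adj[OF F F] Ub unfolding is_adjoint_def by auto
  define op where "op i = (if i = 0 then U1 else if i = 1 then adj F F U1
      else if i = 2 then U2 else adj F F U2)" for i :: nat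
  have op: "bounded_op F F (op i)" for i using Ub U'b by (simp add: op_def)
  define x where "x n h = foldr op (list_decode (snd (prod_decode n))) (p (fst (prod_decode n)) h)"
    for n h
  have fold_carrier: "foldr op w f \<in> carrier F" if "f \<in> carrier F" for w f
    using that by (induction w) (auto intro: bounded_opD(1)[OF op])
  interpret spanning F x
    by unfold_locales (simp add: x_def fold_carrier)
  interpret tr: transported F "cspan" "code" by (rule transported_cspan)
  have opM: "op i m \<in> cspan" if "m \<in> cspan" for i m
  proof (rule cspan_invariant[OF op _ that])
    fix n h
    have "op i (x n h) =
        x (prod_encode (fst (prod_decode n), list_encode (i # list_decode (snd (prod_decode n))))) h"
      by (simp add: x_def del: list_encode.simps)
    thus "\<exists>n'. op i (x n h) = x n' h" ..
  qed
  have UM: "U1 m \<in> cspan" "adj F F U1 m \<in> cspan" "U2 m \<in> cspan" "adj F F U2 m \<in> cspan"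
    if "m \<in> cspan" for m
    using opM[OF that, of 0] opM[OF that, of 1] opM[OF that, of 2] opM[OF that, of 3]
    by (simp_all add: op_def)
  have pM: "p k h \<in> cspan" for k h
    using x_cspan[of "prod_encode (k, list_encode [])" h] by (simp add: x_def del: list_encode.simps)
  let ?F = "tr.K'"
  let ?U1 = "\<lambda>u. code (U1 (tr.r u))" and ?U2 = "\<lambda>u. code (U2 (tr.r u))"
  define J1' where "J1' = (\<lambda>(f, g, h). (?U1 f \<oplus>\<^bsub>?F\<^esub> complex_of_real c \<odot>\<^bsub>?F\<^esub> ?U1 g, ?U1 g, ?U1 h))"
  define J2' where "J2' = (\<lambda>(f, g, h). (?U2 f \<oplus>\<^bsub>?F\<^esub> complex_of_real d \<odot>\<^bsub>?F\<^esub> ?U2 h, ?U2 g, ?U2 h))"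
  have "unitary ?F ?U1" "unitary ?F ?U2"
    using U UM by (auto intro!: tr.unitary_restrict)
  moreover have "op_commute ?F ?U1 ?U2"
    using comm UM unfolding op_commute_def by (auto elim!: tr.K'_cases simp: tr.K'_simps)
  ultimately have J': "class_J c d ?F J1' J2'"
    unfolding class_J_def by (intro exI[of _ ?U1] exI[of _ ?U2]) (auto simp: J1'_def J2'_def)
  define V' where "V' h = (code (p 0 h), code (p 1 h), code (p 2 h))" for h
  have V'n: "hnorm (dsum3 ?F) (V' h) = hnorm H h" if "h \<in> carrier H" for h
    using Vn[OF that] V_eq[OF that] pM by (simp add: V'_def hnorm_def tr.K'_simps)
  have p_add: "p k (h \<oplus>\<^bsub>H\<^esub> h') = p k h \<oplus>\<^bsub>F\<^esub> p k h'"
    and p_smult: "p k (a \<odot>\<^bsub>H\<^esub> h) = a \<odot>\<^bsub>F\<^esub> p k h"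
    if "h \<in> carrier H" "h' \<in> carrier H" for k h h' a
  proof -
    interpret H: hilbert_space H by fact
    have "V (h \<oplus>\<^bsub>H\<^esub> h') = V h \<oplus>\<^bsub>dsum3 F\<^esub> V h'" "V (a \<odot>\<^bsub>H\<^esub> h) = a \<odot>\<^bsub>dsum3 F\<^esub> V h"
      using bounded_opD(2,3)[OF Vb] that by auto
    moreover have "h \<oplus>\<^bsub>H\<^esub> h' \<in> carrier H" "a \<odot>\<^bsub>H\<^esub> h \<in> carrier H" using that by auto
    ultimately have *: "p 0 (h \<oplus>\<^bsub>H\<^esub> h') = p 0 h \<oplus>\<^bsub>F\<^esub> p 0 h'" "p 0 (a \<odot>\<^bsub>H\<^esub> h) = a \<odot>\<^bsub>F\<^esub> p 0 h"
      "p 1 (h \<oplus>\<^bsub>H\<^esub> h') = p 1 h \<oplus>\<^bsub>F\<^esub> p 1 h'" "p 1 (a \<odot>\<^bsub>H\<^esub> h) = a \<odot>\<^bsub>F\<^esub> p 1 h"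
      "p 2 (h \<oplus>\<^bsub>H\<^esub> h') = p 2 h \<oplus>\<^bsub>F\<^esub> p 2 h'" "p 2 (a \<odot>\<^bsub>H\<^esub> h) = a \<odot>\<^bsub>F\<^esub> p 2 h"
      using that by (simp_all add: V_eq)
    have "p k = p 0 \<or> p k = p 1 \<or> p k = p 2" by (auto simp: p_def fun_eq_iff)
    thus "p k (h \<oplus>\<^bsub>H\<^esub> h') = p k h \<oplus>\<^bsub>F\<^esub> p k h'" "p k (a \<odot>\<^bsub>H\<^esub> h) = a \<odot>\<^bsub>F\<^esub> p k h"
      using * by auto
  qed
  have "bounded_op H (dsum3 ?F) V'"
    unfolding bounded_op_def
  proof (intro conjI ballI allI)
    show "V' \<in> carrier H \<rightarrow> carrier (dsum3 ?F)" using pM by (auto simp: V'_def)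
    show "\<exists>C. \<forall>x\<in>carrier H. hnorm (dsum3 ?F) (V' x) \<le> C * hnorm H x"
      using V'n by (intro exI[of _ 1]) auto
  qed (use pM in \<open>auto simp: V'_def p_add p_smult tr.K'_simps\<close>)
  hence "isometry H (dsum3 ?F) V'" using V'n by (simp add: isometry_def)
  moreover have "V' (T1 h) = J1' (V' h)" "V' (T2 h) = J2' (V' h)" if h: "h \<in> carrier H" for h
  proof -
    have "T1 h \<in> carrier H" "T2 h \<in> carrier H" using T h by (auto dest: bounded_opD(1))
    hence "(p 0 (T1 h), p 1 (T1 h), p 2 (T1 h)) = J1 (p 0 h, p 1 h, p 2 h)"
      "(p 0 (T2 h), p 1 (T2 h), p 2 (T2 h)) = J2 (p 0 h, p 1 h, p 2 h)"
      using VT[OF h] V_eq[OF h] V_eq[of "T1 h"] V_eq[of "T2 h"] by simp_all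
    thus "V' (T1 h) = J1' (V' h)" "V' (T2 h) = J2' (V' h)"
      using pM UM by (simp_all add: J_eq V'_def J1'_def J2'_def tr.K'_simps)
  qed
  ultimately have "lifts_to H T1 T2 (dsum3 ?F) J1' J2'" unfolding lifts_to_def by blast
  thus ?thesis unfolding lifts_to_class_J_def using J' tr.hilbert_K' by blast
qed

end

theory Submission
  imports Defs "HOL-Analysis.Infinite_Sum"
begin

text \<open>The source of the counterexample is the gap between nonnegative quadratic matrix polynomials in two
real variables and sums of squares. With \<open>x = (1, \<alpha>, \<beta>)\<close>, the \<open>3 \<times> 3\<close> matrix
\<open>R(\<alpha>, \<beta>) = 5/2 diag(1 + \<beta>\<^sup>2, 1 + \<alpha>\<^sup>2, \<alpha>\<^sup>2 + \<beta>\<^sup>2) - x x\<^sup>T\<close>, a variant of Choi's biquadratic form,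
is positive for all real \<open>\<alpha>, \<beta>\<close>, in fact bounded below by \<open>1/2 diag(1 + \<beta>\<^sup>2, 1 + \<alpha>\<^sup>2, \<alpha>\<^sup>2 + \<beta>\<^sup>2)\<close>
(\<open>choi_inequality\<close>).
It is not of the form \<open>W\<^sup>* W\<close> with \<open>W = V\<^sub>0 + \<alpha> V\<^sub>1 + \<beta> V\<^sub>2\<close>: writing \<open>v\<^sub>i\<^sub>j\<close> for \<open>V\<^sub>i e\<^sub>j\<close>,
the diagonal entries force \<open>v\<^sub>1\<^sub>0 = v\<^sub>2\<^sub>1 = v\<^sub>0\<^sub>2 = 0\<close>, so that the off-diagonal
entries \<open>-x\<^sub>i x\<^sub>j\<close> can come only from the inner products of \<open>v\<^sub>0\<^sub>0, v\<^sub>1\<^sub>1, v\<^sub>2\<^sub>2\<close>. These vectors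
have squared norms \<open>3/2\<close> and pairwise inner products \<open>-1\<close>, and their sum
would have squared norm \<open>9/2 - 6 < 0\<close> (\<open>choi_not_factorizable\<close>).

To realise \<open>R\<close> as the pencil of a 3-isometric pair, let
\<open>P = R + R\<^sub>2\<^sub>0 / c\<^sup>2 + R\<^sub>0\<^sub>2 / d\<^sup>2\<close>, where \<open>R\<^sub>2\<^sub>0\<close> and \<open>R\<^sub>0\<^sub>2\<close> are the coefficients of \<open>\<alpha>\<^sup>2\<close> and \<open>\<beta>\<^sup>2\<close>,
and let \<open>H\<close> be the space of functions \<open>f\<close> from \<open>\<int>\<^sup>2\<close> to \<open>\<complex>\<^sup>3\<close> for which
\<open>\<Sum>\<^sub>k\<^sub>l \<langle>P(k, l) f(k, l), f(k, l)\<rangle>\<close> is finite. Let \<open>T\<close> and \<open>S\<close> be the two coordinate translations.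
Then \<open>\<langle>T\<^sup>n S\<^sup>m f, T\<^sup>n S\<^sup>m g\<rangle> = \<Sum>\<^sub>k\<^sub>l \<langle>P(k + n, l + m) f(k, l), g(k, l)\<rangle>\<close> is a quadratic
polynomial in \<open>n, m\<close>, which is what 3-isometric means. Since \<open>P\<close> and \<open>R\<close>
have the same leading coefficients, passing from \<open>Q\<close> to its corrected pencil turns \<open>P(k + \<alpha>, l + \<beta>)\<close>
into \<open>R(k + \<alpha>, l + \<beta>)\<close> at every site (\<open>ip_Qhat_has_sum\<close>). Hence the pair is in the class F, and
the site \<open>(0, 0)\<close> carries the form \<open>R\<close> itself, so the pencil does not factor. The translations and
their inverses are bounded because \<open>P\<close> changes by at most a constant factor between neighbouring
sites (\<open>weight_neighbour\<close>).

A lift to the class J would give a factorization: if \<open>V = (f, g, h)\<close> intertwines, then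
\<open>\<parallel>T\<^sup>n S\<^sup>m x\<parallel>\<^sup>2 = \<parallel>f x + c n g x + d m h x\<parallel>\<^sup>2 + \<parallel>g x\<parallel>\<^sup>2 + \<parallel>h x\<parallel>\<^sup>2\<close>, and the last two terms are exactly what the
corrected pencil subtracts (\<open>lift_imp_factors_through\<close>).\<close>

section \<open>Quadratic polynomials in two variables\<close>

definition biquad :: "(nat \<Rightarrow> nat \<Rightarrow> complex) \<Rightarrow> real \<Rightarrow> real \<Rightarrow> complex" where
  "biquad p \<alpha> \<beta> = p 0 0 + of_real \<alpha> * p 1 0 + of_real \<beta> * p 0 1 + of_real (\<alpha>\<^sup>2) * p 2 0
     + of_real (\<alpha> * \<beta>) * p 1 1 + of_real (\<beta>\<^sup>2) * p 0 2"

text \<open>A quadratic polynomial in two variables is determined linearly by its values at the six lattice points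
of the triangle \<open>n + m \<le> 2\<close>. Linear weights, rather than mere uniqueness, are what allows the
polynomial identity to be transferred to operators and to infinite sums below.\<close>

lemma biquad_interpolation:
  obtains w :: "nat \<Rightarrow> nat \<Rightarrow> nat \<Rightarrow> nat \<Rightarrow> complex"
  where "\<And>p i j. i + j \<le> 2 \<Longrightarrow>
    p i j = (\<Sum>(n, m)\<in>{(n, m). n + m \<le> 2}. w i j n m * biquad p (real n) (real m))"
proof -
  \<comment> \<open>Newton interpolation: divided forward differences at the origin.\<close>
  define w :: "nat \<Rightarrow> nat \<Rightarrow> nat \<Rightarrow> nat \<Rightarrow> complex" where
    "w i j n m = (if (i, j) = (0, 0) then (if (n, m) = (0, 0) then 1 else 0)
      else if (i, j) = (1, 0) then (if m \<noteq> 0 then 0 else if n = 0 then - 3 / 2 else if n = 1 then 2 else - 1 / 2)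
      else if (i, j) = (0, 1) then (if n \<noteq> 0 then 0 else if m = 0 then - 3 / 2 else if m = 1 then 2 else - 1 / 2)
      else if (i, j) = (2, 0) then (if m \<noteq> 0 then 0 else if n = 1 then - 1 else 1 / 2)
      else if (i, j) = (0, 2) then (if n \<noteq> 0 then 0 else if m = 1 then - 1 else 1 / 2)
      else if n + m = 1 then - 1 else if n + m = 0 \<or> n = m then 1 else 0)" for i j n m
  have six: "(\<Sum>(n, m)\<in>{(n, m). n + m \<le> (2::nat)}. f n m) = f 0 0 + f 1 0 + f 0 1 + f 2 0 + f 1 1 + f 0 2"
    for f :: "nat \<Rightarrow> nat \<Rightarrow> complex"
    unfolding coeff_index_set by (simp add: add.assoc)
  have node: "biquad p (real 0) (real 0) = p 0 0" "biquad p (real 1) (real 0) = p 0 0 + p 1 0 + p 2 0"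
    "biquad p (real 0) (real 1) = p 0 0 + p 0 1 + p 0 2" "biquad p (real 2) (real 0) = p 0 0 + 2 * p 1 0 + 4 * p 2 0"
    "biquad p (real 0) (real 2) = p 0 0 + 2 * p 0 1 + 4 * p 0 2"
    "biquad p (real 1) (real 1) = p 0 0 + p 1 0 + p 0 1 + p 2 0 + p 1 1 + p 0 2" for p
    by (simp_all add: biquad_def)
  have "p i j = (\<Sum>(n, m)\<in>{(n, m). n + m \<le> 2}. w i j n m * biquad p (real n) (real m))"
    if "i + j \<le> 2" for p i j
  proof -
    have "(i, j) \<in> {(i, j). i + j \<le> (2::nat)}" using that by simp
    then consider "i = 0" "j = 0" | "i = 1" "j = 0" | "i = 0" "j = 1" | "i = 2" "j = 0"
      | "i = 1" "j = 1" | "i = 0" "j = 2"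
      unfolding coeff_index_set by auto
    thus ?thesis
      unfolding six node by cases (simp_all add: w_def, simp_all add: field_simps)
  qed
  thus thesis by (rule that)
qed

lemma biquad_unique:
  assumes "\<And>n m. biquad p (real n) (real m) = biquad p' (real n) (real m)" "i + j \<le> 2"
  shows "p i j = p' i j"
proof -
  obtain w :: "nat \<Rightarrow> nat \<Rightarrow> nat \<Rightarrow> nat \<Rightarrow> complex" where
    w: "\<And>p i j. i + j \<le> 2 \<Longrightarrow>
      p i j = (\<Sum>(n, m)\<in>{(n, m). n + m \<le> 2}. w i j n m * biquad p (real n) (real m))"
    by (rule biquad_interpolation) blast
  show ?thesis using w[OF assms(2), of p] w[OF assms(2), of p'] by (simp add: assms(1))
qed

lemma biquad_cong:
  assumes "\<And>i j. i + j \<le> 2 \<Longrightarrow> p i j = p' i j"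
  shows "biquad p \<alpha> \<beta> = biquad p' \<alpha> \<beta>"
  using assms by (simp add: biquad_def)

lemma ip_quad_pencil_biquad:
  assumes "hilbert_space H" "\<And>i j. i + j \<le> 2 \<Longrightarrow> bounded_op H H (B i j)"
    "x \<in> carrier H" "y \<in> carrier H"
  shows "ip H (quad_pencil H B \<alpha> \<beta> x) y = biquad (\<lambda>i j. ip H (B i j x) y) \<alpha> \<beta>"
  using ip_quad_pencil[OF assms] by (simp add: biquad_def)

section \<open>Operators and adjoints\<close>

lemma bounded_op_id: "hilbert_space H \<Longrightarrow> bounded_op H H (\<lambda>x. x)"
  unfolding bounded_op_def by (auto intro!: exI[of _ 1])

lemma bounded_op_funpow:
  assumes "hilbert_space H" "bounded_op H H A"
  shows "bounded_op H H (A ^^ n)"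
proof (induction n)
  case 0
  thus ?case using bounded_op_id[OF assms(1)] by (simp add: id_def)
next
  case (Suc n)
  thus ?case using bounded_op_comp[OF assms(1) Suc assms(2)] by (simp add: comp_def)
qed

lemma bounded_op_cong:
  assumes "hilbert_space H" "bounded_op H K A" "\<And>x. x \<in> carrier H \<Longrightarrow> B x = A x"
  shows "bounded_op H K B"
proof -
  interpret hilbert_space H by fact
  show ?thesis using assms(2,3) unfolding bounded_op_def by auto
qed

lemma bounded_op_finsum:
  assumes H: "hilbert_space H" and K: "hilbert_space K"
    and "finite I" "\<And>i. i \<in> I \<Longrightarrow> bounded_op H K (A i)"
  shows "bounded_op H K (\<lambda>x. finsum K (\<lambda>i. A i x) I)"
  using assms(3,4)
proof (induction I rule: finite_induct)
  interpret H: hilbert_space H by fact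
  interpret K: hilbert_space K by fact
  case empty
  show ?case unfolding bounded_op_def by (auto intro!: exI[of _ 0])
next
  interpret K: hilbert_space K by fact
  case (insert i I)
  have "bounded_op H K (\<lambda>x. A i x \<oplus>\<^bsub>K\<^esub> finsum K (\<lambda>i. A i x) I)"
    using insert by (intro bounded_op_add[OF K]) auto
  thus ?case
    by (rule bounded_op_cong[OF H], subst K.finsum_insert) (use insert in \<open>auto intro: bounded_opD(1)\<close>)
qed

lemma ip_adj:
  assumes "hilbert_space H" "hilbert_space K" "bounded_op H K A" "x \<in> carrier K" "y \<in> carrier H"
  shows "ip H (adj H K A x) y = ip K x (A y)"
proof -
  have adj: "is_adjoint H K A (adj H K A)" using assms by (intro is_adjoint_adj)
  have "adj H K A x \<in> carrier H" "A y \<in> carrier K"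
    using adj assms unfolding is_adjoint_def by (auto dest: bounded_opD(1))
  thus ?thesis
    using adj assms hilbert_space.ip_cnj[of H] hilbert_space.ip_cnj[of K]
    unfolding is_adjoint_def by metis
qed

lemma bounded_op_adj:
  assumes "hilbert_space H" "hilbert_space K" "bounded_op H K A"
  shows "bounded_op K H (adj H K A)"
  using is_adjoint_adj[OF assms] by (simp add: is_adjoint_def)

lemma ip_adj_funpow:
  assumes H: "hilbert_space H" and A: "bounded_op H H A" and x: "x \<in> carrier H" and "y \<in> carrier H"
  shows "ip H ((adj H H A ^^ n) x) y = ip H x ((A ^^ n) y)"
  using \<open>y \<in> carrier H\<close>
proof (induction n arbitrary: y)
  case (Suc n)
  have "(adj H H A ^^ n) x \<in> carrier H" "A y \<in> carrier H"
    using bounded_opD(1)[OF bounded_op_funpow[OF H bounded_op_adj[OF H H A]] x]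
      bounded_opD(1)[OF A Suc.prems] by auto
  thus ?case
    using Suc.IH[of "A y"] Suc.prems by (simp add: ip_adj[OF H H A] funpow_swap1[of A])
qed simp

text \<open>Polarization.\<close>

lemma isometry_ip:
  assumes H: "hilbert_space H" and K: "hilbert_space K" and V: "isometry H K V"
    and x: "x \<in> carrier H" and y: "y \<in> carrier H"
  shows "ip K (V x) (V y) = ip H x y"
proof -
  interpret H: hilbert_space H by fact
  interpret K: hilbert_space K by fact
  have b: "bounded_op H K V" and n: "\<And>x. x \<in> carrier H \<Longrightarrow> hnorm K (V x) = hnorm H x"
    using V by (auto simp: isometry_def)
  note VD = bounded_opD[OF b]
  have re: "Re (ip K (V x) (V y)) = Re (ip H x y)" if x: "x \<in> carrier H" for x
  proof -
    have "Re (ip K (V (x \<oplus>\<^bsub>H\<^esub> y)) (V (x \<oplus>\<^bsub>H\<^esub> y))) = Re (ip H (x \<oplus>\<^bsub>H\<^esub> y) (x \<oplus>\<^bsub>H\<^esub> y))"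
      using n[of "x \<oplus>\<^bsub>H\<^esub> y"] x y VD(1) by (simp flip: K.hnorm_sq H.hnorm_sq)
    moreover have "Re (ip K (V x) (V x)) = Re (ip H x x)" "Re (ip K (V y) (V y)) = Re (ip H y y)"
      using n x y VD(1) by (simp_all flip: K.hnorm_sq H.hnorm_sq)
    ultimately show ?thesis
      using x y VD K.ip_cnj[of "V y" "V x"] H.ip_cnj[of y x] by (simp add: K.ip_simps H.ip_simps)
  qed
  have "Re (ip K (V (\<i> \<odot>\<^bsub>H\<^esub> x)) (V y)) = Re (ip H (\<i> \<odot>\<^bsub>H\<^esub> x) y)"
    using x by (intro re) auto
  thus ?thesis using re[OF x] x y VD by (simp add: K.ip_simps H.ip_simps complex_eq_iff)
qed

section \<open>Recognising 3-isometric pairs\<close>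

text \<open>Testing the defining identity of a 3-isometric pair against vectors removes the adjoints:
only the forms \<open>\<langle>T\<^sup>n S\<^sup>m x, T\<^sup>n S\<^sup>m y\<rangle>\<close> matter.\<close>

definition power_form :: "'a hspace \<Rightarrow> ('a \<Rightarrow> 'a) \<Rightarrow> ('a \<Rightarrow> 'a) \<Rightarrow> 'a \<Rightarrow> 'a \<Rightarrow> nat \<Rightarrow> nat \<Rightarrow> complex" where
  "power_form H T S x y n m = ip H ((T ^^ n) ((S ^^ m) x)) ((T ^^ n) ((S ^^ m) y))"

lemma ip_gram_operator:
  assumes H: "hilbert_space H" and T: "bounded_op H H T" and S: "bounded_op H H S"
    and x: "x \<in> carrier H" and y: "y \<in> carrier H"
  shows "ip H (((adj H H S ^^ m) \<circ> (adj H H T ^^ n) \<circ> (T ^^ n) \<circ> (S ^^ m)) x) y = power_form H T S x y n m"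
proof -
  have p: "(A ^^ k) z \<in> carrier H" if "bounded_op H H A" "z \<in> carrier H" for A k z
    using bounded_opD(1)[OF bounded_op_funpow[OF H that(1)] that(2)] .
  show ?thesis
    using p T S x y bounded_op_adj[OF H H T]
    by (simp add: power_form_def ip_adj_funpow[OF H S] ip_adj_funpow[OF H T])
qed

text \<open>The coefficient operators need not be constructed by hand: interpolation writes them as
combinations of the six bounded operators \<open>S\<^sup>*\<^sup>m T\<^sup>*\<^sup>n T\<^sup>n S\<^sup>m\<close> with \<open>n + m \<le> 2\<close>, so they are bounded
as soon as \<open>T\<close> and \<open>S\<close> are.\<close>

lemma three_isometricI:
  assumes H: "hilbert_space H" and T: "bounded_op H H T" and S: "bounded_op H H S"
    and comm: "op_commute H T S"
    and quad: "\<And>x y. x \<in> carrier H \<Longrightarrow> y \<in> carrier H \<Longrightarrow>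
      \<exists>p. \<forall>n m. power_form H T S x y n m = biquad p (real n) (real m)"
  shows "three_isometric H T S"
proof -
  interpret hilbert_space H by fact
  define A where "A n m = (adj H H S ^^ m) \<circ> (adj H H T ^^ n) \<circ> (T ^^ n) \<circ> (S ^^ m)" for n m
  have A: "bounded_op H H (A n m)" for n m
  proof -
    have "bounded_op H H ((T ^^ n) \<circ> (S ^^ m))"
      using bounded_op_comp[OF H bounded_op_funpow[OF H S] bounded_op_funpow[OF H T]] by (simp add: comp_def)
    moreover have "bounded_op H H ((adj H H S ^^ m) \<circ> (adj H H T ^^ n))"
      using bounded_op_comp[OF H bounded_op_funpow[OF H bounded_op_adj[OF H H T]]
          bounded_op_funpow[OF H bounded_op_adj[OF H H S]]] by (simp add: comp_def)
    ultimately show ?thesis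
      using bounded_op_comp[OF H, of H "(T ^^ n) \<circ> (S ^^ m)" H "(adj H H S ^^ m) \<circ> (adj H H T ^^ n)"]
      by (simp add: A_def comp_def)
  qed
  have ipA: "ip H (A n m x) y = power_form H T S x y n m" if "x \<in> carrier H" "y \<in> carrier H" for n m x y
    unfolding A_def using ip_gram_operator[OF H T S that] .
  obtain w :: "nat \<Rightarrow> nat \<Rightarrow> nat \<Rightarrow> nat \<Rightarrow> complex" where
    w: "\<And>p i j. i + j \<le> 2 \<Longrightarrow>
      p i j = (\<Sum>(n, m)\<in>{(n, m). n + m \<le> 2}. w i j n m * biquad p (real n) (real m))"
    by (rule biquad_interpolation) blast
  have fin: "finite {(n, m). n + m \<le> (2::nat)}" by (simp add: coeff_index_set)
  define B where "B i j x = finsum H (\<lambda>k. case k of (n, m) \<Rightarrow> w i j n m \<odot>\<^bsub>H\<^esub> A n m x) {(n, m). n + m \<le> 2}"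
    for i j x
  have B: "bounded_op H H (B i j)" for i j
    unfolding B_def by (rule bounded_op_finsum[OF H H fin]) (auto intro!: bounded_op_smult[OF H] A)
  have ipB: "ip H (B i j x) y = p i j"
    if x: "x \<in> carrier H" and y: "y \<in> carrier H" and ij: "i + j \<le> 2"
      and p: "\<And>n m. power_form H T S x y n m = biquad p (real n) (real m)" for i j x y p
  proof -
    have Ax: "A n m x \<in> carrier H" for n m using bounded_opD(1)[OF A x] .
    have "ip H (B i j x) y = (\<Sum>k\<in>{(n, m). n + m \<le> 2}. ip H (case k of (n, m) \<Rightarrow> w i j n m \<odot>\<^bsub>H\<^esub> A n m x) y)"
      unfolding B_def by (rule ip_finsum[OF fin _ y]) (auto simp: Ax)
    also have "\<dots> = p i j"
      unfolding w[OF ij, of p] using x y by (intro sum.cong) (auto simp: ip_smult Ax ipA p)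
    finally show ?thesis .
  qed
  have "is_coeffs H T S B"
    unfolding is_coeffs_def
  proof (intro conjI allI impI ballI B)
    fix n m x assume x: "x \<in> carrier H"
    have "A n m x = quad_pencil H B (real n) (real m) x"
    proof (rule ip_eqI)
      show "A n m x \<in> carrier H" using bounded_opD(1)[OF A x] .
      show "quad_pencil H B (real n) (real m) x \<in> carrier H"
        unfolding quad_pencil_def using bounded_opD(1)[OF B x] by (intro finsum_closed) auto
      fix y assume y: "y \<in> carrier H"
      obtain p where p: "\<And>n m. power_form H T S x y n m = biquad p (real n) (real m)"
        using quad[OF x y] by metis
      show "ip H (A n m x) y = ip H (quad_pencil H B (real n) (real m) x) y"
        unfolding ip_quad_pencil_biquad[OF H B x y] ipA[OF x y] p
        by (rule biquad_cong) (simp add: ipB[OF x y _ p])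
    qed
    thus "((adj H H S ^^ m) \<circ> (adj H H T ^^ n) \<circ> (T ^^ n) \<circ> (S ^^ m)) x
        = quad_pencil H B (real n) (real m) x" by (simp add: A_def)
  qed
  thus ?thesis unfolding three_isometric_def using T S comm by blast
qed

lemma coeffs_bounded:
  assumes "three_isometric H T S" "i + j \<le> 2"
  shows "bounded_op H H (coeffs H T S i j)"
  using is_coeffs_coeffs[OF assms(1)] assms(2) by (simp add: is_coeffs_def)

lemma Qhat_carrier:
  assumes H: "hilbert_space H" and 3: "three_isometric H T S" and x: "x \<in> carrier H"
  shows "Qhat c d H T S \<alpha> \<beta> x \<in> carrier H"
proof -
  interpret hilbert_space H by fact
  have "coeffs H T S i j x \<in> carrier H" if "i + j \<le> 2" for i j
    using coeffs_bounded[OF 3 that] x by (rule bounded_opD(1))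
  thus ?thesis
    unfolding Qhat_def Qpencil_def quad_pencil_def by (auto intro!: finsum_closed minus_closed)
qed

text \<open>The operators \<open>B\<^sub>i\<^sub>j\<close> are recovered weakly from the polynomial \<open>p\<close> by uniqueness of its coefficients;
this is the only way in which the corrected pencil is computed below.\<close>

lemma ip_Qhat:
  assumes H: "hilbert_space H" and 3: "three_isometric H T S"
    and x: "x \<in> carrier H" and y: "y \<in> carrier H"
    and p: "\<And>n m. power_form H T S x y n m = biquad p (real n) (real m)"
  shows "ip H (Qhat c d H T S \<alpha> \<beta> x) y = biquad p \<alpha> \<beta> - p 2 0 / c\<^sup>2 - p 0 2 / d\<^sup>2"
proof -
  interpret hilbert_space H by fact
  let ?B = "coeffs H T S"
  have TS: "bounded_op H H T" "bounded_op H H S" using 3 by (auto simp: three_isometric_def)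
  have B: "bounded_op H H (?B i j)" if "i + j \<le> 2" for i j using coeffs_bounded[OF 3 that] .
  have Bx: "?B i j x \<in> carrier H" if "i + j \<le> 2" for i j using bounded_opD(1)[OF B[OF that] x] .
  have Q: "quad_pencil H ?B \<alpha> \<beta> x \<in> carrier H"
    unfolding quad_pencil_def using Bx by (intro finsum_closed) auto
  have eq: "biquad (\<lambda>i j. ip H (?B i j x) y) (real n) (real m) = biquad p (real n) (real m)" for n m
    unfolding p[symmetric] ip_gram_operator[OF H TS x y, symmetric]
    using is_coeffs_coeffs[OF 3] x ip_quad_pencil_biquad[OF H B x y] by (simp add: is_coeffs_def)
  have coeff: "ip H (?B i j x) y = p i j" if "i + j \<le> 2" for i j
    using biquad_unique[of "\<lambda>i j. ip H (?B i j x) y", OF eq that] .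
  have "ip H (Qhat c d H T S \<alpha> \<beta> x) y = biquad (\<lambda>i j. ip H (?B i j x) y) \<alpha> \<beta>
      - of_real (1 / c\<^sup>2) * ip H (?B 2 0 x) y - of_real (1 / d\<^sup>2) * ip H (?B 0 2 x) y"
    unfolding Qhat_def Qpencil_def using Q Bx y ip_quad_pencil_biquad[OF H B x y]
    by (simp add: ip_minus ip_smult)
  also have "\<dots> = biquad p \<alpha> \<beta> - p 2 0 / c\<^sup>2 - p 0 2 / d\<^sup>2"
    using biquad_cong[of "\<lambda>i j. ip H (?B i j x) y" p] by (simp add: coeff)
  finally show ?thesis .
qed

section \<open>A lift factors the pencil\<close>

lemma unitary_ip:
  assumes F: "hilbert_space F" and U: "unitary F U" and x: "x \<in> carrier F" and y: "y \<in> carrier F"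
  shows "ip F ((U ^^ n) x) ((U ^^ n) y) = ip F x y"
proof (induction n)
  case (Suc n)
  have b: "bounded_op F F U" and inv: "\<And>x. x \<in> carrier F \<Longrightarrow> adj F F U (U x) = x"
    using U by (auto simp: unitary_def)
  have c: "(U ^^ n) x \<in> carrier F" "(U ^^ n) y \<in> carrier F"
    using bounded_opD(1)[OF bounded_op_funpow[OF F b]] x y by auto
  hence "U ((U ^^ n) x) \<in> carrier F" using bounded_opD(1)[OF b] by simp
  thus ?case
    using ip_adj[OF F F b, of "U ((U ^^ n) x)" "(U ^^ n) y"] c Suc by (simp add: inv)
qed simp

text \<open>The powers of \<open>J\<^sub>1\<close> are \<open>U\<^sub>1\<^sup>n\<close> applied after a shear that is linear in \<open>n\<close>, and likewise for \<open>J\<^sub>2\<close>. The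
unitaries drop out of the inner product.\<close>

lemma power_form_lift:
  assumes F: "hilbert_space F"
    and U: "unitary F U1" "unitary F U2"
    and J: "\<forall>f\<in>carrier F. \<forall>g\<in>carrier F. \<forall>h\<in>carrier F.
        J1 (f, g, h) = (U1 f \<oplus>\<^bsub>F\<^esub> complex_of_real c \<odot>\<^bsub>F\<^esub> U1 g, U1 g, U1 h) \<and>
        J2 (f, g, h) = (U2 f \<oplus>\<^bsub>F\<^esub> complex_of_real d \<odot>\<^bsub>F\<^esub> U2 h, U2 g, U2 h)"
    and v: "f \<in> carrier F" "g \<in> carrier F" "h \<in> carrier F"
    and v': "f' \<in> carrier F" "g' \<in> carrier F" "h' \<in> carrier F"
  shows "power_form (dsum3 F) J1 J2 (f, g, h) (f', g', h') n m =
    ip F (f \<oplus>\<^bsub>F\<^esub> of_real (n * c) \<odot>\<^bsub>F\<^esub> g \<oplus>\<^bsub>F\<^esub> of_real (m * d) \<odot>\<^bsub>F\<^esub> h)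
         (f' \<oplus>\<^bsub>F\<^esub> of_real (n * c) \<odot>\<^bsub>F\<^esub> g' \<oplus>\<^bsub>F\<^esub> of_real (m * d) \<odot>\<^bsub>F\<^esub> h')
    + ip F g g' + ip F h h'"
proof -
  interpret F: hilbert_space F by fact
  have Ub: "bounded_op F F U1" "bounded_op F F U2" using U by (auto simp: unitary_def)
  note U1D = bounded_opD[OF Ub(1)] and U2D = bounded_opD[OF Ub(2)]
  note P1D = bounded_opD[OF bounded_op_funpow[OF F Ub(1)]]
  note P2D = bounded_opD[OF bounded_op_funpow[OF F Ub(2)]]
  have J1: "(J1 ^^ n) (f, g, h) =
      ((U1 ^^ n) (f \<oplus>\<^bsub>F\<^esub> of_real (n * c) \<odot>\<^bsub>F\<^esub> g), (U1 ^^ n) g, (U1 ^^ n) h)"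
    if "f \<in> carrier F" "g \<in> carrier F" "h \<in> carrier F" for f g h n
  proof (induction n)
    case (Suc n)
    show ?case using that
      by (simp add: Suc.IH J P1D U1D F.sm_add_left F.a_assoc algebra_simps) (simp add: F.a_ac P1D U1D)
  qed (use that in simp)
  have J2: "(J2 ^^ n) (f, g, h) =
      ((U2 ^^ n) (f \<oplus>\<^bsub>F\<^esub> of_real (n * d) \<odot>\<^bsub>F\<^esub> h), (U2 ^^ n) g, (U2 ^^ n) h)"
    if "f \<in> carrier F" "g \<in> carrier F" "h \<in> carrier F" for f g h n
  proof (induction n)
    case (Suc n)
    show ?case using that
      by (simp add: Suc.IH J P2D U2D F.sm_add_left F.a_assoc algebra_simps) (simp add: F.a_ac P2D U2D)
  qed (use that in simp)
  define C where "C f g h = f \<oplus>\<^bsub>F\<^esub> of_real (n * c) \<odot>\<^bsub>F\<^esub> g \<oplus>\<^bsub>F\<^esub> of_real (m * d) \<odot>\<^bsub>F\<^esub> h" for f g h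
  have C: "C f g h \<in> carrier F" if "f \<in> carrier F" "g \<in> carrier F" "h \<in> carrier F" for f g h
    using that by (simp add: C_def)
  have "(J1 ^^ n) ((J2 ^^ m) (f, g, h)) =
      ((U1 ^^ n) ((U2 ^^ m) (C f g h)), (U1 ^^ n) ((U2 ^^ m) g), (U1 ^^ n) ((U2 ^^ m) h))"
    if "f \<in> carrier F" "g \<in> carrier F" "h \<in> carrier F" for f g h
    using that by (simp add: J1 J2 P2D F.a_ac C_def)
  thus ?thesis
    using v v' unfolding power_form_def C_def[symmetric]
    by (simp add: unitary_ip[OF F U(1)] unitary_ip[OF F U(2)] P2D C)
qed

text \<open>If \<open>V = (f, g, h)\<close> is the lifting isometry, the \<open>n\<^sup>2\<close> coefficient of the form in \<open>power_form_lift\<close> is \<open>c\<^sup>2 g\<^sup>* g\<close> and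
the \<open>m\<^sup>2\<close> coefficient is \<open>d\<^sup>2 h\<^sup>* h\<close>. The corrections in the definition of the pencil therefore
cancel the terms \<open>g\<^sup>* g + h\<^sup>* h\<close>, and what remains is
\<open>(f + c \<alpha> g + d \<beta> h)\<^sup>* (f + c \<alpha> g + d \<beta> h)\<close>.\<close>

theorem lift_imp_factors_through:
  assumes H: "hilbert_space H" and F: "hilbert_space F" and 3: "three_isometric H T S"
    and c: "c > 0" and d: "d > 0"
    and J: "class_J c d F J1 J2" and lift: "lifts_to H T S (dsum3 F) J1 J2"
  shows "factors_through c d H T S F"
proof -
  interpret H: hilbert_space H by fact
  interpret F: hilbert_space F by fact
  have D: "hilbert_space (dsum3 F)" using hilbert_dsum3[OF F] .
  obtain U1 U2 where U: "unitary F U1" "unitary F U2"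
    and J_eq: "\<forall>f\<in>carrier F. \<forall>g\<in>carrier F. \<forall>h\<in>carrier F.
           J1 (f, g, h) = (U1 f \<oplus>\<^bsub>F\<^esub> complex_of_real c \<odot>\<^bsub>F\<^esub> U1 g, U1 g, U1 h) \<and>
           J2 (f, g, h) = (U2 f \<oplus>\<^bsub>F\<^esub> complex_of_real d \<odot>\<^bsub>F\<^esub> U2 h, U2 g, U2 h)"
    using J unfolding class_J_def by blast
  obtain V where iso: "isometry H (dsum3 F) V"
    and VT: "\<And>x. x \<in> carrier H \<Longrightarrow> V (T x) = J1 (V x)" "\<And>x. x \<in> carrier H \<Longrightarrow> V (S x) = J2 (V x)"
    using lift unfolding lifts_to_def by blast
  have Vb: "bounded_op H (dsum3 F) V" and Vn: "\<And>x. x \<in> carrier H \<Longrightarrow> hnorm (dsum3 F) (V x) = hnorm H x"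
    using iso by (auto simp: isometry_def)
  have TS: "bounded_op H H T" "bounded_op H H S" using 3 by (auto simp: three_isometric_def)
  define f where "f x = fst (V x)" for x
  define g where "g x = fst (snd (V x))" for x
  define h where "h x = snd (snd (V x))" for x
  have V_eq: "V x = (f x, g x, h x)" for x by (simp add: f_def g_def h_def)
  have cl: "f x \<in> carrier F" "g x \<in> carrier F" "h x \<in> carrier F" if "x \<in> carrier H" for x
    using bounded_opD(1)[OF Vb that] by (auto simp: V_eq)
  have le: "hnorm F (f x) \<le> hnorm H x" "hnorm F (g x) \<le> hnorm H x" "hnorm F (h x) \<le> hnorm H x"
    if x: "x \<in> carrier H" for x
  proof -
    have "(hnorm H x)\<^sup>2 = (hnorm F (f x))\<^sup>2 + (hnorm F (g x))\<^sup>2 + (hnorm F (h x))\<^sup>2"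
      using Vn[OF x, symmetric] cl[OF x] by (simp add: hnorm_def V_eq F.ip_self_nonneg)
    hence "(hnorm F (f x))\<^sup>2 \<le> (hnorm H x)\<^sup>2" "(hnorm F (g x))\<^sup>2 \<le> (hnorm H x)\<^sup>2"
      "(hnorm F (h x))\<^sup>2 \<le> (hnorm H x)\<^sup>2" by simp_all
    thus "hnorm F (f x) \<le> hnorm H x" "hnorm F (g x) \<le> hnorm H x" "hnorm F (h x) \<le> hnorm H x"
      using power2_le_imp_le H.hnorm_nonneg[OF x] by blast+
  qed
  have bd: "bounded_op H F f" "bounded_op H F g" "bounded_op H F h"
    using cl le bounded_opD(2,3)[OF Vb] by (auto simp: bounded_op_def V_eq intro!: exI[of _ 1])
  define W where "W \<alpha> \<beta> x = f x \<oplus>\<^bsub>F\<^esub> of_real \<alpha> \<odot>\<^bsub>F\<^esub> (of_real c \<odot>\<^bsub>F\<^esub> g x)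
      \<oplus>\<^bsub>F\<^esub> of_real \<beta> \<odot>\<^bsub>F\<^esub> (of_real d \<odot>\<^bsub>F\<^esub> h x)" for \<alpha> \<beta> x
  have W: "bounded_op H F (W \<alpha> \<beta>)" for \<alpha> \<beta>
    unfolding W_def using bd by (intro bounded_op_add bounded_op_smult F)
  have pow: "power_form H T S x y n m = power_form (dsum3 F) J1 J2 (V x) (V y) n m"
    if x: "x \<in> carrier H" and y: "y \<in> carrier H" for x y n m
  proof -
    have S: "(S ^^ k) z \<in> carrier H" "V ((S ^^ k) z) = (J2 ^^ k) (V z)" if "z \<in> carrier H" for k z
      using that by (induction k) (auto simp: VT bounded_opD(1)[OF TS(2)])
    have T: "(T ^^ k) z \<in> carrier H" "V ((T ^^ k) z) = (J1 ^^ k) (V z)" if "z \<in> carrier H" for k z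
      using that by (induction k) (auto simp: VT bounded_opD(1)[OF TS(1)])
    show ?thesis
      using isometry_ip[OF H D iso, of "(T ^^ n) ((S ^^ m) x)" "(T ^^ n) ((S ^^ m) y)"] S T x y
      by (simp add: power_form_def)
  qed
  have "Qhat c d H T S \<alpha> \<beta> x = adj H F (W \<alpha> \<beta>) (W \<alpha> \<beta> x)" if x: "x \<in> carrier H" for \<alpha> \<beta> x
  proof (rule H.ip_eqI)
    show "Qhat c d H T S \<alpha> \<beta> x \<in> carrier H" using Qhat_carrier[OF H 3 x] .
    have Wx: "W \<alpha> \<beta> x \<in> carrier F" using bounded_opD(1)[OF W x] .
    show "adj H F (W \<alpha> \<beta>) (W \<alpha> \<beta> x) \<in> carrier H"
      using bounded_opD(1)[OF bounded_op_adj[OF H F W] Wx] .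
    fix y assume y: "y \<in> carrier H"
    define p where "p i j =
      (if (i, j) = (0, 0) then ip F (f x) (f y) + ip F (g x) (g y) + ip F (h x) (h y)
       else if (i, j) = (1, 0) then of_real c * (ip F (f x) (g y) + ip F (g x) (f y))
       else if (i, j) = (0, 1) then of_real d * (ip F (f x) (h y) + ip F (h x) (f y))
       else if (i, j) = (2, 0) then of_real (c\<^sup>2) * ip F (g x) (g y)
       else if (i, j) = (0, 2) then of_real (d\<^sup>2) * ip F (h x) (h y)
       else of_real (c * d) * (ip F (g x) (h y) + ip F (h x) (g y)))" for i j :: nat
    have p: "power_form H T S x y n m = biquad p (real n) (real m)" for n m
      unfolding pow[OF x y] V_eq power_form_lift[OF F U J_eq cl[OF x] cl[OF y]]
      using cl[OF x] cl[OF y]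
      by (simp add: p_def biquad_def F.ip_simps power2_eq_square algebra_simps)
    have "ip H (Qhat c d H T S \<alpha> \<beta> x) y = biquad p \<alpha> \<beta> - p 2 0 / c\<^sup>2 - p 0 2 / d\<^sup>2"
      by (rule ip_Qhat[OF H 3 x y p])
    also have "\<dots> = ip F (W \<alpha> \<beta> x) (W \<alpha> \<beta> y)"
      using cl[OF x] cl[OF y] c d
      by (simp add: W_def p_def biquad_def F.ip_simps power2_eq_square algebra_simps)
    also have "\<dots> = ip H (adj H F (W \<alpha> \<beta>) (W \<alpha> \<beta> x)) y"
      using ip_adj[OF H F W Wx y] by simp
    finally show "ip H (Qhat c d H T S \<alpha> \<beta> x) y = ip H (adj H F (W \<alpha> \<beta>) (W \<alpha> \<beta> x)) y" .
  qed
  thus ?thesis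
    unfolding factors_through_def Let_def W_def
    using bd bounded_op_smult[OF F bd(2)] bounded_op_smult[OF F bd(3)] by blast
qed

corollary lifts_to_class_J_imp_pencil_factors:
  assumes "hilbert_space H" "three_isometric H T S" "c > 0" "d > 0" "lifts_to_class_J c d H T S"
  shows "pencil_factors c d H T S"
  using assms lift_imp_factors_through unfolding lifts_to_class_J_def pencil_factors_def by metis

section \<open>Hilbert spaces from families of positive forms\<close>

text \<open>The Hilbert direct sum of the spaces defined by positive sesquilinear forms \<open>q s\<close>, realised as a
space of scalar functions on an index type \<open>'i\<close>. The forms may read any coordinates of a function;
\<open>q_coord\<close> says that every coordinate is controlled by some form, which gives definiteness and
makes norm convergence imply pointwise convergence. With \<open>q_lim\<close> a pointwise limit can then be
taken inside the forms, which gives completeness.\<close>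

locale form_family =
  fixes q :: "'s \<Rightarrow> ('i \<Rightarrow> complex) \<Rightarrow> ('i \<Rightarrow> complex) \<Rightarrow> complex"
  assumes q_add: "q s (\<lambda>i. f i + g i) h = q s f h + q s g h"
    and q_smult: "q s (\<lambda>i. a * f i) h = a * q s f h"
    and q_cnj: "q s f g = cnj (q s g f)"
    and q_nonneg: "Re (q s f f) \<ge> 0"
    and q_lim: "(\<And>i. (\<lambda>n. F n i) \<longlonglongrightarrow> f i) \<Longrightarrow> (\<lambda>n. q s (F n) (F n)) \<longlonglongrightarrow> q s f f"
    and q_coord: "\<exists>s \<delta>. \<delta> > 0 \<and> (\<forall>f. \<delta> * (cmod (f i))\<^sup>2 \<le> Re (q s f f))"
begin

definition sq :: "('i \<Rightarrow> complex) \<Rightarrow> 's \<Rightarrow> real" where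
  "sq f s = Re (q s f f)"

definition form_space :: "('i \<Rightarrow> complex) hspace" where
  "form_space = \<lparr>carrier = {f. sq f summable_on UNIV}, monoid.mult = undefined, one = undefined,
     zero = (\<lambda>_. 0), add = (\<lambda>f g i. f i + g i), smult = (\<lambda>a f i. a * f i),
     ip = (\<lambda>f g. \<Sum>\<^sub>\<infinity>s. q s f g)\<rparr>"

lemma form_space_simps:
  "f \<in> carrier form_space \<longleftrightarrow> sq f summable_on UNIV" "\<zero>\<^bsub>form_space\<^esub> = (\<lambda>_. 0)"
  "f \<oplus>\<^bsub>form_space\<^esub> g = (\<lambda>i. f i + g i)" "a \<odot>\<^bsub>form_space\<^esub> f = (\<lambda>i. a * f i)"
  "ip form_space f g = (\<Sum>\<^sub>\<infinity>s. q s f g)"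
  by (simp_all add: form_space_def)

lemma q_add_right: "q s h (\<lambda>i. f i + g i) = q s h f + q s h g"
  by (simp add: q_cnj[of s h] q_add)

lemma q_smult_right: "q s h (\<lambda>i. a * f i) = cnj a * q s h f"
  by (simp add: q_cnj[of s h] q_smult)

lemma sq_nonneg: "sq f s \<ge> 0"
  by (simp add: sq_def q_nonneg)

lemma q_self: "q s f f = of_real (sq f s)"
proof -
  have "Im (q s f f) = 0" using arg_cong[OF q_cnj[of s f f], of Im] by simp
  thus ?thesis by (simp add: sq_def complex_eq_iff)
qed

lemma sq_smult: "sq (\<lambda>i. a * f i) s = (cmod a)\<^sup>2 * sq f s"
proof -
  have "q s (\<lambda>i. a * f i) (\<lambda>i. a * f i) = (a * cnj a) * q s f f"
    by (simp add: q_smult q_smult_right)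
  also have "\<dots> = of_real ((cmod a)\<^sup>2 * sq f s)"
    by (simp add: q_self complex_norm_square[symmetric] del: of_real_power)
  finally show ?thesis by (simp add: sq_def)
qed

lemma Re_q_le: "\<bar>Re (q s f g)\<bar> \<le> (sq f s + sq g s) / 2"
proof -
  have gf: "q s g f = cnj (q s f g)" by (rule q_cnj)
  have plus: "sq (\<lambda>i. f i + g i) s = sq f s + sq g s + 2 * Re (q s f g)"
    by (simp add: sq_def q_add q_add_right gf)
  have "sq (\<lambda>i. f i + (-1) * g i) s = sq f s + sq g s - 2 * Re (q s f g)"
    unfolding sq_def by (simp only: q_add q_add_right q_smult q_smult_right) (simp add: gf)
  thus ?thesis
    using plus sq_nonneg[of "\<lambda>i. f i + g i" s] sq_nonneg[of "\<lambda>i. f i + (-1) * g i" s]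
    unfolding abs_le_iff by (simp add: field_simps)
qed

text \<open>A weak substitute for the Cauchy-Schwarz inequality, enough for summability of the inner product.\<close>

lemma norm_q_le: "cmod (q s f g) \<le> sq f s + sq g s"
proof -
  have "Im (q s f g) = Re (q s (\<lambda>i. (-\<i>) * f i) g)" by (simp only: q_smult) simp
  hence "\<bar>Im (q s f g)\<bar> \<le> (sq f s + sq g s) / 2"
    using Re_q_le[of s "\<lambda>i. (-\<i>) * f i" g] by (simp add: sq_smult del: mult_minus_left)
  thus ?thesis using Re_q_le[of s f g] cmod_le[of "q s f g"] by (simp add: field_simps)
qed

lemma sq_add_le: "sq (\<lambda>i. f i + g i) s \<le> 2 * sq f s + 2 * sq g s"
proof -
  have "sq (\<lambda>i. f i + g i) s = sq f s + sq g s + 2 * Re (q s f g)"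
    by (simp add: sq_def q_add q_add_right q_cnj[of s g f])
  thus ?thesis using Re_q_le[of s f g] sq_nonneg[of f s] sq_nonneg[of g s] by (simp add: abs_le_iff field_simps)
qed

lemma q_summable:
  assumes "sq f summable_on UNIV" "sq g summable_on UNIV"
  shows "(\<lambda>s. q s f g) summable_on UNIV"
proof (rule abs_summable_summable, rule abs_summable_on_comparison_test')
  show "(\<lambda>s. sq f s + sq g s) summable_on UNIV" using assms by (rule summable_on_add)
qed (rule norm_q_le)

lemma sq_summable_comparison:
  assumes "g summable_on (UNIV :: 's set)" "\<And>s. sq f s \<le> g s"
  shows "sq f summable_on UNIV"
  using summable_on_comparison_test[OF assms(1), of "sq f"] assms(2) sq_nonneg by simp

lemma ip_self_form_space:
  assumes "sq f summable_on UNIV"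
  shows "ip form_space f f = of_real (\<Sum>\<^sub>\<infinity>s. sq f s)"
proof -
  have "((\<lambda>s. complex_of_real (sq f s)) has_sum of_real (\<Sum>\<^sub>\<infinity>s. sq f s)) UNIV"
    using assms by (simp add: has_sum_of_real_iff)
  thus ?thesis by (simp add: form_space_simps q_self infsumI)
qed

lemma hnorm_form_space:
  assumes "sq f summable_on UNIV"
  shows "(hnorm form_space f)\<^sup>2 = (\<Sum>\<^sub>\<infinity>s. sq f s)" and "hnorm form_space f \<ge> 0"
  using assms by (simp_all add: hnorm_def ip_self_form_space infsum_nonneg sq_nonneg)

lemma sum_sq_le:
  assumes "sq f summable_on UNIV" "finite A"
  shows "sum (sq f) A \<le> (hnorm form_space f)\<^sup>2"
  unfolding hnorm_form_space(1)[OF assms(1)]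
  using assms by (intro finite_sum_le_infsum) (auto simp: sq_nonneg)

lemma eq_zero_if_sq_zero:
  assumes "\<And>s. sq f s = 0"
  shows "f = (\<lambda>_. 0)"
proof
  fix i
  obtain s \<delta> where "\<delta> > 0" "\<delta> * (cmod (f i))\<^sup>2 \<le> Re (q s f f)" using q_coord by blast
  thus "f i = 0" using assms[of s] by (simp add: sq_def mult_le_0_iff)
qed

lemma module_form_space: "Module.module complex_ring form_space"
proof (rule Module.moduleI)
  show "abelian_group form_space"
  proof (rule abelian_groupI)
    fix f g assume "f \<in> carrier form_space" "g \<in> carrier form_space"
    hence "(\<lambda>s. 2 * sq f s + 2 * sq g s) summable_on UNIV"
      by (intro summable_on_add summable_on_cmult_right) (auto simp: form_space_simps)
    thus "f \<oplus>\<^bsub>form_space\<^esub> g \<in> carrier form_space"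
      unfolding form_space_simps using sq_add_le by (rule sq_summable_comparison)
  next
    have "sq (\<lambda>_. 0) s = 0" for s using sq_smult[of 0 "\<lambda>_. 0" s] by simp
    hence "sq (\<lambda>_. 0) = (\<lambda>_. 0)" by blast
    thus "\<zero>\<^bsub>form_space\<^esub> \<in> carrier form_space" by (simp add: form_space_simps)
  next
    fix f assume f: "f \<in> carrier form_space"
    have "sq (\<lambda>i. - f i) s = sq f s" for s using sq_smult[of "-1" f s] by simp
    hence "sq (\<lambda>i. - f i) = sq f" by blast
    hence "(\<lambda>i. - f i) \<in> carrier form_space" using f by (simp add: form_space_simps)
    thus "\<exists>g\<in>carrier form_space. g \<oplus>\<^bsub>form_space\<^esub> f = \<zero>\<^bsub>form_space\<^esub>"
      by (rule bexI[rotated]) (simp add: form_space_simps)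
  qed (auto simp: form_space_simps add_ac)
  show "a \<odot>\<^bsub>form_space\<^esub> f \<in> carrier form_space" if "f \<in> carrier form_space" for a f
  proof -
    have "sq (\<lambda>i. a * f i) = (\<lambda>s. (cmod a)\<^sup>2 * sq f s)" by (auto simp: sq_smult)
    thus ?thesis using that by (auto simp: form_space_simps intro!: summable_on_cmult_right)
  qed
qed (auto simp: form_space_simps cring_complex_ring algebra_simps)

lemma minus_form_space:
  assumes "f \<in> carrier form_space" "g \<in> carrier form_space"
  shows "f \<ominus>\<^bsub>form_space\<^esub> g = (\<lambda>i. f i - g i)" "(\<lambda>i. f i - g i) \<in> carrier form_space"
proof -
  interpret Module.module complex_ring form_space by (rule module_form_space)
  have "\<ominus>\<^bsub>form_space\<^esub> g = (-1) \<odot>\<^bsub>form_space\<^esub> g"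
    using smult_l_minus[of 1 g] assms smult_one by simp
  thus "f \<ominus>\<^bsub>form_space\<^esub> g = (\<lambda>i. f i - g i)" by (simp add: a_minus_def form_space_simps)
  moreover have "f \<ominus>\<^bsub>form_space\<^esub> g \<in> carrier form_space" using assms by (rule minus_closed)
  ultimately show "(\<lambda>i. f i - g i) \<in> carrier form_space" by simp
qed

text \<open>The usual proof that a space of square-summable functions is complete: the limit \<open>f\<close> is taken coordinate by coordinate, and the
bound for finite partial sums of \<open>\<parallel>\<sigma> n - \<sigma> m\<parallel>\<^sup>2\<close> survives the limit \<open>m \<rightarrow> \<infinity>\<close>.\<close>

lemma complete_form_space:
  assumes \<sigma>: "range \<sigma> \<subseteq> carrier form_space"
    and cauchy: "\<And>e. e > 0 \<Longrightarrow> \<exists>N. \<forall>m\<ge>N. \<forall>n\<ge>N. hnorm form_space (\<sigma> m \<ominus>\<^bsub>form_space\<^esub> \<sigma> n) < e"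
  shows "\<exists>f\<in>carrier form_space. (\<lambda>n. hnorm form_space (\<sigma> n \<ominus>\<^bsub>form_space\<^esub> f)) \<longlonglongrightarrow> 0"
proof -
  have c: "\<sigma> n \<in> carrier form_space" for n using \<sigma> by blast
  define D where "D m n = (\<lambda>i. \<sigma> m i - \<sigma> n i)" for m n
  have D: "\<sigma> m \<ominus>\<^bsub>form_space\<^esub> \<sigma> n = D m n" "sq (D m n) summable_on UNIV" for m n
    using minus_form_space[OF c c, of m n] by (simp_all add: D_def form_space_simps)
  have "convergent (\<lambda>n. \<sigma> n i)" for i
  proof -
    obtain s \<delta> where \<delta>: "\<delta> > 0" "\<And>f. \<delta> * (cmod (f i))\<^sup>2 \<le> sq f s"
      using q_coord unfolding sq_def by blast
    have "Cauchy (\<lambda>n. \<sigma> n i)"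
    proof (rule CauchyI)
      fix e :: real assume e: "e > 0"
      define e' where "e' = sqrt \<delta> * e"
      have "e' > 0" using \<delta> e by (simp add: e'_def)
      then obtain N where N: "\<And>m n. m \<ge> N \<Longrightarrow> n \<ge> N \<Longrightarrow> hnorm form_space (D m n) < e'"
        using cauchy unfolding D by metis
      have "cmod (\<sigma> m i - \<sigma> n i) < e" if "m \<ge> N" "n \<ge> N" for m n
      proof -
        have "\<delta> * (cmod (D m n i))\<^sup>2 \<le> sum (sq (D m n)) {s}" using \<delta>(2) by simp
        also have "\<dots> \<le> (hnorm form_space (D m n))\<^sup>2" by (rule sum_sq_le[OF D(2)]) simp
        also have "\<dots> < e'\<^sup>2" using N[OF that] hnorm_form_space(2)[OF D(2)] by (intro power_strict_mono) auto
        also have "\<dots> = \<delta> * e\<^sup>2" using \<delta>(1) by (simp add: e'_def power_mult_distrib)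
        finally have "(cmod (D m n i))\<^sup>2 < e\<^sup>2" using \<delta>(1) by simp
        thus ?thesis using e by (simp add: D_def power2_less_imp_less)
      qed
      thus "\<exists>N. \<forall>m\<ge>N. \<forall>n\<ge>N. norm (\<sigma> m i - \<sigma> n i) < e" by blast
    qed
    thus ?thesis by (rule Cauchy_convergent)
  qed
  then obtain f where f: "\<And>i. (\<lambda>n. \<sigma> n i) \<longlonglongrightarrow> f i" unfolding convergent_def by metis
  define R where "R n = (\<lambda>i. \<sigma> n i - f i)" for n
  have bound: "sum (sq (R n)) A \<le> e\<^sup>2"
    if fin: "finite A" and N: "\<And>m. m \<ge> N \<Longrightarrow> hnorm form_space (D n m) \<le> e" for A N n e
  proof -
    have "(\<lambda>m. sum (sq (D n m)) A) \<longlonglongrightarrow> sum (sq (R n)) A"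
      unfolding sq_def R_def D_def by (intro tendsto_sum tendsto_Re q_lim tendsto_diff tendsto_const f)
    moreover have "sum (sq (D n m)) A \<le> e\<^sup>2" if "m \<ge> N" for m
      using sum_sq_le[OF D(2) fin, of n m] power_mono[OF N[OF that] hnorm_form_space(2)[OF D(2)], of 2]
      by linarith
    ultimately show ?thesis by (intro LIMSEQ_le_const2) auto
  qed
  have tail: "\<exists>N. \<forall>n\<ge>N. sq (R n) summable_on UNIV \<and> hnorm form_space (R n) \<le> e" if e: "e > 0" for e
  proof -
    obtain N where N: "\<And>m n. m \<ge> N \<Longrightarrow> n \<ge> N \<Longrightarrow> hnorm form_space (D m n) < e"
      using cauchy[OF e] unfolding D by metis
    have "sq (R n) summable_on UNIV \<and> hnorm form_space (R n) \<le> e" if n: "n \<ge> N" for n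
    proof -
      have b: "sum (sq (R n)) A \<le> e\<^sup>2" if "finite A" for A
        using bound[OF that, of N n e] N[OF n] by force
      have s: "sq (R n) summable_on UNIV"
        using b by (intro nonneg_bdd_above_summable_on bdd_aboveI2) (auto simp: sq_nonneg)
      have "(hnorm form_space (R n))\<^sup>2 \<le> e\<^sup>2"
        unfolding hnorm_form_space(1)[OF s] using b by (intro infsum_le_finite_sums s) auto
      thus ?thesis using s e by (auto intro: power2_le_imp_le)
    qed
    thus ?thesis by blast
  qed
  obtain N where "sq (R N) summable_on UNIV" using tail[of 1] by auto
  hence "(\<lambda>i. \<sigma> N i - R N i) \<in> carrier form_space"
    using minus_form_space(2)[OF c, of "R N" N] by (simp add: form_space_simps)
  hence fc: "f \<in> carrier form_space" by (simp add: R_def)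
  have "(\<lambda>n. hnorm form_space (R n)) \<longlonglongrightarrow> 0"
  proof (rule LIMSEQ_I)
    fix e :: real assume "e > 0"
    then obtain N where N: "\<forall>n\<ge>N. sq (R n) summable_on UNIV \<and> hnorm form_space (R n) \<le> e / 2"
      using tail[of "e / 2"] by auto
    have "norm (hnorm form_space (R n) - 0) < e" if "n \<ge> N" for n
    proof -
      have "sq (R n) summable_on UNIV" "hnorm form_space (R n) \<le> e / 2" using N that by auto
      thus ?thesis using hnorm_form_space(2)[of "R n"] \<open>e > 0\<close> by simp
    qed
    thus "\<exists>N. \<forall>n\<ge>N. norm (hnorm form_space (R n) - 0) < e" by blast
  qed
  thus ?thesis using fc by (intro bexI[of _ f]) (auto simp: minus_form_space(1)[OF c fc] R_def)
qed

lemma hilbert_space_form_space: "hilbert_space form_space"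
proof (intro hilbert_space.intro hilbert_space_axioms.intro module_form_space complete_form_space)
  fix f g h assume "f \<in> carrier form_space" "g \<in> carrier form_space" "h \<in> carrier form_space"
  thus "ip form_space (f \<oplus>\<^bsub>form_space\<^esub> g) h = ip form_space f h + ip form_space g h"
    by (simp add: form_space_simps q_add infsum_add q_summable)
next
  fix f g and a :: complex
  show "ip form_space (a \<odot>\<^bsub>form_space\<^esub> f) g = a * ip form_space f g"
    by (simp add: form_space_simps q_smult infsum_cmult_right')
next
  fix f g :: "'i \<Rightarrow> complex"
  show "ip form_space f g = cnj (ip form_space g f)"
    by (simp add: form_space_simps flip: infsum_cnj q_cnj)
next
  fix f assume f: "f \<in> carrier form_space"
  hence ip: "ip form_space f f = of_real (\<Sum>\<^sub>\<infinity>s. sq f s)" by (simp add: form_space_simps(1) ip_self_form_space)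
  thus "ip form_space f f \<in> \<real>\<^sub>\<ge>\<^sub>0" by (auto simp: infsum_nonneg sq_nonneg)
  assume "ip form_space f f = 0"
  hence "(\<Sum>\<^sub>\<infinity>s. sq f s) = 0" using ip by simp
  hence "sq f s = 0" for s
    using f by (intro nonneg_infsum_le_0D[of "sq f" UNIV]) (auto simp: sq_nonneg form_space_simps)
  thus "f = \<zero>\<^bsub>form_space\<^esub>" unfolding form_space_simps by (rule eq_zero_if_sq_zero)
qed

lemma composition_bounded:
  assumes \<rho>: "bij \<rho>" and le: "\<And>s f. sq (\<lambda>i. f (\<pi> i)) s \<le> C * sq f (\<rho> s)"
  shows "bounded_op form_space form_space (\<lambda>f i. f (\<pi> i))"
proof -
  have sum: "(\<lambda>s. C * sq f (\<rho> s)) summable_on UNIV" if "f \<in> carrier form_space" for f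
    using that summable_on_reindex_bij_betw[OF \<rho>, of "sq f"]
    by (intro summable_on_cmult_right) (simp add: form_space_simps)
  hence cl: "(\<lambda>i. f (\<pi> i)) \<in> carrier form_space" if "f \<in> carrier form_space" for f
    using that le unfolding form_space_simps by (blast intro: sq_summable_comparison)
  have "hnorm form_space (\<lambda>i. f (\<pi> i)) \<le> sqrt C * hnorm form_space f" if f: "f \<in> carrier form_space" for f
  proof -
    have "(\<Sum>\<^sub>\<infinity>s. sq (\<lambda>i. f (\<pi> i)) s) \<le> (\<Sum>\<^sub>\<infinity>s. C * sq f (\<rho> s))"
      using cl[OF f] sum[OF f] le by (intro infsum_mono) (auto simp: form_space_simps)
    also have "\<dots> = C * (\<Sum>\<^sub>\<infinity>s. sq f s)"
      using infsum_reindex_bij_betw[OF \<rho>, of "sq f"] by (simp add: infsum_cmult_right')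
    finally have "sqrt (\<Sum>\<^sub>\<infinity>s. sq (\<lambda>i. f (\<pi> i)) s) \<le> sqrt (C * (\<Sum>\<^sub>\<infinity>s. sq f s))" by simp
    thus ?thesis
      using f cl[OF f] by (simp add: hnorm_def ip_self_form_space form_space_simps(1) real_sqrt_mult)
  qed
  thus ?thesis unfolding bounded_op_def using cl
    by (intro conjI) (auto simp: form_space_simps(3,4) intro!: exI[of _ "sqrt C"])
qed

end

section \<open>A positive pencil of Choi type without a factorization\<close>

text \<open>The sesquilinear form of \<open>R(\<alpha>, \<beta>) = 5/2 diag(1 + \<beta>\<^sup>2, 1 + \<alpha>\<^sup>2, \<alpha>\<^sup>2 + \<beta>\<^sup>2) - x x\<^sup>T\<close> for \<open>x = (1, \<alpha>, \<beta>)\<close>.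
A vector of \<open>\<complex>\<^sup>3\<close> is given by the values of a function at \<open>0, 1, 2\<close>. Any factor strictly between
\<open>2\<close> and \<open>3\<close> would do in place of \<open>5/2\<close>: above \<open>2\<close> the matrix dominates a positive multiple of
\<open>diag(1 + \<beta>\<^sup>2, 1 + \<alpha>\<^sup>2, \<alpha>\<^sup>2 + \<beta>\<^sup>2)\<close>, below \<open>3\<close> it has no factorization.\<close>

definition choi_form :: "real \<Rightarrow> real \<Rightarrow> (nat \<Rightarrow> complex) \<Rightarrow> (nat \<Rightarrow> complex) \<Rightarrow> complex" where
  "choi_form \<alpha> \<beta> u v =
     of_real (5 / 2 * (1 + \<beta>\<^sup>2)) * (u 0 * cnj (v 0)) + of_real (5 / 2 * (1 + \<alpha>\<^sup>2)) * (u 1 * cnj (v 1))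
     + of_real (5 / 2 * (\<alpha>\<^sup>2 + \<beta>\<^sup>2)) * (u 2 * cnj (v 2))
     - (u 0 + of_real \<alpha> * u 1 + of_real \<beta> * u 2) * cnj (v 0 + of_real \<alpha> * v 1 + of_real \<beta> * v 2)"

text \<open>The Taylor coefficients of the form at the point \<open>(k, l)\<close>.\<close>

definition choi_coeff :: "real \<Rightarrow> real \<Rightarrow> (nat \<Rightarrow> complex) \<Rightarrow> (nat \<Rightarrow> complex) \<Rightarrow> nat \<Rightarrow> nat \<Rightarrow> complex" where
  "choi_coeff k l u v i j =
    (let A = 3 / 2 * (u 1 * cnj (v 1)) + 5 / 2 * (u 2 * cnj (v 2));
         B = 5 / 2 * (u 0 * cnj (v 0)) + 3 / 2 * (u 2 * cnj (v 2));
         C = - (u 1 * cnj (v 2) + u 2 * cnj (v 1));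
         A' = - (u 0 * cnj (v 1) + u 1 * cnj (v 0));
         B' = - (u 0 * cnj (v 2) + u 2 * cnj (v 0))
     in if (i, j) = (0, 0) then choi_form k l u v
        else if (i, j) = (1, 0) then 2 * of_real k * A + of_real l * C + A'
        else if (i, j) = (0, 1) then 2 * of_real l * B + of_real k * C + B'
        else if (i, j) = (2, 0) then A
        else if (i, j) = (0, 2) then B
        else C)"

lemma choi_form_sesquilinear:
  "choi_form \<alpha> \<beta> (\<lambda>i. u i + u' i) v = choi_form \<alpha> \<beta> u v + choi_form \<alpha> \<beta> u' v"
  "choi_form \<alpha> \<beta> (\<lambda>i. a * u i) v = a * choi_form \<alpha> \<beta> u v"
  "choi_form \<alpha> \<beta> u v = cnj (choi_form \<alpha> \<beta> v u)"
  by (simp_all add: choi_form_def) (simp_all add: field_simps)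

lemma choi_form_shift: "choi_form (k + \<alpha>) (l + \<beta>) u v = biquad (choi_coeff k l u v) \<alpha> \<beta>"
  by (simp add: biquad_def choi_coeff_def choi_form_def Let_def power2_eq_square)
    (simp add: field_simps)

lemma weighted_cauchy_schwarz:
  fixes a b c x0 x1 x2 y0 y1 y2 :: real
  assumes "a > 0" "b > 0" "c > 0"
  shows "(x0 * y0 + x1 * y1 + x2 * y2)\<^sup>2
    \<le> (x0\<^sup>2 / a + x1\<^sup>2 / b + x2\<^sup>2 / c) * (a * y0\<^sup>2 + b * y1\<^sup>2 + c * y2\<^sup>2)"
proof -
  \<comment> \<open>Lagrange's identity.\<close>
  have "(x0\<^sup>2 / a + x1\<^sup>2 / b + x2\<^sup>2 / c) * (a * y0\<^sup>2 + b * y1\<^sup>2 + c * y2\<^sup>2)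
      - (x0 * y0 + x1 * y1 + x2 * y2)\<^sup>2
      = (b * x0 * y1 - a * x1 * y0)\<^sup>2 / (a * b) + (c * x0 * y2 - a * x2 * y0)\<^sup>2 / (a * c)
      + (c * x1 * y2 - b * x2 * y1)\<^sup>2 / (b * c)"
    using assms by (simp add: field_simps power2_eq_square)
  also have "\<dots> \<ge> 0" using assms by simp
  finally show ?thesis by simp
qed

definition choi_diag :: "real \<Rightarrow> real \<Rightarrow> (nat \<Rightarrow> complex) \<Rightarrow> real" where
  "choi_diag \<alpha> \<beta> u = (1 + \<beta>\<^sup>2) * (cmod (u 0))\<^sup>2 + (1 + \<alpha>\<^sup>2) * (cmod (u 1))\<^sup>2
     + (\<alpha>\<^sup>2 + \<beta>\<^sup>2) * (cmod (u 2))\<^sup>2"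

text \<open>The Cauchy-Schwarz inequality with the diagonal entries as weights reduces this to the scalar inequality
\<open>1 / (1 + \<beta>\<^sup>2) + \<alpha>\<^sup>2 / (1 + \<alpha>\<^sup>2) + \<beta>\<^sup>2 / (\<alpha>\<^sup>2 + \<beta>\<^sup>2) \<le> 2\<close>. The
difference of the two sides is not a sum of squares of forms linear in the \<open>u i\<close> and in \<open>(1, \<alpha>, \<beta>)\<close>, for the
reason given at \<open>choi_not_factorizable\<close>, so a weighted argument is needed.\<close>

lemma choi_inequality: "(cmod (u 0 + of_real \<alpha> * u 1 + of_real \<beta> * u 2))\<^sup>2 \<le> 2 * choi_diag \<alpha> \<beta> u"
proof (cases "\<alpha> = 0 \<and> \<beta> = 0")
  \<comment> \<open>At the origin the third weight vanishes, and with it the third summand on the left.\<close>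
  case True
  thus ?thesis by (simp add: choi_diag_def)
next
  case False
  define A B where "A = \<alpha>\<^sup>2" and "B = \<beta>\<^sup>2"
  have nn: "A \<ge> 0" "B \<ge> 0" and AB: "A + B > 0"
    using False by (auto simp: A_def B_def sum_power2_gt_zero_iff)
  have "2 - (1 / (1 + B) + A / (1 + A) + B / (A + B))
      = (A * B + B\<^sup>2 + A\<^sup>2 * B + A) / ((1 + A) * (1 + B) * (A + B))"
    using nn AB by (simp add: divide_simps add_nonneg_eq_0_iff) (simp add: algebra_simps power2_eq_square)
  also have "\<dots> \<ge> 0" using nn by simp
  finally have sum: "1 / (1 + B) + A / (1 + A) + B / (A + B) \<le> 2" by simp
  have "cmod (u 0 + of_real \<alpha> * u 1 + of_real \<beta> * u 2)
      \<le> 1 * cmod (u 0) + \<bar>\<alpha>\<bar> * cmod (u 1) + \<bar>\<beta>\<bar> * cmod (u 2)"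
    using norm_triangle_ineq[of "u 0 + of_real \<alpha> * u 1" "of_real \<beta> * u 2"]
      norm_triangle_ineq[of "u 0" "of_real \<alpha> * u 1"] by (simp add: norm_mult)
  hence "(cmod (u 0 + of_real \<alpha> * u 1 + of_real \<beta> * u 2))\<^sup>2
      \<le> (1 * cmod (u 0) + \<bar>\<alpha>\<bar> * cmod (u 1) + \<bar>\<beta>\<bar> * cmod (u 2))\<^sup>2"
    by (intro power_mono) auto
  also have "\<dots> \<le> (1\<^sup>2 / (1 + B) + \<bar>\<alpha>\<bar>\<^sup>2 / (1 + A) + \<bar>\<beta>\<bar>\<^sup>2 / (A + B)) *
      ((1 + B) * (cmod (u 0))\<^sup>2 + (1 + A) * (cmod (u 1))\<^sup>2 + (A + B) * (cmod (u 2))\<^sup>2)"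
    using nn AB by (intro weighted_cauchy_schwarz) auto
  also have "\<dots> = (1 / (1 + B) + A / (1 + A) + B / (A + B)) * choi_diag \<alpha> \<beta> u"
    by (simp add: choi_diag_def A_def B_def)
  also have "\<dots> \<le> 2 * choi_diag \<alpha> \<beta> u"
    using sum by (intro mult_right_mono) (auto simp: choi_diag_def)
  finally show ?thesis .
qed

lemma choi_form_self:
  "choi_form \<alpha> \<beta> u u =
     of_real (5 / 2 * choi_diag \<alpha> \<beta> u - (cmod (u 0 + of_real \<alpha> * u 1 + of_real \<beta> * u 2))\<^sup>2)"
  unfolding choi_form_def choi_diag_def
  by (simp only: complex_norm_square of_real_diff of_real_mult of_real_add of_real_divide
      of_real_numeral of_real_1) (simp add: field_simps)

text \<open>Read \<open>v i j\<close> as \<open>V\<^sub>i e\<^sub>j\<close>. Only nine vectors of \<open>K\<close> enter, so the obstruction already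
lives in the Gram matrix of a factorization.\<close>

lemma choi_not_factorizable:
  fixes K :: "'k hspace" and v :: "nat \<Rightarrow> nat \<Rightarrow> 'k"
  assumes K: "hilbert_space K" and v: "\<And>i j. v i j \<in> carrier K"
    and eq: "\<And>\<alpha> \<beta> j l. j < 3 \<Longrightarrow> l < 3 \<Longrightarrow>
      ip K (v 0 j \<oplus>\<^bsub>K\<^esub> of_real \<alpha> \<odot>\<^bsub>K\<^esub> v 1 j \<oplus>\<^bsub>K\<^esub> of_real \<beta> \<odot>\<^bsub>K\<^esub> v 2 j)
           (v 0 l \<oplus>\<^bsub>K\<^esub> of_real \<alpha> \<odot>\<^bsub>K\<^esub> v 1 l \<oplus>\<^bsub>K\<^esub> of_real \<beta> \<odot>\<^bsub>K\<^esub> v 2 l)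
      = choi_form \<alpha> \<beta> (\<lambda>i. of_bool (i = j)) (\<lambda>i. of_bool (i = l))"
  shows False
proof -
  interpret K: hilbert_space K by fact
  define G where "G a b i j = ip K (v a i) (v b j)" for a b i j :: nat
  define p where "p i j a b =
      (if (a, b) = (0, 0) then G 0 0 i j else if (a, b) = (1, 0) then G 0 1 i j + G 1 0 i j
       else if (a, b) = (0, 1) then G 0 2 i j + G 2 0 i j else if (a, b) = (2, 0) then G 1 1 i j
       else if (a, b) = (0, 2) then G 2 2 i j else G 1 2 i j + G 2 1 i j)" for i j a b :: nat
  have p: "p i j a b = choi_coeff 0 0 (\<lambda>n. of_bool (n = i)) (\<lambda>n. of_bool (n = j)) a b"
    if "i < 3" "j < 3" "a + b \<le> 2" for i j a b
  proof (rule biquad_unique[OF _ that(3)])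
    fix n m
    show "biquad (p i j) (real n) (real m)
        = biquad (choi_coeff 0 0 (\<lambda>n. of_bool (n = i)) (\<lambda>n. of_bool (n = j))) (real n) (real m)"
      unfolding choi_form_shift[symmetric]
      using eq[OF that(1,2), of "real n" "real m"] v
      by (simp add: biquad_def p_def G_def K.ip_simps power2_eq_square algebra_simps)
  qed
  have zero: "v a j = \<zero>\<^bsub>K\<^esub>" if "G a a j j = 0" for a j
    using that K.ip_definite[OF v] by (simp add: G_def)
  \<comment> \<open>The three square monomials that are missing from the diagonal entries of the form.\<close>
  have "v 1 0 = \<zero>\<^bsub>K\<^esub>" "v 2 1 = \<zero>\<^bsub>K\<^esub>" "v 0 2 = \<zero>\<^bsub>K\<^esub>"
    using p[of 0 0 2 0] p[of 1 1 0 2] p[of 2 2 0 0]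
    by (auto intro!: zero simp: p_def choi_coeff_def choi_form_def)
  \<comment> \<open>With these vectors gone, each off-diagonal monomial comes from a single pair.\<close>
  hence off: "G 0 1 0 1 = - 1" "G 1 2 1 2 = - 1" "G 0 2 0 2 = - 1"
    using p[of 0 1 1 0] p[of 1 2 1 1] p[of 0 2 0 1] v
    by (auto simp: p_def choi_coeff_def G_def)
  have diag: "G 0 0 0 0 = 3 / 2" "G 1 1 1 1 = 3 / 2" "G 2 2 2 2 = 3 / 2"
    using p[of 0 0 0 0] p[of 1 1 2 0] p[of 2 2 0 2] by (simp_all add: p_def choi_coeff_def choi_form_def)
  have sym: "G 1 0 1 0 = - 1" "G 2 1 2 1 = - 1" "G 2 0 2 0 = - 1"
    using off K.ip_cnj[OF v v] unfolding G_def by (metis complex_cnj_minus complex_cnj_one)+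
  let ?w = "v 0 0 \<oplus>\<^bsub>K\<^esub> v 1 1 \<oplus>\<^bsub>K\<^esub> v 2 2"
  have "ip K ?w ?w = (G 0 0 0 0 + G 1 1 1 1 + G 2 2 2 2) + (G 0 1 0 1 + G 1 2 1 2 + G 0 2 0 2)
      + (G 1 0 1 0 + G 2 1 2 1 + G 2 0 2 0)"
    using v by (simp add: K.ip_simps G_def)
  also have "\<dots> = - 3 / 2" by (simp only: off diag sym) simp
  finally have "ip K ?w ?w = - 3 / 2" .
  thus False using K.ip_self_nonneg[of ?w] v by simp
qed


section \<open>Summing families of quadratic polynomials\<close>

lemma has_sum_biquad:
  assumes "\<And>i j. i + j \<le> 2 \<Longrightarrow> ((\<lambda>s. p s i j) has_sum P i j) A"
  shows "((\<lambda>s. biquad (p s) \<alpha> \<beta>) has_sum biquad P \<alpha> \<beta>) A"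
  unfolding biquad_def by (intro has_sum_add has_sum_cmult_right assms) auto

text \<open>Only the values at lattice points are known to be summable, since these are inner products of vectors in the
space; interpolation passes to the coefficients, hence to all real arguments.\<close>

lemma biquad_coeff_summable:
  assumes sum: "\<And>n m. (\<lambda>s. biquad (p s) (real n) (real m)) summable_on A" and ij: "i + j \<le> 2"
  shows "(\<lambda>s. p s i j) summable_on A"
proof -
  obtain w :: "nat \<Rightarrow> nat \<Rightarrow> nat \<Rightarrow> nat \<Rightarrow> complex" where
    w: "\<And>p i j. i + j \<le> 2 \<Longrightarrow>
      p i j = (\<Sum>(n, m)\<in>{(n, m). n + m \<le> 2}. w i j n m * biquad p (real n) (real m))"
    by (rule biquad_interpolation) blast
  have "(\<lambda>s. \<Sum>(n, m)\<in>I. w i j n m * biquad (p s) (real n) (real m)) summable_on A" if "finite I" for I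
    using that
    by (induction I rule: finite_induct)
      (auto simp: case_prod_beta intro!: summable_on_add summable_on_cmult_right sum)
  from this[of "{(n, m). n + m \<le> 2}"] show ?thesis
    by (subst w[OF ij]) (simp add: coeff_index_set)
qed

section \<open>Shifts on the weighted lattice\<close>

text \<open>Functions from \<open>\<int>\<^sup>2\<close> to \<open>\<complex>\<^sup>3\<close> are coded as functions on \<open>nat\<close>: \<open>idx k l j\<close> is the position of
the coordinate \<open>j < 3\<close> at the site \<open>(k, l)\<close>.\<close>

definition idx :: "int \<Rightarrow> int \<Rightarrow> nat \<Rightarrow> nat" where
  "idx k l j = 3 * prod_encode (int_encode k, int_encode l) + j"

definition site :: "nat \<Rightarrow> int \<times> int" where
  "site n = map_prod int_decode int_decode (prod_decode (n div 3))"

lemma site_idx [simp]: "j < 3 \<Longrightarrow> site (idx k l j) = (k, l)"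
  and idx_mod [simp]: "j < 3 \<Longrightarrow> idx k l j mod 3 = j"
  by (simp_all add: site_def idx_def)

lemma idx_site: "idx (fst (site n)) (snd (site n)) (n mod 3) = n"
proof -
  obtain a b where ab: "prod_decode (n div 3) = (a, b)" by force
  hence "prod_encode (a, b) = n div 3" by (metis prod_decode_inverse)
  thus ?thesis by (simp add: site_def idx_def ab)
qed

lemma idx_eq_iff: "i < 3 \<Longrightarrow> j < 3 \<Longrightarrow> idx k l i = idx k' l' j \<longleftrightarrow> k = k' \<and> l = l' \<and> i = j"
  by (metis site_idx idx_mod prod.inject)

definition fiber :: "int \<Rightarrow> int \<Rightarrow> (nat \<Rightarrow> complex) \<Rightarrow> nat \<Rightarrow> complex" where
  "fiber k l f j = f (idx k l j)"

text \<open>Translation by \<open>(a, b)\<close> pulls back along \<open>move a b\<close>, hence the minus signs.\<close>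

definition move :: "int \<Rightarrow> int \<Rightarrow> nat \<Rightarrow> nat" where
  "move a b n = idx (fst (site n) - a) (snd (site n) - b) (n mod 3)"

definition translate :: "int \<Rightarrow> int \<Rightarrow> (nat \<Rightarrow> complex) \<Rightarrow> nat \<Rightarrow> complex" where
  "translate a b f = (\<lambda>n. f (move a b n))"

lemma fiber_translate: "j < 3 \<Longrightarrow> fiber k l (translate a b f) j = fiber (k - a) (l - b) f j"
  by (simp add: fiber_def translate_def move_def)

lemma translate_translate: "translate a b (translate a' b' f) = translate (a + a') (b + b') f"
  by (simp add: translate_def move_def algebra_simps)

lemma translate_0: "translate 0 0 f = f"
  by (simp add: translate_def move_def idx_site)

lemma translate_funpow: "translate a b ^^ n = translate (int n * a) (int n * b)"
  by (induction n) (auto simp: fun_eq_iff[of _ "translate _ _"] translate_0 translate_translate algebra_simps)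

locale weighted_lattice =
  fixes c d :: real
  assumes c: "c > 0" and d: "d > 0"
begin

text \<open>The correction \<open>R\<^sub>2\<^sub>0 / c\<^sup>2 + R\<^sub>0\<^sub>2 / d\<^sup>2\<close>. The leading coefficients do not depend on the point of
expansion, so it is the same at every site. It is positive definite, which makes the weight
\<open>R + excess\<close> definite even at the origin, where \<open>R\<close> is singular.\<close>

definition excess :: "(nat \<Rightarrow> complex) \<Rightarrow> (nat \<Rightarrow> complex) \<Rightarrow> complex" where
  "excess u v = choi_coeff 0 0 u v 2 0 / c\<^sup>2 + choi_coeff 0 0 u v 0 2 / d\<^sup>2"

lemma excess_eq:
  "excess u v = of_real (5 / (2 * d\<^sup>2)) * (u 0 * cnj (v 0)) + of_real (3 / (2 * c\<^sup>2)) * (u 1 * cnj (v 1))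
     + of_real (5 / (2 * c\<^sup>2) + 3 / (2 * d\<^sup>2)) * (u 2 * cnj (v 2))"
  using c d by (simp add: excess_def choi_coeff_def field_simps)

lemma excess_sesquilinear:
  "excess (\<lambda>i. u i + u' i) v = excess u v + excess u' v"
  "excess (\<lambda>i. a * u i) v = a * excess u v"
  "excess u v = cnj (excess v u)"
  unfolding excess_eq by (simp_all only: ring_distribs mult_ac add_ac complex_cnj_add complex_cnj_mult
      complex_cnj_cnj complex_cnj_complex_of_real) 

definition excess_sq :: "(nat \<Rightarrow> complex) \<Rightarrow> real" where
  "excess_sq u = 5 / (2 * d\<^sup>2) * (cmod (u 0))\<^sup>2 + 3 / (2 * c\<^sup>2) * (cmod (u 1))\<^sup>2
     + (5 / (2 * c\<^sup>2) + 3 / (2 * d\<^sup>2)) * (cmod (u 2))\<^sup>2"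

lemma excess_self: "excess u u = of_real (excess_sq u)"
  unfolding excess_def excess_sq_def choi_coeff_def Let_def
  by (simp only: complex_norm_square of_real_mult of_real_add of_real_divide
      of_real_numeral of_real_1) (use c d in \<open>simp add: field_simps\<close>)

definition weight :: "real \<Rightarrow> real \<Rightarrow> (nat \<Rightarrow> complex) \<Rightarrow> (nat \<Rightarrow> complex) \<Rightarrow> complex" where
  "weight \<alpha> \<beta> u v = choi_form \<alpha> \<beta> u v + excess u v"

definition weight_coeff :: "real \<Rightarrow> real \<Rightarrow> (nat \<Rightarrow> complex) \<Rightarrow> (nat \<Rightarrow> complex) \<Rightarrow> nat \<Rightarrow> nat \<Rightarrow> complex" where
  "weight_coeff k l u v i j = choi_coeff k l u v i j + (if (i, j) = (0, 0) then excess u v else 0)"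

lemma weight_shift: "weight (k + \<alpha>) (l + \<beta>) u v = biquad (weight_coeff k l u v) \<alpha> \<beta>"
  by (simp add: weight_def choi_form_shift) (simp add: biquad_def weight_coeff_def)

text \<open>The reason for the choice of the weight: adding a constant leaves the leading coefficients unchanged,
so the correction in the definition of the pencil removes exactly the excess.\<close>

lemma biquad_weight_coeff_minus_excess:
  "biquad (weight_coeff k l u v) \<alpha> \<beta> - weight_coeff k l u v 2 0 / c\<^sup>2 - weight_coeff k l u v 0 2 / d\<^sup>2
    = choi_form (k + \<alpha>) (l + \<beta>) u v"
  by (simp add: weight_shift[symmetric] weight_def) (simp add: excess_def weight_coeff_def choi_coeff_def)

lemma Re_weight:
  "Re (weight \<alpha> \<beta> u u) = 5 / 2 * choi_diag \<alpha> \<beta> u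
     - (cmod (u 0 + of_real \<alpha> * u 1 + of_real \<beta> * u 2))\<^sup>2 + excess_sq u"
  by (simp add: weight_def choi_form_self excess_self)

lemma Re_weight_ge: "Re (weight \<alpha> \<beta> u u) \<ge> choi_diag \<alpha> \<beta> u / 2 + excess_sq u"
  using choi_inequality[of u \<alpha> \<beta>] by (simp add: Re_weight)

lemma choi_diag_nonneg: "choi_diag \<alpha> \<beta> u \<ge> 0"
  by (simp add: choi_diag_def)

text \<open>Up to constants the weight is \<open>choi_diag + excess_sq\<close>, and both parts are diagonal. A unit step
changes \<open>1 + \<alpha>\<^sup>2\<close> and \<open>1 + \<beta>\<^sup>2\<close> by a bounded factor; the entry \<open>\<alpha>\<^sup>2 + \<beta>\<^sup>2\<close> may vanish, and there
the excess absorbs the increment, which is why \<open>c\<close> enters the constant.\<close>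

lemma weight_neighbour:
  assumes "\<bar>\<alpha>' - \<alpha>\<bar> \<le> 1" "\<bar>\<beta>' - \<beta>\<bar> \<le> 1"
  shows "Re (weight \<alpha>' \<beta>' u u) \<le> (15 + 4 * c\<^sup>2) * Re (weight \<alpha> \<beta> u u)"
proof -
  have sq: "y\<^sup>2 \<le> 2 * x\<^sup>2 + 2" if "\<bar>y - x\<bar> \<le> 1" for x y :: real
  proof -
    have "(y - x)\<^sup>2 \<le> 1" using that by (simp add: abs_square_le_1)
    moreover have "0 \<le> (y - 2 * x)\<^sup>2" by simp
    ultimately show ?thesis by (simp add: power2_eq_square algebra_simps)
  qed
  have "\<beta>'\<^sup>2 \<le> 2 + 3 * \<beta>\<^sup>2" "\<alpha>'\<^sup>2 \<le> 2 + 3 * \<alpha>\<^sup>2"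
    using sq[OF assms(1)] sq[OF assms(2)] zero_le_power2[of \<alpha>] zero_le_power2[of \<beta>] by - linarith+
  hence h: "1 + \<beta>'\<^sup>2 \<le> 3 + 3 * \<beta>\<^sup>2" "1 + \<alpha>'\<^sup>2 \<le> 3 + 3 * \<alpha>\<^sup>2"
    "\<alpha>'\<^sup>2 + \<beta>'\<^sup>2 \<le> 3 * \<alpha>\<^sup>2 + 3 * \<beta>\<^sup>2 + 4" by simp_all
  have "choi_diag \<alpha>' \<beta>' u \<le> (3 + 3 * \<beta>\<^sup>2) * (cmod (u 0))\<^sup>2 + (3 + 3 * \<alpha>\<^sup>2) * (cmod (u 1))\<^sup>2
      + (3 * \<alpha>\<^sup>2 + 3 * \<beta>\<^sup>2 + 4) * (cmod (u 2))\<^sup>2"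
    unfolding choi_diag_def by (intro add_mono h[THEN mult_right_mono] zero_le_power2)
  hence 1: "choi_diag \<alpha>' \<beta>' u \<le> 3 * choi_diag \<alpha> \<beta> u + 4 * (cmod (u 2))\<^sup>2"
    by (simp add: choi_diag_def algebra_simps)
  \<comment> \<open>The excess pays for the additive increment of the third diagonal entry.\<close>
  have "5 / (2 * c\<^sup>2) * (cmod (u 2))\<^sup>2 \<le> excess_sq u"
    by (simp add: excess_sq_def algebra_simps)
  hence 2: "5 * (cmod (u 2))\<^sup>2 \<le> 2 * c\<^sup>2 * excess_sq u"
    using c by (simp add: field_simps)
  have 3: "excess_sq u \<ge> 0" by (simp add: excess_sq_def)
  have "Re (weight \<alpha>' \<beta>' u u) \<le> 5 / 2 * choi_diag \<alpha>' \<beta>' u + excess_sq u"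
    by (simp add: Re_weight)
  also have "\<dots> \<le> 15 / 2 * choi_diag \<alpha> \<beta> u + (4 * c\<^sup>2 + 1) * excess_sq u"
    using 1 2 by (simp add: algebra_simps)
  also have "\<dots> \<le> (15 + 4 * c\<^sup>2) * (choi_diag \<alpha> \<beta> u / 2 + excess_sq u)"
    using 3 choi_diag_nonneg[of \<alpha> \<beta> u] by (simp add: algebra_simps)
  also have "\<dots> \<le> (15 + 4 * c\<^sup>2) * Re (weight \<alpha> \<beta> u u)"
    using Re_weight_ge by (intro mult_left_mono) auto
  finally show ?thesis .
qed

definition site_form :: "int \<times> int \<Rightarrow> (nat \<Rightarrow> complex) \<Rightarrow> (nat \<Rightarrow> complex) \<Rightarrow> complex" where
  "site_form s f g = (case s of (k, l) \<Rightarrow> weight (real_of_int k) (real_of_int l) (fiber k l f) (fiber k l g))"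

lemmas weight_defs = weight_def excess_def choi_form_def choi_coeff_def Let_def

sublocale form_family site_form
proof
  fix s :: "int \<times> int" and f g h :: "nat \<Rightarrow> complex" and a :: complex
  obtain k l where s: "s = (k, l)" by force
  have fiber_lin: "fiber k l (\<lambda>i. f i + g i) = (\<lambda>i. fiber k l f i + fiber k l g i)"
    "fiber k l (\<lambda>i. a * f i) = (\<lambda>i. a * fiber k l f i)" for k l
    by (simp_all add: fiber_def[abs_def])
  show "site_form s (\<lambda>i. f i + g i) h = site_form s f h + site_form s g h"
    by (simp add: s site_form_def weight_def fiber_lin choi_form_sesquilinear(1) excess_sesquilinear(1))
  show "site_form s (\<lambda>i. a * f i) h = a * site_form s f h"
    by (simp add: s site_form_def weight_def fiber_lin choi_form_sesquilinear(2) excess_sesquilinear(2)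
        distrib_left)
  show "site_form s f g = cnj (site_form s g f)"
    unfolding s site_form_def weight_def prod.case complex_cnj_add
    by (subst choi_form_sesquilinear(3), subst excess_sesquilinear(3)) (rule refl)
  show "0 \<le> Re (site_form s f f)"
    using Re_weight_ge[of "real_of_int k" "real_of_int l" "fiber k l f"]
      choi_diag_nonneg[of "real_of_int k" "real_of_int l" "fiber k l f"]
    by (simp add: s site_form_def excess_sq_def) (smt (verit) divide_nonneg_nonneg mult_nonneg_nonneg zero_le_power2)
next
  fix s :: "int \<times> int" and F :: "nat \<Rightarrow> nat \<Rightarrow> complex" and f
  assume lim: "\<And>i. (\<lambda>n. F n i) \<longlonglongrightarrow> f i"
  obtain k l where s: "s = (k, l)" by force
  show "(\<lambda>n. site_form s (F n) (F n)) \<longlonglongrightarrow> site_form s f f"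
    unfolding s site_form_def prod.case weight_defs fiber_def
    by (simp, intro tendsto_intros lim) (use c d in auto)
next
  fix i
  obtain k l j where i: "i = idx k l j" "j < 3"
    using idx_site[of i] mod_less_divisor[of 3 i] by (metis zero_less_numeral)
  define \<delta> where "\<delta> = min (1 / c\<^sup>2) (1 / d\<^sup>2)"
  have \<delta>_le: "\<delta> \<le> 1 / d\<^sup>2" "\<delta> \<le> 1 / c\<^sup>2" by (simp_all add: \<delta>_def)
  have le: "1 / d\<^sup>2 \<le> 5 / (2 * d\<^sup>2)" "1 / c\<^sup>2 \<le> 3 / (2 * c\<^sup>2)"
    "1 / d\<^sup>2 \<le> 5 / (2 * c\<^sup>2) + 3 / (2 * d\<^sup>2)"
    using c d by (simp_all add: field_simps add_increasing)
  have "\<delta> > 0" using c d by (simp add: \<delta>_def)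
  moreover have "\<delta> * (cmod (f i))\<^sup>2 \<le> Re (site_form (k, l) f f)" for f
  proof -
    let ?u = "fiber k l f"
    have "j = 0 \<or> j = 1 \<or> j = 2" using i by auto
    moreover have "\<delta> * (cmod (?u 0))\<^sup>2 \<le> 5 / (2 * d\<^sup>2) * (cmod (?u 0))\<^sup>2"
      "\<delta> * (cmod (?u 1))\<^sup>2 \<le> 3 / (2 * c\<^sup>2) * (cmod (?u 1))\<^sup>2"
      "\<delta> * (cmod (?u 2))\<^sup>2 \<le> (5 / (2 * c\<^sup>2) + 3 / (2 * d\<^sup>2)) * (cmod (?u 2))\<^sup>2"
      by (intro mult_right_mono order_trans[OF \<delta>_le(1) le(1)] order_trans[OF \<delta>_le(2) le(2)]
          order_trans[OF \<delta>_le(1) le(3)]; simp)+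
    moreover have "\<delta> * (cmod (?u 0))\<^sup>2 \<ge> 0" "\<delta> * (cmod (?u 1))\<^sup>2 \<ge> 0" "\<delta> * (cmod (?u 2))\<^sup>2 \<ge> 0"
      using \<open>\<delta> > 0\<close> by auto
    ultimately have "\<delta> * (cmod (?u j))\<^sup>2 \<le> excess_sq ?u"
      unfolding excess_sq_def by auto
    also have "\<dots> \<le> Re (site_form (k, l) f f)"
      using Re_weight_ge[of "real_of_int k" "real_of_int l" ?u]
        choi_diag_nonneg[of "real_of_int k" "real_of_int l" ?u] by (simp add: site_form_def)
    finally show ?thesis by (simp add: i fiber_def)
  qed
  ultimately show "\<exists>s \<delta>. \<delta> > 0 \<and> (\<forall>f. \<delta> * (cmod (f i))\<^sup>2 \<le> Re (site_form s f f))" by blast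
qed

lemma site_form_translate:
  "site_form (k, l) (translate a b f) (translate a b g)
    = weight (real_of_int k) (real_of_int l) (fiber (k - a) (l - b) f) (fiber (k - a) (l - b) g)"
  by (simp add: site_form_def weight_defs fiber_translate)

lemma bij_shift: "bij (\<lambda>(k, l). (k + a, l + b))" for a b :: int
  by (rule bij_betw_byWitness[where f' = "\<lambda>(k, l). (k - a, l - b)"]) auto

lemma translate_bounded:
  assumes "\<bar>a\<bar> \<le> 1" "\<bar>b\<bar> \<le> 1"
  shows "bounded_op form_space form_space (translate a b)"
proof -
  have "sq (\<lambda>i. f (move a b i)) s \<le> (15 + 4 * c\<^sup>2) * sq f (case s of (k, l) \<Rightarrow> (k + - a, l + - b))" for f s
  proof -
    obtain k l where s: "s = (k, l)" by force
    show ?thesis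
      using weight_neighbour[of "real_of_int k" "real_of_int (k - a)" "real_of_int l" "real_of_int (l - b)"
          "fiber (k - a) (l - b) f"] assms
        site_form_translate[of k l a b f f]
      by (simp add: s sq_def site_form_def translate_def)
  qed
  from composition_bounded[OF bij_shift this] show ?thesis
    by (simp add: translate_def[abs_def])
qed

abbreviation "T \<equiv> translate 1 0"
abbreviation "S \<equiv> translate 0 1"

text \<open>Reindexing by the translation moves the shift from the functions to the weight.\<close>

lemma power_form_has_sum:
  assumes f: "f \<in> carrier form_space" and g: "g \<in> carrier form_space"
  shows "((\<lambda>s. weight (real_of_int (fst s) + real n) (real_of_int (snd s) + real m) (fiber (fst s) (snd s) f) (fiber (fst s) (snd s) g))
    has_sum power_form form_space T S f g n m) UNIV"
proof -
  have TS: "(T ^^ n) ((S ^^ m) h) = translate (int n) (int m) h" for h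
    by (simp add: translate_funpow translate_translate)
  have "translate (int n) (int m) h \<in> carrier form_space" if "h \<in> carrier form_space" for h
    unfolding TS[symmetric]
    using that bounded_opD(1)[OF bounded_op_funpow[OF hilbert_space_form_space translate_bounded]] by simp
  hence "(\<lambda>s. site_form s (translate (int n) (int m) f) (translate (int n) (int m) g)) summable_on UNIV"
    using f g by (intro q_summable) (simp_all add: form_space_simps)
  hence "((\<lambda>s. site_form s (translate (int n) (int m) f) (translate (int n) (int m) g))
      has_sum power_form form_space T S f g n m) UNIV"
    by (simp add: power_form_def TS form_space_simps)
  hence "((\<lambda>s. site_form (case s of (k, l) \<Rightarrow> (k + int n, l + int m))
      (translate (int n) (int m) f) (translate (int n) (int m) g))
      has_sum power_form form_space T S f g n m) UNIV"
    by (subst has_sum_reindex_bij_betw[OF bij_shift])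
  thus ?thesis by (simp add: site_form_translate case_prod_beta)
qed

definition power_coeff :: "(nat \<Rightarrow> complex) \<Rightarrow> (nat \<Rightarrow> complex) \<Rightarrow> nat \<Rightarrow> nat \<Rightarrow> complex" where
  "power_coeff f g i j =
     (\<Sum>\<^sub>\<infinity>s. weight_coeff (real_of_int (fst s)) (real_of_int (snd s)) (fiber (fst s) (snd s) f) (fiber (fst s) (snd s) g) i j)"

lemma power_coeff_has_sum:
  assumes f: "f \<in> carrier form_space" and g: "g \<in> carrier form_space" and ij: "i + j \<le> 2"
  shows "((\<lambda>s. weight_coeff (real_of_int (fst s)) (real_of_int (snd s)) (fiber (fst s) (snd s) f) (fiber (fst s) (snd s) g) i j)
    has_sum power_coeff f g i j) UNIV"
proof -
  have "(\<lambda>s. biquad (weight_coeff (real_of_int (fst s)) (real_of_int (snd s)) (fiber (fst s) (snd s) f) (fiber (fst s) (snd s) g))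
      (real n) (real m)) summable_on UNIV" for n m
    using has_sum_imp_summable[OF power_form_has_sum[OF f g, of n m]]
    by (simp add: weight_shift)
  from biquad_coeff_summable[OF this ij]
  show ?thesis by (simp add: power_coeff_def)
qed

lemma biquad_power_coeff_has_sum:
  assumes "f \<in> carrier form_space" "g \<in> carrier form_space"
  shows "((\<lambda>s. biquad (weight_coeff (real_of_int (fst s)) (real_of_int (snd s)) (fiber (fst s) (snd s) f) (fiber (fst s) (snd s) g)) \<alpha> \<beta>)
    has_sum biquad (power_coeff f g) \<alpha> \<beta>) UNIV"
  using has_sum_biquad[OF power_coeff_has_sum[OF assms], where \<alpha> = \<alpha> and \<beta> = \<beta>]
  by simp

lemma power_form_biquad:
  assumes "f \<in> carrier form_space" "g \<in> carrier form_space"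
  shows "power_form form_space T S f g n m = biquad (power_coeff f g) (real n) (real m)"
  using has_sum_unique[OF power_form_has_sum[OF assms, of n m]] biquad_power_coeff_has_sum[OF assms]
  by (simp add: weight_shift)

lemma three_isometric_TS: "three_isometric form_space T S"
proof (rule three_isometricI[OF hilbert_space_form_space])
  show "op_commute form_space T S" by (simp add: op_commute_def translate_translate)
qed (auto intro: translate_bounded power_form_biquad)

lemma invertible_translate:
  assumes "\<bar>a\<bar> \<le> 1" "\<bar>b\<bar> \<le> 1"
  shows "invertible_op form_space (translate a b)"
  unfolding invertible_op_def using assms
  by (auto intro!: translate_bounded exI[of _ "translate (- a) (- b)"] simp: translate_translate translate_0)

text \<open>Site by site, the corrected pencil is the Choi-type form at the translated point.\<close>

lemma ip_Qhat_has_sum: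
  assumes f: "f \<in> carrier form_space" and g: "g \<in> carrier form_space"
  shows "((\<lambda>s. choi_form (real_of_int (fst s) + \<alpha>) (real_of_int (snd s) + \<beta>) (fiber (fst s) (snd s) f) (fiber (fst s) (snd s) g))
    has_sum ip form_space (Qhat c d form_space T S \<alpha> \<beta> f) g) UNIV"
proof -
  have "((\<lambda>s. (biquad (weight_coeff (real_of_int (fst s)) (real_of_int (snd s)) (fiber (fst s) (snd s) f) (fiber (fst s) (snd s) g)) \<alpha> \<beta>)
      + (- 1 / c\<^sup>2) * (weight_coeff (real_of_int (fst s)) (real_of_int (snd s)) (fiber (fst s) (snd s) f) (fiber (fst s) (snd s) g) 2 0)
      + (- 1 / d\<^sup>2) * (weight_coeff (real_of_int (fst s)) (real_of_int (snd s)) (fiber (fst s) (snd s) f) (fiber (fst s) (snd s) g) 0 2))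
    has_sum biquad (power_coeff f g) \<alpha> \<beta> + (- 1 / c\<^sup>2) * power_coeff f g 2 0 + (- 1 / d\<^sup>2) * power_coeff f g 0 2) UNIV"
    by (intro has_sum_add has_sum_cmult_right biquad_power_coeff_has_sum power_coeff_has_sum f g) auto
  thus ?thesis
    unfolding ip_Qhat[OF hilbert_space_form_space three_isometric_TS f g power_form_biquad[OF f g]]
    by (simp add: case_prod_beta biquad_weight_coeff_minus_excess[symmetric])
qed

lemma class_F_TS: "class_F c d form_space T S"
  unfolding class_F_def pos_op_def
proof (intro conjI allI ballI three_isometric_TS)
  fix \<alpha> \<beta> f assume f: "f \<in> carrier form_space"
  define r where "r = (\<lambda>s. Re (choi_form (real_of_int (fst s) + \<alpha>) (real_of_int (snd s) + \<beta>) (fiber (fst s) (snd s) f) (fiber (fst s) (snd s) f)))"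
  have self: "choi_form a b u u = of_real (Re (choi_form a b u u))" and nn: "Re (choi_form a b u u) \<ge> 0" for a b u
    using choi_inequality[of u a b] choi_diag_nonneg[of a b u] by (simp_all add: choi_form_self)
  have "((\<lambda>s. complex_of_real (r s)) has_sum ip form_space (Qhat c d form_space T S \<alpha> \<beta> f) f) UNIV"
    using ip_Qhat_has_sum[OF f f, of \<alpha> \<beta>] self by (simp add: r_def case_prod_beta)
  moreover from has_sum_Re[OF this] have r: "(r has_sum Re (ip form_space (Qhat c d form_space T S \<alpha> \<beta> f) f)) UNIV"
    by simp
  ultimately have "ip form_space (Qhat c d form_space T S \<alpha> \<beta> f) f
      = of_real (Re (ip form_space (Qhat c d form_space T S \<alpha> \<beta> f) f))"
    using has_sum_unique has_sum_of_real by blast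
  moreover have "Re (ip form_space (Qhat c d form_space T S \<alpha> \<beta> f) f) \<ge> 0"
    using r by (rule has_sum_nonneg) (auto simp: r_def nn)
  ultimately show "ip form_space (Qhat c d form_space T S \<alpha> \<beta> f) f \<in> \<real>\<^sub>\<ge>\<^sub>0"
    by (metis nonneg_Reals_of_real_iff)
qed

text \<open>The standard basis at the site \<open>(0, 0)\<close>, where the corrected pencil restricts to \<open>choi_form \<alpha> \<beta>\<close>.\<close>

definition unit :: "nat \<Rightarrow> nat \<Rightarrow> complex" where
  "unit j n = of_bool (n = idx 0 0 j)"

lemma fiber_unit: "i < 3 \<Longrightarrow> j < 3 \<Longrightarrow> fiber k l (unit j) i = of_bool (k = 0 \<and> l = 0 \<and> i = j)"
  by (simp add: fiber_def unit_def idx_eq_iff)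

lemma unit_carrier:
  assumes "j < 3" shows "unit j \<in> carrier form_space"
proof -
  have "sq (unit j) s = 0" if "s \<noteq> (0, 0)" for s
    using that assms by (cases s) (auto simp: sq_def site_form_def weight_defs fiber_unit)
  hence "sq (unit j) summable_on UNIV \<longleftrightarrow> sq (unit j) summable_on {(0, 0)}"
    by (intro summable_on_cong_neutral) auto
  thus ?thesis by (simp add: form_space_simps)
qed

lemma ip_Qhat_unit:
  assumes "j < 3" "l < 3"
  shows "ip form_space (Qhat c d form_space T S \<alpha> \<beta> (unit j)) (unit l)
    = choi_form \<alpha> \<beta> (\<lambda>i. of_bool (i = j)) (\<lambda>i. of_bool (i = l))"
proof -
  let ?q = "\<lambda>s. choi_form (real_of_int (fst s) + \<alpha>) (real_of_int (snd s) + \<beta>)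
    (fiber (fst s) (snd s) (unit j)) (fiber (fst s) (snd s) (unit l))"
  have 0: "?q s = 0" if "s \<noteq> (0, 0)" for s
    using that assms by (cases s) (auto simp: choi_form_def fiber_unit)
  have "(?q has_sum ip form_space (Qhat c d form_space T S \<alpha> \<beta> (unit j)) (unit l)) UNIV"
    by (intro ip_Qhat_has_sum unit_carrier assms)
  also have "?this \<longleftrightarrow> (?q has_sum ip form_space (Qhat c d form_space T S \<alpha> \<beta> (unit j)) (unit l)) {(0, 0)}"
    by (intro has_sum_cong_neutral) (auto intro: 0)
  finally have "ip form_space (Qhat c d form_space T S \<alpha> \<beta> (unit j)) (unit l) = ?q (0, 0)"
    using has_sum_finite[of "{(0, 0)}" ?q] has_sum_unique by fastforce
  thus ?thesis using assms by (simp add: choi_form_def fiber_unit)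
qed

lemma not_factors_through:
  assumes K: "hilbert_space K"
  shows "\<not> factors_through c d form_space T S K"
proof
  interpret K: hilbert_space K by fact
  assume "factors_through c d form_space T S K"
  then obtain V0 V1 V2 where V: "bounded_op form_space K V0" "bounded_op form_space K V1" "bounded_op form_space K V2"
    and eq: "\<And>\<alpha> \<beta> x. x \<in> carrier form_space \<Longrightarrow> Qhat c d form_space T S \<alpha> \<beta> x =
        adj form_space K (\<lambda>x. V0 x \<oplus>\<^bsub>K\<^esub> complex_of_real \<alpha> \<odot>\<^bsub>K\<^esub> V1 x \<oplus>\<^bsub>K\<^esub> complex_of_real \<beta> \<odot>\<^bsub>K\<^esub> V2 x)
          (V0 x \<oplus>\<^bsub>K\<^esub> complex_of_real \<alpha> \<odot>\<^bsub>K\<^esub> V1 x \<oplus>\<^bsub>K\<^esub> complex_of_real \<beta> \<odot>\<^bsub>K\<^esub> V2 x)"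
    unfolding factors_through_def Let_def by blast
  define W where "W \<alpha> \<beta> x = V0 x \<oplus>\<^bsub>K\<^esub> complex_of_real \<alpha> \<odot>\<^bsub>K\<^esub> V1 x \<oplus>\<^bsub>K\<^esub> complex_of_real \<beta> \<odot>\<^bsub>K\<^esub> V2 x" for \<alpha> \<beta> x
  have W: "bounded_op form_space K (W \<alpha> \<beta>)" for \<alpha> \<beta>
    unfolding W_def using V by (intro bounded_op_add bounded_op_smult K)
  define v where "v i j = (if j < 3 then (if i = 0 then V0 else if i = 1 then V1 else V2) (unit j) else \<zero>\<^bsub>K\<^esub>)"
    for i j :: nat
  have W_unit: "W \<alpha> \<beta> (unit j) = v 0 j \<oplus>\<^bsub>K\<^esub> of_real \<alpha> \<odot>\<^bsub>K\<^esub> v 1 j \<oplus>\<^bsub>K\<^esub> of_real \<beta> \<odot>\<^bsub>K\<^esub> v 2 j"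
    if "j < 3" for \<alpha> \<beta> j using that by (simp add: W_def v_def)
  show False
  proof (rule choi_not_factorizable[OF K])
    show "v i j \<in> carrier K" for i j
      using bounded_opD(1)[OF V(1) unit_carrier] bounded_opD(1)[OF V(2) unit_carrier]
        bounded_opD(1)[OF V(3) unit_carrier] by (simp add: v_def)
    fix \<alpha> \<beta> and j l :: nat assume j: "j < 3" and l: "l < 3"
    have "ip K (W \<alpha> \<beta> (unit j)) (W \<alpha> \<beta> (unit l)) = ip form_space (Qhat c d form_space T S \<alpha> \<beta> (unit j)) (unit l)"
      using ip_adj[OF hilbert_space_form_space K W bounded_opD(1)[OF W unit_carrier[OF j]] unit_carrier[OF l]]
        eq[OF unit_carrier[OF j], of \<alpha> \<beta>] by (simp add: W_def[abs_def])
    thus "ip K (v 0 j \<oplus>\<^bsub>K\<^esub> of_real \<alpha> \<odot>\<^bsub>K\<^esub> v 1 j \<oplus>\<^bsub>K\<^esub> of_real \<beta> \<odot>\<^bsub>K\<^esub> v 2 j)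
        (v 0 l \<oplus>\<^bsub>K\<^esub> of_real \<alpha> \<odot>\<^bsub>K\<^esub> v 1 l \<oplus>\<^bsub>K\<^esub> of_real \<beta> \<odot>\<^bsub>K\<^esub> v 2 l)
      = choi_form \<alpha> \<beta> (\<lambda>i. of_bool (i = j)) (\<lambda>i. of_bool (i = l))"
      by (simp add: W_unit j l ip_Qhat_unit)
  qed
qed

end

theorem proposition5:
  fixes c d :: real
  assumes "c > 0" and "d > 0"
  shows "\<exists>(H :: (nat \<Rightarrow> complex) hspace) T S.
           hilbert_space H \<and> three_isometric H T S \<and>
           invertible_op H T \<and> invertible_op H S \<and>
           class_F c d H T S \<and>
           \<not> pencil_factors c d H T S \<and>
           \<not> lifts_to_class_J c d H T S"
proof -
  interpret weighted_lattice c d by unfold_locales (fact assms)+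
  have nf: "\<not> pencil_factors c d form_space T S"
    unfolding pencil_factors_def using not_factors_through by blast
  hence "\<not> lifts_to_class_J c d form_space T S"
    using lifts_to_class_J_imp_pencil_factors[OF hilbert_space_form_space three_isometric_TS assms] by blast
  thus ?thesis
    using hilbert_space_form_space three_isometric_TS invertible_translate[of 1 0] invertible_translate[of 0 1]
      class_F_TS nf by (intro exI[of _ form_space] exI[of _ T] exI[of _ S]) simp
qed

end
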